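(* Let $(J^s)_{s\in(1/2,1)}$ satisfy Hypotheses (H1) and (H2) below with constant $\delta>0$ and limit kernel $J^1$. Let $0\le k<m<M\le1$, $\eta>2+\delta$, $\theta=\frac{m-k}{m+d/2}$, $\varepsilon\in(0,1)$, and $u_0\in L^1_M\cap H^\eta$. Let $u^s_\varepsilon$ be the solution of $\partial_tu=\varepsilon^{-2s}(J^s_\varepsilon*u-u)+\mathrm{div}(xu)$ and $u_\varepsilon$ the solution of $\partial_tu=\varepsilon^{-2}(J^1_\varepsilon*u-u)+\mathrm{div}(xu)$, both with initial datum $u_0$. Then for every $T^*>0$ there exists $C=C(d,k,M,m,u_0)$ such that for all $t\in[0,T^*]$ $$\|u^s_\varepsilon(t)-u_\varepsilon(t)\|_{L^1_k}\le C(1-s)^\theta\big(1+\varepsilon^{\delta\theta}|\log\varepsilon|\big).$$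
   Context: $\langle x\rangle=(1+|x|^2)^{1/2}$; $\|f\|_{L^1_k}=\int\langle x\rangle^k|f|$; $H^\eta$ the $L^2$-Sobolev space; $\hat f(\xi)=\int e^{-ix\cdot\xi}f$; $J_\varepsilon(x)=\varepsilon^{-d}J(x/\varepsilon)$; solutions are mild solutions in $C([0,\infty);L^1_k)$. Hypothesis (H1): $(J^s)_{s\in(1/2,1)}$ is a family of probability densities on $\mathbb{R}^d$ with $J^s\in L^1\cap L^p$ for some $p\in(1,\infty]$, such that (i) $\int\min\{1,|y|^2\}J^s<\infty$; (ii) there exist $\delta,C_0>0$ independent of $s$ with $\hat J^s(\xi)=1-|\xi|^{2s}+R_s(\xi)$, $|R_s(\xi)|\le C_0|\xi|^{2s+\delta}$ for $|\xi|\le1$; (iii) there exist $C,R>0$, $\Psi$ with $\int(1+|x|^2)|\Psi|<\infty$, $\int x\Psi=0$, independent of $s$, with $J^s(x)\le C(1-s)|x|^{-d-2s}+\Psi(x)$ for $|x|\ge R$. Hypothesis (H2): $J^1$ is a probability density with $\hat J^1(\xi)=1-|\xi|^2+R_1(\xi)$, $|R_1(\xi)|\le C_0|\xi|^{2+\delta}$ for $|\xi|\le1$, and there is $\mathfrak C>0$ with $\left|\frac{1-\hat J^s(\xi)}{|\xi|^{2s}}-\frac{1-\hat J^1(\xi)}{|\xi|^2}\right|\le\mathfrak C(1-s)|\xi|^\delta\max(1,|\log|\xi||)$ for all $s\in(1/2,1)$, $\xi\in\mathbb{R}^d$. *)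

theory Defs
  imports "HOL-Analysis.Analysis"
begin

definition jbr :: "'a::real_normed_vector \<Rightarrow> real" where
  "jbr x = sqrt (1 + (norm x)\<^sup>2)"

definition L1w :: "real \<Rightarrow> ('a::euclidean_space \<Rightarrow> real) \<Rightarrow> bool" where
  "L1w k f \<longleftrightarrow> f \<in> borel_measurable lborel \<and>
      integrable lborel (\<lambda>x. jbr x powr k * \<bar>f x\<bar>)"

definition L1w_norm :: "real \<Rightarrow> ('a::euclidean_space \<Rightarrow> real) \<Rightarrow> real" where
  "L1w_norm k f = (\<integral>x. jbr x powr k * \<bar>f x\<bar> \<partial>lborel)"

definition fourier :: "('a::euclidean_space \<Rightarrow> real) \<Rightarrow> 'a \<Rightarrow> complex" where
  "fourier f \<xi> = (\<integral>x. cis (- (x \<bullet> \<xi>)) * complex_of_real (f x) \<partial>lborel)"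

text \<open>Sobolev space H^eta (for an L^1 function, via its Fourier transform).\<close>
definition sobolev_H :: "real \<Rightarrow> ('a::euclidean_space \<Rightarrow> real) \<Rightarrow> bool" where
  "sobolev_H \<eta> f \<longleftrightarrow> f \<in> borel_measurable lborel \<and>
      integrable lborel (\<lambda>x. (f x)\<^sup>2) \<and>
      integrable lborel (\<lambda>\<xi>. (1 + (norm \<xi>)\<^sup>2) powr \<eta> * (cmod (fourier f \<xi>))\<^sup>2)"

definition prob_density :: "('a::euclidean_space \<Rightarrow> real) \<Rightarrow> bool" where
  "prob_density J \<longleftrightarrow> J \<in> borel_measurable lborel \<and> (AE x in lborel. 0 \<le> J x) \<and>
      integrable lborel J \<and> (\<integral>x. J x \<partial>lborel) = 1"

definition in_Lp_some :: "('a::euclidean_space \<Rightarrow> real) \<Rightarrow> bool" where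
  "in_Lp_some J \<longleftrightarrow> (\<exists>p>1. integrable lborel (\<lambda>x. \<bar>J x\<bar> powr p)) \<or>
      (\<exists>B. AE x in lborel. \<bar>J x\<bar> \<le> B)"

definition rescale :: "real \<Rightarrow> ('a::euclidean_space \<Rightarrow> real) \<Rightarrow> 'a \<Rightarrow> real" where
  "rescale \<epsilon> J x = \<epsilon> powr (- real DIM('a)) * J (inverse \<epsilon> *\<^sub>R x)"

definition conv :: "('a::euclidean_space \<Rightarrow> real) \<Rightarrow> ('a \<Rightarrow> real) \<Rightarrow> 'a \<Rightarrow> real" where
  "conv J f x = (\<integral>y. J (x - y) * f y \<partial>lborel)"

text \<open>Mild solution in C([0,infinity); L^1_k) of
  d/dt u = lam (K * u - u) + div(x u),  u(0) = u0.
  The group generated by div(x .) is  (e^{tA} f)(x) = e^{dt} f(e^t x), so the Duhamel formula reads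
  u(t,x) = e^{(d-lam)t} u0(e^t x) + int_0^t lam e^{(d-lam)(t-tau)} (K*u(tau))(e^{t-tau} x) dtau.\<close>
definition mild_solution ::
  "real \<Rightarrow> real \<Rightarrow> ('a::euclidean_space \<Rightarrow> real) \<Rightarrow> ('a \<Rightarrow> real) \<Rightarrow> (real \<Rightarrow> 'a \<Rightarrow> real) \<Rightarrow> bool" where
  "mild_solution k lam K u0 u \<longleftrightarrow>
     (\<forall>t\<ge>0. L1w k (u t)) \<and>
     (\<forall>t0\<ge>0. ((\<lambda>t. L1w_norm k (\<lambda>x. u t x - u t0 x)) \<longlongrightarrow> 0) (at t0 within {0..})) \<and>
     (\<forall>t\<ge>0. AE x in lborel.
        set_integrable lborel {0..t}
          (\<lambda>\<tau>. lam * exp ((real DIM('a) - lam) * (t - \<tau>)) * conv K (u \<tau>) (exp (t - \<tau>) *\<^sub>R x)) \<and>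
        u t x = exp ((real DIM('a) - lam) * t) * u0 (exp t *\<^sub>R x) +
          (LINT \<tau>:{0..t}|lborel. lam * exp ((real DIM('a) - lam) * (t - \<tau>)) * conv K (u \<tau>) (exp (t - \<tau>) *\<^sub>R x)))"

definition H1 :: "real \<Rightarrow> (real \<Rightarrow> 'a::euclidean_space \<Rightarrow> real) \<Rightarrow> bool" where
  "H1 \<delta> J \<longleftrightarrow>
     (\<forall>s\<in>{1/2<..<1}. prob_density (J s) \<and> in_Lp_some (J s) \<and>
         integrable lborel (\<lambda>y. min 1 ((norm y)\<^sup>2) * J s y)) \<and>
     (\<exists>C0>0. \<forall>s\<in>{1/2<..<1}. \<forall>\<xi>::'a. norm \<xi> \<le> 1 \<longrightarrow>
         cmod (fourier (J s) \<xi> - (1 - complex_of_real (norm \<xi> powr (2 * s))))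
           \<le> C0 * norm \<xi> powr (2 * s + \<delta>)) \<and>
     (\<exists>C>0. \<exists>R>0. \<exists>\<Psi>::'a \<Rightarrow> real. \<Psi> \<in> borel_measurable lborel \<and>
         integrable lborel (\<lambda>x. (1 + (norm x)\<^sup>2) * \<bar>\<Psi> x\<bar>) \<and>
         (\<integral>x. \<Psi> x *\<^sub>R x \<partial>lborel) = 0 \<and>
         (\<forall>s\<in>{1/2<..<1}. \<forall>x. norm x \<ge> R \<longrightarrow>
            J s x \<le> C * (1 - s) * norm x powr (- real DIM('a) - 2 * s) + \<Psi> x))"

definition H2 :: "real \<Rightarrow> (real \<Rightarrow> 'a::euclidean_space \<Rightarrow> real) \<Rightarrow> ('a \<Rightarrow> real) \<Rightarrow> bool" where
  "H2 \<delta> J J1 \<longleftrightarrow>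
     prob_density J1 \<and>
     (\<exists>C0>0. \<forall>\<xi>::'a. norm \<xi> \<le> 1 \<longrightarrow>
         cmod (fourier J1 \<xi> - (1 - complex_of_real ((norm \<xi>)\<^sup>2))) \<le> C0 * norm \<xi> powr (2 + \<delta>)) \<and>
     (\<exists>CC>0. \<forall>s\<in>{1/2<..<1}. \<forall>\<xi>::'a. \<xi> \<noteq> 0 \<longrightarrow>
         cmod ((1 - fourier (J s) \<xi>) / complex_of_real (norm \<xi> powr (2 * s))
               - (1 - fourier J1 \<xi>) / complex_of_real ((norm \<xi>)\<^sup>2))
           \<le> CC * (1 - s) * norm \<xi> powr \<delta> * max 1 \<bar>ln (norm \<xi>)\<bar>)"

end

theory Submission
  imports Defs "HOL-Probability.Characteristic_Functions"
begin

text \<open>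
  In the coordinates \<open>y = e^t x\<close> the mild formula is a Duhamel formula with the kernel dilated by \<open>e^\<tau>\<close>,
  and its Fourier transform is a scalar linear equation: the transform of the solution at \<open>e^t \<zeta>\<close> is that
  of \<open>u0\<close> at \<open>\<zeta>\<close> times the exponential of the time integral of the symbol along \<open>e^\<tau> \<zeta>\<close>. All symbols
  have nonpositive real part, so (H2) and the smoothness of \<open>u0\<close> bound the L2 difference of the two
  solutions by a multiple of \<open>(1 - s) (1 + \<epsilon>^\<delta> |ln \<epsilon>|)\<close>.

  Moments of order \<open>m < 1\<close> are bounded uniformly in \<open>s\<close> and \<open>\<epsilon>\<close>: up to a constant, \<open>|x_i|^m\<close> is the integral
  of \<open>(1 - cos (r x_i)) r^(-1-m)\<close> over \<open>r > 0\<close>, and for each \<open>r\<close> the integral of \<open>1 - cos (r x_i)\<close> against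
  \<open>|u|\<close> obeys a Gronwall inequality whose source is the symbol at a point of the \<open>i\<close>-th axis, which is
  \<open>O(r)\<close> because \<open>2 s > 1\<close>. Splitting the weighted L1 norm at a radius that balances the two bounds
  gives the exponent \<open>\<theta>\<close>.
\<close>

section \<open>Affine changes of variables, convolution and the Fourier transform\<close>

text \<open>The jump rate \<open>lam\<close>, equal to \<epsilon>^(-2s) or \<epsilon>^(-2), is
  unbounded, so no estimate may lose a factor depending on it. In the coordinates y the unknown
  carries the integrating factor e^(lam t); every Gronwall bound loses exactly this factor, which
  cancels on the way back to x. What remains sees the kernel only through \<open>lam\<close> times 1
  minus its transform, and by scaling this is O(|\<omega>|^(2s)) at frequency \<omega>, uniformly in
  \<epsilon>. The datum may change sign, so moments are propagated for |u|, which satisfies only an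
  inequality. The weight 1 - cos suits this: convolution acts on its integral through the transform
  at a single frequency. (H2) compares the symbols only after division by |\<xi>|^(2s) and
  |\<xi>|^2. Exchanging one power for the other costs a logarithm of the frequency; this one and the
  one in (H2) are absorbed by the margin \<eta> - 2 - \<delta>. With X the size of the L2
  difference, the part inside radius \<rho> is at most \<rho>^(k+d/2) X and the part outside at most
  \<rho>^(k-m), up to constants. They agree for \<rho> = X^(-1/(m+d/2)), which gives
  X^\<theta>.\<close>

lemma nn_integral_lborel_affine:
  fixes f :: "'a::euclidean_space \<Rightarrow> ennreal"
  assumes [measurable]: "f \<in> borel_measurable borel" and c: "c \<noteq> 0"
  shows "(\<integral>\<^sup>+x. f x \<partial>lborel) = ennreal (\<bar>c\<bar> ^ DIM('a)) * (\<integral>\<^sup>+x. f (t + c *\<^sub>R x) \<partial>lborel)"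
  by (subst lborel_affine[OF c, of t])
     (simp add: nn_integral_density nn_integral_distr nn_integral_cmult)

lemma lborel_integrable_affine:
  fixes f :: "'a::euclidean_space \<Rightarrow> 'b::{banach, second_countable_topology}"
  assumes f: "integrable lborel f" and c: "c \<noteq> 0"
  shows "integrable lborel (\<lambda>x. f (t + c *\<^sub>R x))"
  using f f[THEN borel_measurable_integrable] c unfolding integrable_iff_bounded
  by (subst (asm) nn_integral_lborel_affine[where c=c and t=t]) (auto simp: ennreal_mult_less_top)

lemma lborel_integrable_affine_iff:
  fixes f :: "'a::euclidean_space \<Rightarrow> 'b::{banach, second_countable_topology}"
  assumes "c \<noteq> 0"
  shows "integrable lborel (\<lambda>x. f (t + c *\<^sub>R x)) \<longleftrightarrow> integrable lborel f"
  using lborel_integrable_affine[of f c t] assms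
    lborel_integrable_affine[of "\<lambda>x. f (t + c *\<^sub>R x)" "1/c" "- (1/c) *\<^sub>R t"]
  by (auto simp: algebra_simps)

lemma lborel_integral_affine:
  fixes f :: "'a::euclidean_space \<Rightarrow> 'b::{banach, second_countable_topology}"
  assumes c: "c \<noteq> 0"
  shows "(\<integral>x. f x \<partial>lborel) = (\<bar>c\<bar> ^ DIM('a)) *\<^sub>R (\<integral>x. f (t + c *\<^sub>R x) \<partial>lborel)"
proof cases
  assume f[measurable]: "integrable lborel f" then show ?thesis
    using c f f[THEN borel_measurable_integrable] f[THEN lborel_integrable_affine, of c t]
    by (subst lborel_affine[OF c, of t])
       (simp add: integral_density integral_distr)
next
  assume "\<not> integrable lborel f" with c show ?thesis
    by (simp add: lborel_integrable_affine_iff not_integrable_integral_eq)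
qed

text \<open>Null sets are preserved by invertible affine maps. This carries the almost-everywhere
  identity of the mild formula into the expanding coordinates.\<close>

lemma AE_lborel_affine:
  fixes t :: "'a::euclidean_space"
  assumes c: "c \<noteq> 0" and P: "AE x in lborel. P x"
  shows "AE x in lborel. P (t + c *\<^sub>R x)"
proof -
  obtain N where N: "N \<in> null_sets lborel" "{x. \<not> P x} \<subseteq> N"
    using P by (auto simp: eventually_ae_filter)
  have [measurable]: "N \<in> sets borel" using N(1) by auto
  have *: "AE x in lborel. x \<notin> N" using N(1) by (rule AE_not_in)
  have "AE x in lborel. t + c *\<^sub>R x \<notin> N"
    using * c
    by (subst (asm) lborel_affine[OF c, of t])
       (simp add: AE_density AE_distr_iff)
  then show ?thesis by (rule AE_mp) (use N(2) in auto)
qed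

lemma lborel_integral_diff_reflect:
  fixes f :: "'a::euclidean_space \<Rightarrow> 'b::{banach, second_countable_topology}"
  shows "(\<integral>y. f (x - y) \<partial>lborel) = (\<integral>y. f y \<partial>lborel)"
  using lborel_integral_affine[of "-1" f x] by simp

lemma lborel_integral_translate:
  fixes f :: "'a::euclidean_space \<Rightarrow> 'b::{banach, second_countable_topology}"
  shows "(\<integral>y. f (y - x) \<partial>lborel) = (\<integral>y. f y \<partial>lborel)"
  using lborel_integral_affine[of "1" f "-x"] by simp

lemma lborel_integrable_translate:
  fixes f :: "'a::euclidean_space \<Rightarrow> 'b::{banach, second_countable_topology}"
  assumes "integrable lborel f"
  shows "integrable lborel (\<lambda>y. f (y - x))"
  using lborel_integrable_affine[OF assms, of "1" "-x"] by simp

section \<open>Convolution of integrable functions\<close>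

lemma conv_integrable_pair:
  fixes K f :: "'a::euclidean_space \<Rightarrow> real"
  assumes K: "integrable lborel K" and f: "integrable lborel f"
  shows "integrable (lborel \<Otimes>\<^sub>M lborel) (\<lambda>(y, x). K (x - y) * f y)"
proof -
  have [measurable]: "K \<in> borel_measurable borel" "f \<in> borel_measurable borel"
    using K f by auto
  show ?thesis
  proof (rule lborel_pair.Fubini_integrable)
    show "integrable lborel (\<lambda>y. \<integral>x. norm (case (y, x) of (y, x) \<Rightarrow> K (x - y) * f y) \<partial>lborel)"
      using f by (simp add: abs_mult lborel_integral_translate[of "\<lambda>x. \<bar>K x\<bar>"])
    show "AE y in lborel. integrable lborel (\<lambda>x. case (y, x) of (y, x) \<Rightarrow> K (x - y) * f y)"
      using lborel_integrable_translate[OF K] by auto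
  qed measurable
qed

lemma conv_integrable_pair':
  fixes K f :: "'a::euclidean_space \<Rightarrow> real"
  assumes K: "integrable lborel K" and f: "integrable lborel f"
  shows "integrable (lborel \<Otimes>\<^sub>M lborel) (\<lambda>(x, y). K (x - y) * f y)"
  using lborel_pair.integrable_product_swap[OF conv_integrable_pair[OF assms]] by simp

lemma integrable_conv:
  fixes K f :: "'a::euclidean_space \<Rightarrow> real"
  assumes K: "integrable lborel K" and f: "integrable lborel f"
  shows "integrable lborel (conv K f)"
  using lborel_pair.integrable_fst'[OF conv_integrable_pair'[OF assms]] by (simp add: conv_def[abs_def])

lemma AE_conv_integrable:
  fixes K f :: "'a::euclidean_space \<Rightarrow> real"
  assumes K: "integrable lborel K" and f: "integrable lborel f"
  shows "AE x in lborel. integrable lborel (\<lambda>y. K (x - y) * f y)"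
  using lborel_pair.AE_integrable_fst'[OF conv_integrable_pair'[OF assms]] by simp

section \<open>The Fourier transform and its action on convolutions\<close>

lemma cis_inner_measurable [measurable]: "(\<lambda>x::'a::euclidean_space. cis (- (x \<bullet> \<xi>))) \<in> borel_measurable borel"
  by (intro borel_measurable_continuous_onI continuous_intros)

lemma integrable_cis_mult:
  fixes f :: "'a::euclidean_space \<Rightarrow> real"
  assumes f: "integrable lborel f"
  shows "integrable lborel (\<lambda>x. cis (- (x \<bullet> \<xi>)) * complex_of_real (f x))"
proof (rule Bochner_Integration.integrable_bound[OF f])
  have [measurable]: "f \<in> borel_measurable borel" using f by auto
  show "(\<lambda>x. cis (- (x \<bullet> \<xi>)) * complex_of_real (f x)) \<in> borel_measurable lborel"
    by measurable
qed (simp add: norm_mult)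

lemma fourier_conv:
  fixes K f :: "'a::euclidean_space \<Rightarrow> real"
  assumes K: "integrable lborel K" and f: "integrable lborel f"
  shows "fourier (conv K f) \<xi> = fourier K \<xi> * fourier f \<xi>"
proof -
  have [measurable]: "K \<in> borel_measurable borel" "f \<in> borel_measurable borel"
    using K f by auto
  have int: "integrable (lborel \<Otimes>\<^sub>M lborel) (\<lambda>(x, y). cis (- (x \<bullet> \<xi>)) * complex_of_real (K (x - y) * f y))"
    by (rule Bochner_Integration.integrable_bound[OF conv_integrable_pair'[OF assms]])
       (measurable, auto simp: norm_mult)
  have "fourier (conv K f) \<xi> = (\<integral>x. (\<integral>y. cis (- (x \<bullet> \<xi>)) * complex_of_real (K (x - y) * f y) \<partial>lborel) \<partial>lborel)"
    unfolding fourier_def conv_def by (simp del: of_real_mult flip: integral_complex_of_real)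
  also have "\<dots> = (\<integral>y. (\<integral>x. cis (- (x \<bullet> \<xi>)) * complex_of_real (K (x - y) * f y) \<partial>lborel) \<partial>lborel)"
    using lborel_pair.Fubini_integral[of "\<lambda>x y. cis (- (x \<bullet> \<xi>)) * complex_of_real (K (x - y) * f y)"] int
    by simp
  also have "\<dots> = (\<integral>y. cis (- (y \<bullet> \<xi>)) * complex_of_real (f y) * fourier K \<xi> \<partial>lborel)"
  proof (rule Bochner_Integration.integral_cong[OF refl])
    fix y :: 'a
    have c: "cis (- (x \<bullet> \<xi>)) = cis (- (y \<bullet> \<xi>)) * cis (- ((x - y) \<bullet> \<xi>))" for x
      by (simp add: cis_mult inner_diff_left)
    have "(\<integral>x. cis (- (x \<bullet> \<xi>)) * complex_of_real (K (x - y) * f y) \<partial>lborel) =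
       (\<integral>x. cis (- (y \<bullet> \<xi>)) * complex_of_real (f y) * (cis (- ((x - y) \<bullet> \<xi>)) * complex_of_real (K (x - y))) \<partial>lborel)"
      by (subst c) (simp add: mult_ac)
    also have "\<dots> = cis (- (y \<bullet> \<xi>)) * complex_of_real (f y) * fourier K \<xi>"
      by (simp add: fourier_def lborel_integral_translate[of "\<lambda>x. cis (- (x \<bullet> \<xi>)) * complex_of_real (K x)"])
    finally show "(\<integral>x. cis (- (x \<bullet> \<xi>)) * complex_of_real (K (x - y) * f y) \<partial>lborel)
       = cis (- (y \<bullet> \<xi>)) * complex_of_real (f y) * fourier K \<xi>" .
  qed
  also have "\<dots> = fourier K \<xi> * fourier f \<xi>"
    by (simp add: fourier_def)
  finally show ?thesis .
qed

lemma fourier_0: "fourier f 0 = complex_of_real (\<integral>x. f x \<partial>lborel)"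
  by (simp add: fourier_def)

lemma norm_fourier_le: "cmod (fourier f \<xi>) \<le> (\<integral>x. \<bar>f x\<bar> \<partial>lborel)"
  unfolding fourier_def using integral_norm_bound[of lborel "\<lambda>x. cis (- (x \<bullet> \<xi>)) * complex_of_real (f x)"]
  by (simp add: norm_mult)

lemma fourier_diff:
  assumes "integrable lborel f" "integrable lborel g"
  shows "fourier (\<lambda>x. f x - g x) \<xi> = fourier f \<xi> - fourier g \<xi>"
  using assms by (simp add: fourier_def right_diff_distrib integrable_cis_mult)

lemma continuous_fourier:
  fixes f :: "'a::euclidean_space \<Rightarrow> real"
  assumes f: "integrable lborel f"
  shows "continuous_on A (fourier f)"
proof -
  have [measurable]: "f \<in> borel_measurable borel" using f by auto
  show ?thesis
    unfolding fourier_def continuous_on_sequentially comp_def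
  proof safe
    fix X :: "nat \<Rightarrow> 'a" and a assume X: "X \<longlonglongrightarrow> a"
    show "(\<lambda>n. \<integral>x. cis (- (x \<bullet> X n)) * complex_of_real (f x) \<partial>lborel) \<longlonglongrightarrow>
       (\<integral>x. cis (- (x \<bullet> a)) * complex_of_real (f x) \<partial>lborel)"
    proof (rule integral_dominated_convergence[where w="\<lambda>x. \<bar>f x\<bar>"])
      show "AE x in lborel. (\<lambda>n. cis (- (x \<bullet> X n)) * complex_of_real (f x)) \<longlonglongrightarrow> cis (- (x \<bullet> a)) * complex_of_real (f x)"
        using X by (intro AE_I2 tendsto_intros)
    qed (use f in \<open>auto simp: norm_mult\<close>)
  qed
qed

lemma fourier_measurable:
  fixes f :: "'a::euclidean_space \<Rightarrow> real"
  assumes f: "integrable lborel f"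
  shows "fourier f \<in> borel_measurable borel"
  by (intro borel_measurable_continuous_onI continuous_fourier f)

lemma integral_conv:
  assumes K: "integrable lborel K" and f: "integrable lborel f"
  shows "(\<integral>x. conv K f x \<partial>lborel) = (\<integral>x. K x \<partial>lborel) * (\<integral>x. f x \<partial>lborel)"
  using fourier_conv[OF assms, of 0] unfolding fourier_0 by (simp flip: of_real_mult)

text \<open>Expresses the weight 1 - cos through Fourier data at one frequency, where convolution
  becomes multiplication. The moment bounds rest on this.\<close>

lemma integral_one_minus_cos:
  fixes f :: "'a::euclidean_space \<Rightarrow> real"
  assumes f: "integrable lborel f"
  shows "(\<integral>x. (1 - cos (x \<bullet> \<xi>)) * f x \<partial>lborel) = (\<integral>x. f x \<partial>lborel) - Re (fourier f \<xi>)"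
    and "integrable lborel (\<lambda>x. (1 - cos (x \<bullet> \<xi>)) * f x)"
proof -
  have c: "integrable lborel (\<lambda>x. cos (x \<bullet> \<xi>) * f x)"
    using integrable_Re[OF integrable_cis_mult[OF f, of \<xi>]] by simp
  have "Re (fourier f \<xi>) = (\<integral>x. cos (x \<bullet> \<xi>) * f x \<partial>lborel)"
    unfolding fourier_def by (subst integral_Re[symmetric]) (auto intro: integrable_cis_mult f)
  then show "(\<integral>x. (1 - cos (x \<bullet> \<xi>)) * f x \<partial>lborel) = (\<integral>x. f x \<partial>lborel) - Re (fourier f \<xi>)"
    and "integrable lborel (\<lambda>x. (1 - cos (x \<bullet> \<xi>)) * f x)"
    using f c by (auto simp: left_diff_distrib)
qed

lemma conv_nonneg:
  assumes "\<And>x. 0 \<le> K x" "\<And>x. 0 \<le> f x" shows "0 \<le> conv K f x"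
  unfolding conv_def using assms by (intro Bochner_Integration.integral_nonneg) auto

lemma abs_conv_le:
  fixes K :: "'a::euclidean_space \<Rightarrow> real"
  assumes "\<And>x. 0 \<le> K x" shows "\<bar>conv K f x\<bar> \<le> conv K (\<lambda>y. \<bar>f y\<bar>) x"
  unfolding conv_def using integral_norm_bound[of lborel "\<lambda>y. K (x - y) * f y"] assms
  by (simp add: abs_mult)

text \<open>Equality holds at every x, not just almost everywhere, because y \<mapsto> x - y
  preserves null sets. So changing kernel and function on null sets does not disturb the Duhamel
  integrand.\<close>

lemma conv_cong_AE:
  fixes K L f g :: "'a::euclidean_space \<Rightarrow> real"
  assumes [measurable]: "K \<in> borel_measurable borel" "L \<in> borel_measurable borel"
    "f \<in> borel_measurable borel" "g \<in> borel_measurable borel"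
  and K: "AE x in lborel. K x = L x" and f: "AE x in lborel. f x = g x"
  shows "conv K f x = conv L g x"
  unfolding conv_def
proof (rule integral_cong_AE)
  have "AE y in lborel. K (x - y) = L (x - y)"
    using AE_lborel_affine[OF _ K, of "-1" x] by simp
  with f show "AE y in lborel. K (x - y) * f y = L (x - y) * g y"
    by eventually_elim simp
qed measurable

section \<open>Duhamel equations with a convolution kernel\<close>

text \<open>Homogeneous Gronwall for functions that are only bounded and measurable. The norms and
  transforms to which it is applied are not known to be continuous in time.\<close>

lemma gronwall_nonpos:
  fixes w :: "real \<Rightarrow> real"
  assumes lam: "0 \<le> lam" and T: "0 \<le> T"
    and [measurable]: "w \<in> borel_measurable borel"
    and bd: "\<And>t. t \<in> {0..T} \<Longrightarrow> \<bar>w t\<bar> \<le> B"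
    and le: "\<And>t. t \<in> {0..T} \<Longrightarrow> w t \<le> (LINT \<tau>:{0..t}|lborel. lam * w \<tau>)"
    and t: "t \<in> {0..T}"
  shows "w t \<le> 0"
proof -
  \<comment> \<open>With the weight e^(-2 lam t) the Volterra operator gains a factor 1/2, so a
    positive \<open>S\<close> would satisfy \<open>S \<le> S / 2\<close>.\<close>
  define S where "S = (SUP t\<in>{0..T}. exp (- 2 * lam * t) * w t)"
  have e1: "exp (- 2 * lam * t) * w t \<le> B" if "t \<in> {0..T}" for t
  proof -
    have "exp (- 2 * lam * t) * w t \<le> exp (- 2 * lam * t) * B"
      using bd[OF that] by (intro mult_left_mono) auto
    also have "\<dots> \<le> 1 * B"
      using bd[OF that] that lam by (intro mult_right_mono) auto
    finally show ?thesis by simp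
  qed
  then have bdd: "bdd_above ((\<lambda>t. exp (- 2 * lam * t) * w t) ` {0..T})"
    by (rule bdd_aboveI2)
  have upper: "w t \<le> S * exp (2 * lam * t)" if "t \<in> {0..T}" for t
  proof -
    have "exp (- 2 * lam * t) * w t \<le> S"
      unfolding S_def by (rule cSUP_upper[OF that bdd])
    then have "exp (2 * lam * t) * (exp (- 2 * lam * t) * w t) \<le> exp (2 * lam * t) * S"
      by (intro mult_left_mono) auto
    then show ?thesis by (simp add: exp_minus field_simps)
  qed
  have "S \<le> 0"
  proof (rule ccontr)
    assume "\<not> S \<le> 0" then have S: "0 < S" by simp
    have "exp (- 2 * lam * t) * w t \<le> S / 2" if t: "t \<in> {0..T}" for t
    proof -
      have FTC: "(LINT \<tau>:{0..t}|lborel. lam * (S * exp (2 * lam * \<tau>))) = S / 2 * exp (2 * lam * t) - S / 2 * exp (2 * lam * 0)"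
        unfolding set_lebesgue_integral_def
        by (rule integral_FTC_atLeastAtMost)
           (use t in \<open>auto intro!: derivative_eq_intros continuous_intros
             simp flip: has_real_derivative_iff_has_vector_derivative\<close>)
      have i1: "set_integrable lborel {0..t} (\<lambda>\<tau>. lam * w \<tau>)"
        unfolding set_integrable_def
      proof (rule Bochner_Integration.integrable_bound)
        show "integrable lborel (\<lambda>x. indicator {0..t} x * (lam * B))"
      by (intro integrable_mult_left integrable_real_indicator) (auto simp: emeasure_lborel_Icc_eq)
        show "AE x in lborel. norm (indicator {0..t} x *\<^sub>R (lam * w x)) \<le> norm (indicator {0..t} x * (lam * B))"
        proof (rule AE_I2)
          fix x show "norm (indicator {0..t} x *\<^sub>R (lam * w x)) \<le> norm (indicator {0..t} x * (lam * B))"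
            using bd[of x] t lam by (cases "x \<in> {0..t}") (auto simp: abs_mult intro!: mult_mono)
        qed
      qed measurable
      have i2: "set_integrable lborel {0..t} (\<lambda>\<tau>. lam * (S * exp (2 * lam * \<tau>)))"
        by (intro borel_integrable_atLeastAtMost' continuous_intros)
      have "w t \<le> (LINT \<tau>:{0..t}|lborel. lam * w \<tau>)" by (rule le[OF t])
      also have "\<dots> \<le> (LINT \<tau>:{0..t}|lborel. lam * (S * exp (2 * lam * \<tau>)))"
        using upper t lam by (intro set_integral_mono i1 i2 mult_left_mono) auto
      also have "\<dots> \<le> S / 2 * exp (2 * lam * t)"
        unfolding FTC using S by simp
      finally have "exp (- 2 * lam * t) * w t \<le> exp (- 2 * lam * t) * (S / 2 * exp (2 * lam * t))"
        by (intro mult_left_mono) auto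
      also have "\<dots> = S / 2"
        by (simp add: exp_minus)
      finally show ?thesis .
    qed
    then have "S \<le> S / 2"
      unfolding S_def using T by (intro cSUP_least) auto
    with S show False by simp
  qed
  then show ?thesis
    using upper[OF t] by (meson exp_ge_zero mult_nonpos_nonneg order_trans)
qed

section \<open>Exchange of time and space integrals\<close>

lemma time_space_integrable:
  fixes g :: "real \<Rightarrow> 'a::euclidean_space \<Rightarrow> 'b::{banach, second_countable_topology}"
  assumes [measurable]: "case_prod g \<in> borel_measurable (borel \<Otimes>\<^sub>M borel)"
    and int: "\<And>\<tau>. integrable lborel (g \<tau>)"
    and C: "\<And>\<tau>. (\<integral>y. norm (g \<tau> y) \<partial>lborel) \<le> C"
  shows "integrable (lborel \<Otimes>\<^sub>M lborel) (\<lambda>(\<tau>, y). indicator {0..t::real} \<tau> *\<^sub>R g \<tau> y)"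
proof (rule lborel_pair.Fubini_integrable)
  have m: "(\<lambda>\<tau>. \<integral>y. norm (g \<tau> y) \<partial>lborel) \<in> borel_measurable borel"
    by measurable
  show "integrable lborel (\<lambda>\<tau>. \<integral>y. norm (case (\<tau>, y) of (\<tau>, y) \<Rightarrow> indicator {0..t} \<tau> *\<^sub>R g \<tau> y) \<partial>lborel)"
  proof (rule Bochner_Integration.integrable_bound)
    show "integrable lborel (\<lambda>\<tau>. indicator {0..t} \<tau> * C)"
      by (intro integrable_mult_left integrable_real_indicator) (auto simp: emeasure_lborel_Icc_eq)
    show "AE \<tau> in lborel. norm (\<integral>y. norm (case (\<tau>, y) of (\<tau>, y) \<Rightarrow> indicator {0..t} \<tau> *\<^sub>R g \<tau> y) \<partial>lborel) \<le> norm (indicator {0..t} \<tau> * C)"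
    proof (rule AE_I2)
      fix \<tau>
      have "0 \<le> (\<integral>y. norm (g \<tau> y) \<partial>lborel)" by simp
      with C[of \<tau>] have "\<bar>\<integral>y. norm (g \<tau> y) \<partial>lborel\<bar> \<le> \<bar>C\<bar>" by linarith
      then show "norm (\<integral>y. norm (case (\<tau>, y) of (\<tau>, y) \<Rightarrow> indicator {0..t} \<tau> *\<^sub>R g \<tau> y) \<partial>lborel) \<le> norm (indicator {0..t} \<tau> * C)"
        by (simp split: split_indicator)
    qed
  qed measurable
  show "AE x in lborel. integrable lborel (\<lambda>y. case (x, y) of (\<tau>, y) \<Rightarrow> indicator {0..t} \<tau> *\<^sub>R g \<tau> y)"
    using int by simp
qed measurable

lemma time_space_Fubini:
  fixes g :: "real \<Rightarrow> 'a::euclidean_space \<Rightarrow> 'b::{banach, second_countable_topology}"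
  assumes m: "case_prod g \<in> borel_measurable (borel \<Otimes>\<^sub>M borel)"
    and int: "\<And>\<tau>. integrable lborel (g \<tau>)"
    and C: "\<And>\<tau>. (\<integral>y. norm (g \<tau> y) \<partial>lborel) \<le> C"
  shows "AE y in lborel. set_integrable lborel {0..t::real} (\<lambda>\<tau>. g \<tau> y)"
    and "integrable lborel (\<lambda>y. LINT \<tau>:{0..t}|lborel. g \<tau> y)"
    and "(\<integral>y. (LINT \<tau>:{0..t}|lborel. g \<tau> y) \<partial>lborel) = (LINT \<tau>:{0..t}|lborel. (\<integral>y. g \<tau> y \<partial>lborel))"
proof -
  note I = time_space_integrable[OF m int C, of t]
  note I' = lborel_pair.integrable_product_swap[OF I]
  show "AE y in lborel. set_integrable lborel {0..t::real} (\<lambda>\<tau>. g \<tau> y)"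
    using lborel_pair.AE_integrable_fst'[OF I'] by (simp add: set_integrable_def)
  show "integrable lborel (\<lambda>y. LINT \<tau>:{0..t}|lborel. g \<tau> y)"
    using lborel_pair.integrable_fst'[OF I'] by (simp add: set_lebesgue_integral_def)
  show "(\<integral>y. (LINT \<tau>:{0..t}|lborel. g \<tau> y) \<partial>lborel) = (LINT \<tau>:{0..t}|lborel. (\<integral>y. g \<tau> y \<partial>lborel))"
    using lborel_pair.Fubini_integral[OF I] by (simp add: set_lebesgue_integral_def)
qed

lemma conv_measurable_pair:
  fixes K V :: "real \<Rightarrow> 'a::euclidean_space \<Rightarrow> real"
  assumes K: "case_prod K \<in> borel_measurable (borel \<Otimes>\<^sub>M borel)"
    and V: "case_prod V \<in> borel_measurable (borel \<Otimes>\<^sub>M borel)"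
  shows "(\<lambda>(\<tau>, y). conv (K \<tau>) (V \<tau>) y) \<in> borel_measurable (borel \<Otimes>\<^sub>M borel)"
proof -
  have "(\<lambda>p. (fst (fst p), snd (fst p) - snd p)) \<in> ((borel \<Otimes>\<^sub>M borel) \<Otimes>\<^sub>M lborel) \<rightarrow>\<^sub>M (borel \<Otimes>\<^sub>M (borel :: 'a measure))"
    by measurable
  from measurable_compose[OF this K]
  have 1: "(\<lambda>p. K (fst (fst p)) (snd (fst p) - snd p)) \<in> borel_measurable ((borel \<Otimes>\<^sub>M borel) \<Otimes>\<^sub>M lborel)"
    by simp
  have "(\<lambda>p. (fst (fst p), snd p)) \<in> ((borel \<Otimes>\<^sub>M borel) \<Otimes>\<^sub>M lborel) \<rightarrow>\<^sub>M (borel \<Otimes>\<^sub>M (borel :: 'a measure))"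
    by measurable
  from measurable_compose[OF this V]
  have 2: "(\<lambda>p. V (fst (fst p)) (snd p)) \<in> borel_measurable ((borel \<Otimes>\<^sub>M (borel :: 'a measure)) \<Otimes>\<^sub>M lborel)"
    by simp
  have "(\<lambda>q. \<integral>z. K (fst q) (snd q - z) * V (fst q) z \<partial>lborel) \<in> borel_measurable (borel \<Otimes>\<^sub>M borel)"
    by (rule lborel.borel_measurable_lebesgue_integral) (use 1 2 in \<open>simp add: split_beta'\<close>)
  then show ?thesis by (simp add: conv_def split_beta')
qed

lemma set_lborel_integral_singleton:
  fixes f :: "real \<Rightarrow> 'b::{banach, second_countable_topology}"
  shows "(LINT x:{a}|lborel. f x) = 0"
  unfolding set_lebesgue_integral_def
  by (rule integral_eq_zero_AE, rule AE_mp[OF AE_lborel_singleton[of a]]) (auto split: split_indicator)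

lemma set_lborel_has_vector_derivative:
  fixes b :: "real \<Rightarrow> 'b::euclidean_space"
  assumes b: "continuous_on {0..T} b" and t: "t \<in> {0..T}"
  shows "((\<lambda>t. LINT \<tau>:{0..t}|lborel. b \<tau>) has_vector_derivative b t) (at t within {0..T})"
proof -
  have "((\<lambda>t. integral {0..t} b) has_vector_derivative b t) (at t within {0..T})"
    by (rule integral_has_vector_derivative[OF b t])
  moreover have "integral {0..s} b = (LINT \<tau>:{0..s}|lborel. b \<tau>)" if "s \<in> {0..T}" for s
    by (rule set_borel_integral_eq_integral(2)[symmetric], rule borel_integrable_atLeastAtMost')
       (use that continuous_on_subset[OF b] in auto)
  ultimately show ?thesis
    using t by (intro has_vector_derivative_transform[where g="\<lambda>t. LINT \<tau>:{0..t}|lborel. b \<tau>"]) auto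
qed

lemma set_integrable_bounded_Icc:
  fixes q :: "real \<Rightarrow> 'b::{banach, second_countable_topology}"
  assumes [measurable]: "q \<in> borel_measurable borel" and bd: "\<And>t. t \<in> {0..T} \<Longrightarrow> norm (q t) \<le> B"
    and t: "t \<in> {0..T}"
  shows "set_integrable lborel {0..t} q"
  unfolding set_integrable_def
proof (rule Bochner_Integration.integrable_bound)
  show "integrable lborel (\<lambda>x. indicator {0..t} x * B)"
    by (intro integrable_mult_left integrable_real_indicator) (auto simp: emeasure_lborel_Icc_eq)
  show "AE x in lborel. norm (indicator {0..t} x *\<^sub>R q x) \<le> norm (indicator {0..t} x * B)"
    using bd t by (intro AE_I2) (force split: split_indicator)
qed measurable

text \<open>The comparison function \<open>y\<close> satisfies the integral relation with equality,
  by the fundamental theorem of calculus, so the source \<open>g\<close> cancels in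
  \<open>q - y\<close> and the homogeneous case applies.\<close>

lemma gronwall:
  fixes q y g :: "real \<Rightarrow> real"
  assumes lam: "0 \<le> lam" and T: "0 \<le> T"
    and [measurable]: "q \<in> borel_measurable borel"
    and bd: "\<And>t. t \<in> {0..T} \<Longrightarrow> \<bar>q t\<bar> \<le> B"
    and y: "\<And>t. t \<in> {0..T} \<Longrightarrow> (y has_real_derivative lam * y t + g t) (at t within {0..T})"
    and g: "continuous_on {0..T} g"
    and le: "\<And>t. t \<in> {0..T} \<Longrightarrow> q t \<le> y 0 + (LINT \<tau>:{0..t}|lborel. lam * q \<tau> + g \<tau>)"
    and t: "t \<in> {0..T}"
  shows "q t \<le> y t"
proof -
  have cy: "continuous_on {0..T} y"
    using y by (rule DERIV_continuous_on)
  obtain Y where Y: "\<And>t. t \<in> {0..T} \<Longrightarrow> \<bar>y t\<bar> \<le> Y"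
    using compact_imp_bounded[OF compact_continuous_image[OF cy compact_Icc]]
    unfolding bounded_iff by (metis imageI real_norm_def)
  \<comment> \<open>\<open>y\<close> is controlled only on [0,T]; the indicator makes
    \<open>w\<close> Borel on the whole line.\<close>
  define w where "w = (\<lambda>t. q t - indicator {0..T} t *\<^sub>R y t)"
  have [measurable]: "(\<lambda>t. indicator {0..T} t *\<^sub>R y t) \<in> borel_measurable borel"
    by (intro borel_measurable_continuous_on_indicator cy) auto
  have "w t \<le> 0"
  proof (rule gronwall_nonpos[OF lam T _ _ _ t, where B="B + Y"])
    show "w \<in> borel_measurable borel" unfolding w_def by measurable
    fix t assume t: "t \<in> {0..T}"
    then show "\<bar>w t\<bar> \<le> B + Y" using bd[OF t] Y[OF t] by (simp add: w_def)
    have sub: "{0..t} \<subseteq> {0..T}" using t by auto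
    have FTC: "(LINT \<tau>:{0..t}|lborel. lam * y \<tau> + g \<tau>) = y t - y 0"
      unfolding set_lebesgue_integral_def
    proof (rule integral_FTC_atLeastAtMost)
      show "(y has_vector_derivative lam * y x + g x) (at x within {0..t})" if "0 \<le> x" "x \<le> t" for x
        using has_field_derivative_subset[OF y sub] that t
        by (simp flip: has_real_derivative_iff_has_vector_derivative)
      show "continuous_on {0..t} (\<lambda>x. lam * y x + g x)"
        using continuous_on_subset[OF cy sub] continuous_on_subset[OF g sub] by (intro continuous_intros)
    qed (use t in auto)
    have iq: "set_integrable lborel {0..t} (\<lambda>\<tau>. lam * q \<tau>)"
      using set_integrable_bounded_Icc[of q T B t] bd t by auto
    have ig: "set_integrable lborel {0..t} g" and iy: "set_integrable lborel {0..t} (\<lambda>\<tau>. lam * y \<tau>)"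
      using continuous_on_subset[OF cy sub] continuous_on_subset[OF g sub]
      by (auto intro!: borel_integrable_atLeastAtMost' continuous_intros)
    have "(LINT \<tau>:{0..t}|lborel. lam * w \<tau>) = (LINT \<tau>:{0..t}|lborel. (lam * q \<tau> + g \<tau>) - (lam * y \<tau> + g \<tau>))"
      using sub by (intro set_lebesgue_integral_cong) (auto simp: w_def right_diff_distrib)
    also have "\<dots> = (LINT \<tau>:{0..t}|lborel. lam * q \<tau> + g \<tau>) - (y t - y 0)"
      unfolding FTC[symmetric] by (intro set_integral_diff(2) set_integral_add(1) iq ig iy)
    finally show "w t \<le> (LINT \<tau>:{0..t}|lborel. lam * w \<tau>)"
      using le[OF t] t by (simp add: w_def)
  qed
  then show ?thesis using t by (simp add: w_def)
qed

text \<open>The equation in expanding coordinates: no drift, a time-dependent probability kernel,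
  and the integrating factor already inside \<open>V\<close>. Integrability and the bound
  \<open>B\<close> are required at all times, so that Fubini applies without restricting \<tau>; the
  concrete \<open>V\<close> is 0 outside [0,T]. \<open>B\<close> serves only for integrability and
  for the a priori boundedness in Gronwall and enters no conclusion below.\<close>

locale conv_duhamel =
  fixes K V :: "real \<Rightarrow> 'a::euclidean_space \<Rightarrow> real" and v0 :: "'a \<Rightarrow> real" and lam T B :: real
  assumes lam_nonneg: "0 \<le> lam" and T_nonneg: "0 \<le> T"
    and K_meas: "case_prod K \<in> borel_measurable (borel \<Otimes>\<^sub>M borel)"
    and K_nonneg: "\<And>\<tau> x. 0 \<le> K \<tau> x"
    and K_int: "\<And>\<tau>. integrable lborel (K \<tau>)"
    and K_mass: "\<And>\<tau>. (\<integral>x. K \<tau> x \<partial>lborel) = 1"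
    and K_fourier: "\<And>\<zeta>. continuous_on {0..T} (\<lambda>\<tau>. fourier (K \<tau>) \<zeta>)"
    and V_meas: "case_prod V \<in> borel_measurable (borel \<Otimes>\<^sub>M borel)"
    and V_int: "\<And>\<tau>. integrable lborel (V \<tau>)"
    and V_bound: "\<And>\<tau>. (\<integral>x. \<bar>V \<tau> x\<bar> \<partial>lborel) \<le> B"
    and v0_int: "integrable lborel v0"
    and V_eq: "\<And>t. t \<in> {0..T} \<Longrightarrow>
      AE y in lborel. V t y = v0 y + (LINT \<tau>:{0..t}|lborel. lam * conv (K \<tau>) (V \<tau>) y)"
begin

lemma integral_conv_abs: "(\<integral>x. conv (K \<tau>) (\<lambda>y. \<bar>V \<tau> y\<bar>) x \<partial>lborel) = (\<integral>x. \<bar>V \<tau> x\<bar> \<partial>lborel)"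
  by (subst integral_conv) (auto simp: K_int K_mass V_int)

lemma integrable_conv_abs: "integrable lborel (conv (K \<tau>) (\<lambda>y. \<bar>V \<tau> y\<bar>))"
  by (intro integrable_conv K_int integrable_abs V_int)

lemma V_abs_meas: "(\<lambda>(\<tau>, y). \<bar>V \<tau> y\<bar>) \<in> borel_measurable (borel \<Otimes>\<^sub>M borel)"
  using V_meas by measurable

text \<open>Absolute values are taken inside the Duhamel formula and the result is integrated
  against a bounded weight. It is used with the weights 1 and 1 - cos.\<close>

lemma weighted_mass_le:
  fixes \<psi> :: "'a \<Rightarrow> real"
  assumes [measurable]: "\<psi> \<in> borel_measurable borel" and \<psi>: "\<And>y. 0 \<le> \<psi> y" "\<And>y. \<psi> y \<le> D"
    and t: "t \<in> {0..T}"
  shows "(\<integral>y. \<psi> y * \<bar>V t y\<bar> \<partial>lborel) \<le> (\<integral>y. \<psi> y * \<bar>v0 y\<bar> \<partial>lborel) +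
     (LINT \<tau>:{0..t}|lborel. lam * (\<integral>y. \<psi> y * conv (K \<tau>) (\<lambda>y. \<bar>V \<tau> y\<bar>) y \<partial>lborel))"
proof -
  note [measurable] = conv_measurable_pair[OF K_meas V_abs_meas] conv_measurable_pair[OF K_meas V_meas]
  have [measurable]: "v0 \<in> borel_measurable borel" "\<And>t. V t \<in> borel_measurable borel"
    using v0_int V_int by auto
  define g where "g = (\<lambda>\<tau> y. lam * (\<psi> y * conv (K \<tau>) (\<lambda>y. \<bar>V \<tau> y\<bar>) y))"
  have cv: "0 \<le> conv (K \<tau>) (\<lambda>y. \<bar>V \<tau> y\<bar>) y" for \<tau> y
    by (intro conv_nonneg K_nonneg) auto
  have bnd: "norm (g \<tau> y) \<le> norm (lam * (D * conv (K \<tau>) (\<lambda>y. \<bar>V \<tau> y\<bar>) y))" for \<tau> y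
    using cv[of \<tau> y] \<psi>[of y] lam_nonneg unfolding g_def
    by (auto simp: abs_mult intro!: mult_mono)
  have gm: "case_prod g \<in> borel_measurable (borel \<Otimes>\<^sub>M borel)"
    unfolding g_def by measurable
  have D: "0 \<le> D" using \<psi>[of 0] by linarith
  have gi: "integrable lborel (g \<tau>)" for \<tau>
  proof (rule Bochner_Integration.integrable_bound)
    show "integrable lborel (\<lambda>y. lam * (D * conv (K \<tau>) (\<lambda>y. \<bar>V \<tau> y\<bar>) y))"
      by (intro integrable_mult_right integrable_conv_abs)
    show "g \<tau> \<in> borel_measurable lborel" using measurable_Pair2[OF gm] by simp
  qed (use bnd in auto)
  have gb: "(\<integral>y. norm (g \<tau> y) \<partial>lborel) \<le> lam * (D * B)" for \<tau>
  proof -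
    have "(\<integral>y. norm (g \<tau> y) \<partial>lborel) \<le> (\<integral>y. lam * (D * conv (K \<tau>) (\<lambda>y. \<bar>V \<tau> y\<bar>) y) \<partial>lborel)"
      using bnd[of \<tau>] cv lam_nonneg D
      by (intro Bochner_Integration.integral_mono integrable_norm gi integrable_mult_right integrable_conv_abs) auto
    also have "\<dots> \<le> lam * (D * B)"
      using integral_conv_abs[of \<tau>] V_bound[of \<tau>] lam_nonneg D by (simp add: mult_left_mono)
    finally show ?thesis .
  qed
  note F = time_space_Fubini[OF gm gi gb, of t]
  \<comment> \<open>The integrand without the weight. As \<open>\<psi>\<close> may vanish,
    integrability of \<open>g\<close> in time does not give that of \<open>c\<close>, which is what
    the pointwise bound on |V| needs.\<close>
  define c where "c = (\<lambda>\<tau> y. lam * conv (K \<tau>) (\<lambda>y. \<bar>V \<tau> y\<bar>) y)"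
  have cm: "case_prod c \<in> borel_measurable (borel \<Otimes>\<^sub>M borel)"
    unfolding c_def by measurable
  have ci: "integrable lborel (c \<tau>)" for \<tau>
    unfolding c_def by (intro integrable_mult_right integrable_conv_abs)
  have cb: "(\<integral>y. norm (c \<tau> y) \<partial>lborel) \<le> lam * B" for \<tau>
    using V_bound[of \<tau>] cv lam_nonneg integral_conv_abs[of \<tau>]
    by (simp add: c_def abs_mult mult_left_mono)
  note C = time_space_Fubini(1)[OF cm ci cb, of t]
  have pw: "AE y in lborel. \<psi> y * \<bar>V t y\<bar> \<le> \<psi> y * \<bar>v0 y\<bar> + (LINT \<tau>:{0..t}|lborel. g \<tau> y)"
    using V_eq[OF t] C
  proof eventually_elim
    case (elim y)
    have "\<bar>LINT \<tau>:{0..t}|lborel. lam * conv (K \<tau>) (V \<tau>) y\<bar> \<le> (LINT \<tau>:{0..t}|lborel. c \<tau> y)"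
      unfolding set_lebesgue_integral_def
    proof (rule order_trans[OF integral_abs_bound], rule integral_mono_AE')
      show "integrable lborel (\<lambda>\<tau>. indicator {0..t} \<tau> *\<^sub>R c \<tau> y)"
        using elim(2) by (simp add: set_integrable_def)
      show "AE x in lborel. \<bar>indicator {0..t} x *\<^sub>R (lam * conv (K x) (V x) y)\<bar> \<le> indicator {0..t} x *\<^sub>R c x y"
        using abs_conv_le[OF K_nonneg] lam_nonneg
        by (auto simp: c_def abs_mult intro!: AE_I2 mult_left_mono split: split_indicator)
      show "AE x in lborel. 0 \<le> indicator {0..t} x *\<^sub>R c x y"
        using cv lam_nonneg by (auto simp: c_def)
    qed
    then have "\<bar>V t y\<bar> \<le> \<bar>v0 y\<bar> + (LINT \<tau>:{0..t}|lborel. c \<tau> y)"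
      unfolding elim(1) by linarith
    then have "\<psi> y * \<bar>V t y\<bar> \<le> \<psi> y * (\<bar>v0 y\<bar> + (LINT \<tau>:{0..t}|lborel. c \<tau> y))"
      using \<psi>(1)[of y] by (rule mult_left_mono)
    moreover have "(LINT \<tau>:{0..t}|lborel. g \<tau> y) = \<psi> y * (LINT \<tau>:{0..t}|lborel. c \<tau> y)"
      unfolding set_integral_mult_right[symmetric] by (simp add: g_def c_def mult_ac)
    ultimately show ?case by (simp add: distrib_left)
  qed
  have i0: "integrable lborel (\<lambda>y. \<psi> y * \<bar>f y\<bar>)" if "integrable lborel f" for f
  proof (rule Bochner_Integration.integrable_bound)
    show "integrable lborel (\<lambda>y. D * f y)" using that by simp
    show "(\<lambda>y. \<psi> y * \<bar>f y\<bar>) \<in> borel_measurable lborel" using that by (auto dest!: borel_measurable_integrable)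
    show "AE x in lborel. norm (\<psi> x * \<bar>f x\<bar>) \<le> norm (D * f x)"
      using \<psi> D by (auto simp: abs_mult intro!: mult_right_mono)
  qed
  have "(\<integral>y. \<psi> y * \<bar>V t y\<bar> \<partial>lborel) \<le> (\<integral>y. \<psi> y * \<bar>v0 y\<bar> + (LINT \<tau>:{0..t}|lborel. g \<tau> y) \<partial>lborel)"
    by (intro integral_mono_AE pw Bochner_Integration.integrable_add i0 V_int v0_int F(2))
  also have "\<dots> = (\<integral>y. \<psi> y * \<bar>v0 y\<bar> \<partial>lborel) + (LINT \<tau>:{0..t}|lborel. (\<integral>y. g \<tau> y \<partial>lborel))"
    by (simp add: i0 v0_int F)
  finally show ?thesis by (simp add: g_def)
qed

text \<open>Convolution with a probability density preserves the mass of |V|, so Gronwall has rate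
  \<open>lam\<close> and no source. The growth is that of the integrating factor alone.\<close>

lemma mass_bound:
  assumes t: "t \<in> {0..T}"
  shows "(\<integral>y. \<bar>V t y\<bar> \<partial>lborel) \<le> exp (lam * t) * (\<integral>y. \<bar>v0 y\<bar> \<partial>lborel)"
proof -
  note [measurable] = V_meas
  define n where "n = (\<lambda>t. \<integral>y. \<bar>V t y\<bar> \<partial>lborel)"
  define n0 where "n0 = (\<integral>y. \<bar>v0 y\<bar> \<partial>lborel)"
  have n0: "0 \<le> n0" by (simp add: n0_def)
  have n: "0 \<le> n t" "n t \<le> B" for t using V_bound by (auto simp: n_def)
  have [measurable]: "n \<in> borel_measurable borel" unfolding n_def by measurable
  have "n t \<le> exp (lam * t) * n0"
  proof (rule gronwall[OF lam_nonneg T_nonneg _ _ _ _ _ t, where B=B and g="\<lambda>_. 0"])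
    fix t assume t: "t \<in> {0..T}"
    show "n t \<le> exp (lam * 0) * n0 + (LINT \<tau>:{0..t}|lborel. lam * n \<tau> + 0)"
      using weighted_mass_le[of "\<lambda>_. 1" 1, OF _ _ _ t] by (simp add: n_def n0_def integral_conv_abs)
  qed (use n in \<open>auto intro!: derivative_eq_intros\<close>)
  then show ?thesis by (simp add: n_def n0_def)
qed

text \<open>At a fixed frequency the Duhamel formula becomes a scalar linear Volterra equation,
  since the transform of a convolution is a product.\<close>

lemma fourier_V_eq:
  assumes t: "t \<in> {0..T}"
  shows "fourier (V t) \<zeta> = fourier v0 \<zeta> +
    (LINT \<tau>:{0..t}|lborel. complex_of_real lam * fourier (K \<tau>) \<zeta> * fourier (V \<tau>) \<zeta>)"
proof -
  note [measurable] = conv_measurable_pair[OF K_meas V_meas]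
  have [measurable]: "v0 \<in> borel_measurable borel" "\<And>t. V t \<in> borel_measurable borel"
    using v0_int V_int by auto
  define g where "g = (\<lambda>\<tau> y. cis (- (y \<bullet> \<zeta>)) * complex_of_real (lam * conv (K \<tau>) (V \<tau>) y))"
  have gm: "case_prod g \<in> borel_measurable (borel \<Otimes>\<^sub>M borel)"
    unfolding g_def by measurable
  have ci: "integrable lborel (\<lambda>y. lam * conv (K \<tau>) (V \<tau>) y)" for \<tau>
    by (intro integrable_mult_right integrable_conv K_int V_int)
  have gi: "integrable lborel (g \<tau>)" for \<tau>
    unfolding g_def by (intro integrable_cis_mult ci)
  have gb: "(\<integral>y. norm (g \<tau> y) \<partial>lborel) \<le> lam * B" for \<tau>
  proof -
    have "(\<integral>y. norm (g \<tau> y) \<partial>lborel) \<le> (\<integral>y. lam * conv (K \<tau>) (\<lambda>y. \<bar>V \<tau> y\<bar>) y \<partial>lborel)"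
      using abs_conv_le[OF K_nonneg] lam_nonneg
      by (intro Bochner_Integration.integral_mono integrable_norm gi integrable_mult_right integrable_conv_abs)
         (auto simp: g_def norm_mult abs_mult intro!: mult_left_mono)
    also have "\<dots> \<le> lam * B"
      using integral_conv_abs[of \<tau>] V_bound[of \<tau>] lam_nonneg by (simp add: mult_left_mono)
    finally show ?thesis .
  qed
  note F = time_space_Fubini[OF gm gi gb, of t]
  have g_eq: "(\<integral>y. g \<tau> y \<partial>lborel) = complex_of_real lam * fourier (K \<tau>) \<zeta> * fourier (V \<tau>) \<zeta>" for \<tau>
  proof -
    have "(\<integral>y. g \<tau> y \<partial>lborel) = complex_of_real lam * fourier (conv (K \<tau>) (V \<tau>)) \<zeta>"
      unfolding g_def fourier_def integral_mult_right_zero[symmetric]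
      by (intro Bochner_Integration.integral_cong) (auto simp: mult_ac)
    then show ?thesis by (simp add: fourier_conv K_int V_int mult.assoc)
  qed
  have "fourier (V t) \<zeta> = (\<integral>y. cis (- (y \<bullet> \<zeta>)) * complex_of_real (v0 y) + (LINT \<tau>:{0..t}|lborel. g \<tau> y) \<partial>lborel)"
    unfolding fourier_def
  proof (rule integral_cong_AE)
    show "(\<lambda>y. cis (- (y \<bullet> \<zeta>)) * complex_of_real (v0 y) + (LINT \<tau>:{0..t}|lborel. g \<tau> y)) \<in> borel_measurable lborel"
      using borel_measurable_integrable[OF F(2)] by measurable
    show "AE y in lborel. cis (- (y \<bullet> \<zeta>)) * complex_of_real (V t y) =
        cis (- (y \<bullet> \<zeta>)) * complex_of_real (v0 y) + (LINT \<tau>:{0..t}|lborel. g \<tau> y)"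
      using V_eq[OF t]
    proof eventually_elim
      case (elim y)
      show ?case
        unfolding elim g_def by (simp only: set_integral_mult_right set_integral_complex_of_real of_real_add distrib_left)
    qed
  qed measurable
  also have "\<dots> = fourier v0 \<zeta> + (LINT \<tau>:{0..t}|lborel. (\<integral>y. g \<tau> y \<partial>lborel))"
    by (simp add: F integrable_cis_mult v0_int fourier_def)
  finally show ?thesis by (simp add: g_eq)
qed

lemma norm_fourier_K_le: "cmod (fourier (K \<tau>) \<zeta>) \<le> 1"
  using norm_fourier_le[of "K \<tau>" \<zeta>] K_nonneg K_mass by simp

text \<open>Uniqueness for the scalar Volterra equation. The explicit exponential \<open>H\<close>
  solves it, and the modulus of the difference \<open>h - H\<close> satisfies Gronwall with zero
  data and zero source. No continuity of \<open>h\<close> in time is used.\<close>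

lemma fourier_V:
  assumes t: "t \<in> {0..T}"
  shows "fourier (V t) \<zeta> = fourier v0 \<zeta> *
    exp (LINT \<tau>:{0..t}|lborel. complex_of_real lam * fourier (K \<tau>) \<zeta>)"
proof -
  note [measurable] = V_meas
  define b where "b = (\<lambda>\<tau>. complex_of_real lam * fourier (K \<tau>) \<zeta>)"
  define h where "h = (\<lambda>t. fourier (V t) \<zeta>)"
  define H where "H = (\<lambda>t. fourier v0 \<zeta> * exp (LINT \<tau>:{0..t}|lborel. b \<tau>))"
  have b: "continuous_on {0..T} b" unfolding b_def by (intro continuous_intros K_fourier)
  have H: "(H has_vector_derivative b t * H t) (at t within {0..T})" if "t \<in> {0..T}" for t
  proof -
    have "((\<lambda>z. fourier v0 \<zeta> * exp z) \<circ> (\<lambda>t. LINT \<tau>:{0..t}|lborel. b \<tau>) has_vector_derivative b t * H t) (at t within {0..T})"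
      by (rule field_vector_diff_chain_within[OF set_lborel_has_vector_derivative[OF b that]])
         (auto intro!: derivative_eq_intros simp: H_def)
    then show ?thesis by (simp add: H_def comp_def)
  qed
  have cH: "continuous_on {0..T} H"
    unfolding continuous_on_eq_continuous_within using H has_vector_derivative_continuous by blast
  obtain M where M: "\<And>t. t \<in> {0..T} \<Longrightarrow> cmod (H t) \<le> M"
    using compact_imp_bounded[OF compact_continuous_image[OF cH compact_Icc]]
    unfolding bounded_iff by (metis imageI)
  have [measurable]: "(\<lambda>t. indicator {0..T} t *\<^sub>R H t) \<in> borel_measurable borel"
    by (intro borel_measurable_continuous_on_indicator cH) auto
  have hm [measurable]: "h \<in> borel_measurable borel"
    unfolding h_def fourier_def by measurable
  have hB: "cmod (h t) \<le> B" for t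
    using norm_fourier_le[of "V t" \<zeta>] V_bound[of t] by (simp add: h_def)
  have [measurable]: "(\<lambda>t. indicator {0..T} t *\<^sub>R b t) \<in> borel_measurable borel"
    by (intro borel_measurable_continuous_on_indicator b) auto
  have bb: "cmod (b \<tau>) \<le> lam" for \<tau>
    using norm_fourier_K_le[of \<tau> \<zeta>] lam_nonneg by (simp add: b_def norm_mult mult_left_le)
  define q where "q = (\<lambda>t. cmod (h t - indicator {0..T} t *\<^sub>R H t))"
  have qm [measurable]: "q \<in> borel_measurable borel" unfolding q_def by measurable
  have qb: "\<bar>q t\<bar> \<le> B + M" if "t \<in> {0..T}" for t
    unfolding q_def using norm_triangle_ineq4[of "h t" "H t"] hB[of t] M[OF that] that by simp
  have "q t \<le> 0"
  proof (rule gronwall[OF lam_nonneg T_nonneg qm qb, where y="\<lambda>_. 0" and g="\<lambda>_. 0"])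
    fix t assume t: "t \<in> {0..T}"
    have sub: "{0..t} \<subseteq> {0..T}" using t by auto
    have FTC: "(LINT \<tau>:{0..t}|lborel. b \<tau> * H \<tau>) = H t - H 0"
      unfolding set_lebesgue_integral_def
    proof (rule integral_FTC_atLeastAtMost)
      show "(H has_vector_derivative b x * H x) (at x within {0..t})" if "0 \<le> x" "x \<le> t" for x
        using has_vector_derivative_within_subset[OF H sub] that t by simp
      show "continuous_on {0..t} (\<lambda>x. b x * H x)"
        using continuous_on_subset[OF cH sub] continuous_on_subset[OF b sub] by (intro continuous_intros)
    qed (use t in auto)
    have H0: "H 0 = fourier v0 \<zeta>"
      by (simp add: H_def set_lborel_integral_singleton)
    have iH: "set_integrable lborel {0..t} (\<lambda>\<tau>. b \<tau> * H \<tau>)"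
      using continuous_on_subset[OF cH sub] continuous_on_subset[OF b sub]
      by (auto intro!: borel_integrable_atLeastAtMost' continuous_intros)
    \<comment> \<open>\<open>b\<close> is known to be continuous only on [0,T]; the indicator
      provides a Borel integrand, and it equals 1 on {0..t}.\<close>
    have ih': "set_integrable lborel {0..t} (\<lambda>\<tau>. (indicator {0..T} \<tau> *\<^sub>R b \<tau>) * h \<tau>)"
    proof (rule set_integrable_bounded_Icc[OF _ _ t, where B="lam * B"])
      show "(\<lambda>\<tau>. (indicator {0..T} \<tau> *\<^sub>R b \<tau>) * h \<tau>) \<in> borel_measurable borel" by measurable
      show "norm ((indicator {0..T} \<tau> *\<^sub>R b \<tau>) * h \<tau>) \<le> lam * B" if "\<tau> \<in> {0..T}" for \<tau>
        using hB[of \<tau>] bb[of \<tau>] lam_nonneg that by (auto simp: norm_mult intro!: mult_mono)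
    qed
    have ih: "set_integrable lborel {0..t} (\<lambda>\<tau>. b \<tau> * h \<tau>)"
      using ih' sub by (subst (asm) set_integrable_cong[OF refl refl, where f'="\<lambda>\<tau>. b \<tau> * h \<tau>"]) auto
    have "h t - H t = (LINT \<tau>:{0..t}|lborel. b \<tau> * h \<tau>) - (LINT \<tau>:{0..t}|lborel. b \<tau> * H \<tau>)"
      unfolding FTC H0 using fourier_V_eq[OF t, of \<zeta>] by (simp add: h_def b_def)
    also have "\<dots> = (LINT \<tau>:{0..t}|lborel. b \<tau> * (h \<tau> - H \<tau>))"
      by (simp add: set_integral_diff(2)[OF ih iH] right_diff_distrib)
    also have "cmod \<dots> \<le> (LINT \<tau>:{0..t}|lborel. lam * q \<tau>)"
    proof -
      have "cmod (LINT \<tau>:{0..t}|lborel. b \<tau> * (h \<tau> - H \<tau>)) \<le> (LINT \<tau>:{0..t}|lborel. cmod (b \<tau> * (h \<tau> - H \<tau>)))"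
        using set_integral_diff(1)[OF ih iH] by (intro set_integral_norm_bound) (simp add: right_diff_distrib)
      also have "\<dots> \<le> (LINT \<tau>:{0..t}|lborel. lam * q \<tau>)"
      proof (rule set_integral_mono)
        show "set_integrable lborel {0..t} (\<lambda>\<tau>. cmod (b \<tau> * (h \<tau> - H \<tau>)))"
          using set_integral_diff(1)[OF ih iH] by (intro set_integrable_norm) (simp add: right_diff_distrib)
        show "set_integrable lborel {0..t} (\<lambda>\<tau>. lam * q \<tau>)"
          using set_integrable_bounded_Icc[OF qm _ t, of "B + M"] qb by auto
        show "cmod (b \<tau> * (h \<tau> - H \<tau>)) \<le> lam * q \<tau>" if "\<tau> \<in> {0..t}" for \<tau>
          using bb[of \<tau>] that sub by (auto simp: q_def norm_mult intro!: mult_right_mono)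
      qed
      finally show ?thesis .
    qed
    finally show "q t \<le> 0 + (LINT \<tau>:{0..t}|lborel. lam * q \<tau> + 0)"
      using t by (simp add: q_def)
  qed (use t in \<open>auto\<close>)
  then show ?thesis using t by (simp add: q_def h_def H_def b_def)
qed

text \<open>Comparing |V| with its convolution, the integral against 1 - cos changes by at most |1 -
  K^| times the mass, K^ being the transform of the kernel. The mass bound then leaves a Gronwall
  inequality of rate \<open>lam\<close> with an explicit source, whose solution has e^(lam t) as an
  overall factor.\<close>

lemma one_minus_cos_bound:
  assumes t: "t \<in> {0..T}"
  shows "(\<integral>y. (1 - cos (y \<bullet> \<zeta>)) * \<bar>V t y\<bar> \<partial>lborel) \<le>
    exp (lam * t) * ((\<integral>y. (1 - cos (y \<bullet> \<zeta>)) * \<bar>v0 y\<bar> \<partial>lborel) +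
      (\<integral>y. \<bar>v0 y\<bar> \<partial>lborel) * (LINT \<tau>:{0..t}|lborel. lam * cmod (1 - fourier (K \<tau>) \<zeta>)))"
proof -
  note [measurable] = V_meas
  define b where "b = (\<lambda>\<tau>. lam * cmod (1 - fourier (K \<tau>) \<zeta>))"
  define n0 where "n0 = (\<integral>y. \<bar>v0 y\<bar> \<partial>lborel)"
  define q0 where "q0 = (\<integral>y. (1 - cos (y \<bullet> \<zeta>)) * \<bar>v0 y\<bar> \<partial>lborel)"
  define q where "q = (\<lambda>t. \<integral>y. (1 - cos (y \<bullet> \<zeta>)) * \<bar>V t y\<bar> \<partial>lborel)"
  \<comment> \<open>The solution of y' = lam y + n0 e^(lam t) b with y(0) = \<open>q0\<close>, by
    variation of constants.\<close>
  define y where "y = (\<lambda>t. exp (lam * t) * (q0 + n0 * (LINT \<tau>:{0..t}|lborel. b \<tau>)))"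
  have b: "continuous_on {0..T} b" unfolding b_def by (intro continuous_intros K_fourier)
  have qm: "q \<in> borel_measurable borel" unfolding q_def by measurable
  have qb: "\<bar>q t\<bar> \<le> 2 * B" for t
  proof -
    have "q t \<le> (\<integral>y. 2 * \<bar>V t y\<bar> \<partial>lborel)"
      unfolding q_def
    proof (rule Bochner_Integration.integral_mono)
      fix y show "(1 - cos (y \<bullet> \<zeta>)) * \<bar>V t y\<bar> \<le> 2 * \<bar>V t y\<bar>"
        using cos_ge_minus_one[of "y \<bullet> \<zeta>"] by (intro mult_right_mono) auto
    qed (use V_int in \<open>auto intro!: integral_one_minus_cos(2)\<close>)
    moreover have "0 \<le> q t" unfolding q_def by (intro Bochner_Integration.integral_nonneg) auto
    ultimately show ?thesis using V_bound[of t] by simp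
  qed
  have "q t \<le> y t"
  proof (rule gronwall[OF lam_nonneg T_nonneg qm qb, where g="\<lambda>t. n0 * (exp (lam * t) * b t)"])
    fix t assume t: "t \<in> {0..T}"
    have "((\<lambda>t. LINT \<tau>:{0..t}|lborel. b \<tau>) has_real_derivative b t) (at t within {0..T})"
      using set_lborel_has_vector_derivative[OF b t] by (simp add: has_real_derivative_iff_has_vector_derivative)
    then show "(y has_real_derivative lam * y t + n0 * (exp (lam * t) * b t)) (at t within {0..T})"
      unfolding y_def by (auto intro!: derivative_eq_intros simp: algebra_simps)
    have sub: "{0..t} \<subseteq> {0..T}" using t by auto
    have y0: "y 0 = q0"
      by (simp add: y_def set_lborel_integral_singleton)
    define c where "c = (\<lambda>\<tau>. \<integral>y. (1 - cos (y \<bullet> \<zeta>)) * conv (K \<tau>) (\<lambda>y. \<bar>V \<tau> y\<bar>) y \<partial>lborel)"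
    have cle: "lam * c \<tau> \<le> lam * q \<tau> + n0 * (exp (lam * \<tau>) * b \<tau>)" if \<tau>: "\<tau> \<in> {0..t}" for \<tau>
    proof -
      define F where "F = fourier (\<lambda>y. \<bar>V \<tau> y\<bar>) \<zeta>"
      have "c \<tau> = (\<integral>y. \<bar>V \<tau> y\<bar> \<partial>lborel) - Re (fourier (K \<tau>) \<zeta> * F)"
        unfolding c_def F_def
        by (simp add: integral_one_minus_cos integrable_conv_abs integral_conv_abs fourier_conv K_int V_int)
      \<comment> \<open>From mass - Re(K^ F) = (mass - Re F) + Re((1 - K^) F): the first part is
        \<open>q\<close> again, the second is the source.\<close>
      also have "\<dots> = q \<tau> + Re ((1 - fourier (K \<tau>) \<zeta>) * F)"
        unfolding q_def F_def by (subst integral_one_minus_cos(1)) (auto simp: V_int left_diff_distrib)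
      also have "\<dots> \<le> q \<tau> + cmod (1 - fourier (K \<tau>) \<zeta>) * cmod F"
        using complex_Re_le_cmod[of "(1 - fourier (K \<tau>) \<zeta>) * F"] by (simp add: norm_mult)
      also have "\<dots> \<le> q \<tau> + cmod (1 - fourier (K \<tau>) \<zeta>) * (exp (lam * \<tau>) * n0)"
        using norm_fourier_le[of "\<lambda>y. \<bar>V \<tau> y\<bar>" \<zeta>] mass_bound[of \<tau>] \<tau> sub
        by (auto simp: F_def n0_def intro!: mult_left_mono)
      finally have "lam * c \<tau> \<le> lam * (q \<tau> + cmod (1 - fourier (K \<tau>) \<zeta>) * (exp (lam * \<tau>) * n0))"
        using lam_nonneg by (rule mult_left_mono)
      then show ?thesis by (simp add: b_def algebra_simps)
    qed
    have i1: "set_integrable lborel {0..t} (\<lambda>\<tau>. lam * q \<tau> + n0 * (exp (lam * \<tau>) * b \<tau>))"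
    proof (rule set_integral_add(1))
      show "set_integrable lborel {0..t} (\<lambda>\<tau>. lam * q \<tau>)"
        using set_integrable_bounded_Icc[OF qm _ t, of "2 * B"] qb by auto
      show "set_integrable lborel {0..t} (\<lambda>\<tau>. n0 * (exp (lam * \<tau>) * b \<tau>))"
        using continuous_on_subset[OF b sub] by (intro borel_integrable_atLeastAtMost' continuous_intros)
    qed
    have c0: "0 \<le> c \<tau>" for \<tau>
      unfolding c_def by (intro Bochner_Integration.integral_nonneg mult_nonneg_nonneg conv_nonneg K_nonneg) auto
    have "q t \<le> q0 + (LINT \<tau>:{0..t}|lborel. lam * c \<tau>)"
      unfolding q_def q0_def c_def
    proof (rule weighted_mass_le[where D=2])
      show "1 - cos (y \<bullet> \<zeta>) \<le> 2" for y
        using cos_ge_minus_one[of "y \<bullet> \<zeta>"] by linarith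
    qed (use t in auto)
    also have "\<dots> \<le> q0 + (LINT \<tau>:{0..t}|lborel. lam * q \<tau> + n0 * (exp (lam * \<tau>) * b \<tau>))"
      unfolding set_lebesgue_integral_def
      by (intro add_left_mono integral_mono_AE')
         (use i1 cle mult_nonneg_nonneg[OF lam_nonneg c0] in
           \<open>auto simp: set_integrable_def intro!: AE_I2 intro: order_trans split: split_indicator\<close>)
    finally show "q t \<le> y 0 + (LINT \<tau>:{0..t}|lborel. lam * q \<tau> + n0 * (exp (lam * \<tau>) * b \<tau>))"
      by (simp add: y0)
  qed (use t b in \<open>auto intro!: continuous_intros\<close>)
  then show ?thesis by (simp add: q_def y_def q0_def n0_def b_def)
qed

end

section \<open>Mild solutions in expanding coordinates\<close>

text \<open>Heine-Cantor for a curve in L1. Uniformity supplies one mesh size for the whole interval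
  in the step-function approximation that follows.\<close>

lemma L1_uniformly_continuous_Icc:
  fixes u :: "real \<Rightarrow> 'a::euclidean_space \<Rightarrow> real"
  assumes int: "\<And>t. t \<in> {0..T} \<Longrightarrow> integrable lborel (u t)"
    and cont: "\<And>t0. t0 \<in> {0..T} \<Longrightarrow>
      ((\<lambda>t. \<integral>x. \<bar>u t x - u t0 x\<bar> \<partial>lborel) \<longlongrightarrow> 0) (at t0 within {0..T})"
    and e: "0 < e"
  shows "\<exists>d>0. \<forall>a\<in>{0..T}. \<forall>b\<in>{0..T}. \<bar>a - b\<bar> < d \<longrightarrow> (\<integral>x. \<bar>u a x - u b x\<bar> \<partial>lborel) < e"
proof (rule ccontr)
  define D where "D = (\<lambda>a b. \<integral>x. \<bar>u a x - u b x\<bar> \<partial>lborel)"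
  assume "\<not> ?thesis"
  then have "\<forall>n. \<exists>a b. a \<in> {0..T} \<and> b \<in> {0..T} \<and> \<bar>a - b\<bar> < inverse (real (Suc n)) \<and> e \<le> D a b"
    unfolding D_def by (metis inverse_positive_iff_positive linorder_not_less of_nat_0_less_iff zero_less_Suc)
  then obtain a b where ab: "\<And>n. a n \<in> {0..T}" "\<And>n. b n \<in> {0..T}"
    "\<And>n. \<bar>a n - b n\<bar> < inverse (real (Suc n))" "\<And>n. e \<le> D (a n) (b n)"
    by metis
  obtain l r where l: "l \<in> {0..T}" and r: "strict_mono r" and al: "(a \<circ> r) \<longlonglongrightarrow> l"
    using compact_Icc[of 0 T] ab(1) unfolding compact_def by metis
  have ba: "(\<lambda>n. a n - b n) \<longlonglongrightarrow> 0"
    by (rule Lim_null_comparison[OF _ LIMSEQ_inverse_real_of_nat])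
       (use ab(3) in \<open>auto intro!: always_eventually less_imp_le\<close>)
  have "(\<lambda>n. (a \<circ> r) n - (a (r n) - b (r n))) \<longlonglongrightarrow> l - 0"
    by (intro tendsto_diff al LIMSEQ_subseq_LIMSEQ[OF ba r, unfolded comp_def])
  then have bl: "(\<lambda>n. b (r n)) \<longlonglongrightarrow> l" by simp
  obtain d where d: "0 < d" "\<And>t. t \<in> {0..T} \<Longrightarrow> dist t l < d \<Longrightarrow> D t l < e / 2"
  proof -
    obtain d where d: "0 < d" "\<forall>x\<in>{0..T}. 0 < dist x l \<and> dist x l < d \<longrightarrow> dist (D x l) 0 < e / 2"
      using cont[OF l] half_gt_zero[OF e] unfolding Lim_within D_def by metis
    have "D t l < e / 2" if "t \<in> {0..T}" "dist t l < d" for t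
      using d(2) that e by (cases "t = l") (auto simp: D_def dist_real_def)
    with d(1) show thesis using that by blast
  qed
  have "eventually (\<lambda>n. dist ((a \<circ> r) n) l < d \<and> dist (b (r n)) l < d) sequentially"
    using al bl d(1) by (intro eventually_conj) (auto dest: tendstoD)
  then obtain n where n: "dist (a (r n)) l < d" "dist (b (r n)) l < d"
    by (auto simp: eventually_sequentially)
  have "D (a (r n)) (b (r n)) \<le> (\<integral>x. \<bar>u (a (r n)) x - u l x\<bar> + \<bar>u (b (r n)) x - u l x\<bar> \<partial>lborel)"
    unfolding D_def
    by (intro Bochner_Integration.integral_mono integrable_abs Bochner_Integration.integrable_add
        Bochner_Integration.integrable_diff int ab l) auto
  also have "\<dots> = D (a (r n)) l + D (b (r n)) l"
    unfolding D_def
    by (intro Bochner_Integration.integral_add integrable_abs Bochner_Integration.integrable_diff int ab l)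
  also have "\<dots> < e"
    using d(2)[OF ab(1) n(1)] d(2)[OF ab(2) n(2)] by simp
  finally show False using ab(4)[of "r n"] by simp
qed

text \<open>An L1-continuous curve has no joint measurability a priori; a fast converging sequence of
  step functions in time provides a jointly measurable version.\<close>

lemma L1_continuous_measurable_version:
  fixes u :: "real \<Rightarrow> 'a::euclidean_space \<Rightarrow> real"
  assumes int: "\<And>t. t \<in> {0..T} \<Longrightarrow> integrable lborel (u t)"
    and cont: "\<And>t0. t0 \<in> {0..T} \<Longrightarrow>
      ((\<lambda>t. \<integral>x. \<bar>u t x - u t0 x\<bar> \<partial>lborel) \<longlongrightarrow> 0) (at t0 within {0..T})"
  obtains U where "case_prod U \<in> borel_measurable (borel \<Otimes>\<^sub>M borel)"
    and "\<And>t. t \<in> {0..T} \<Longrightarrow> AE x in lborel. U t x = u t x"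
proof -
  have "\<forall>n::nat. \<exists>d>0. \<forall>a\<in>{0..T}. \<forall>b\<in>{0..T}. \<bar>a - b\<bar> < d \<longrightarrow> (\<integral>x. \<bar>u a x - u b x\<bar> \<partial>lborel) < (1/2) ^ n"
    by (intro allI L1_uniformly_continuous_Icc int cont) auto
  then obtain h where h: "\<And>n. 0 < h n" "\<And>n a b. a \<in> {0..T} \<Longrightarrow> b \<in> {0..T} \<Longrightarrow> \<bar>a - b\<bar> < h n \<Longrightarrow>
      (\<integral>x. \<bar>u a x - u b x\<bar> \<partial>lborel) < (1/2) ^ n"
    by metis
  \<comment> \<open>The curve is unconstrained outside [0,T]; extension by 0 makes every time slice
    measurable.\<close>
  define u' where "u' = (\<lambda>t x. if t \<in> {0..T} then u t x else 0)"
  \<comment> \<open>Rounds t down to the grid of mesh \<open>h n\<close>. It takes countably many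
    values, which gives joint measurability of the step functions, and it stays in [0,T] when t
    does.\<close>
  define p where "p = (\<lambda>n t. h n * of_int \<lfloor>t / h n\<rfloor>)"
  have u'm [measurable]: "u' t \<in> borel_measurable borel" for t
    using int[of t] by (cases "t \<in> {0..T}") (auto simp: u'_def dest!: borel_measurable_integrable)
  have um [measurable]: "(\<lambda>q. u' (p n (fst q)) (snd q)) \<in> borel_measurable (borel \<Otimes>\<^sub>M borel)" for n
    unfolding p_def
    by (rule measurable_compose_countable[where f="\<lambda>i q. u' (h n * of_int i) (snd q)" and g="\<lambda>q. \<lfloor>fst q / h n\<rfloor>"])
       measurable
  \<comment> \<open>Where the sequence diverges, \<open>lim\<close> is an unspecified value; for
    each fixed t this concerns only a null set of x.\<close>
  define U where "U = (\<lambda>t x. lim (\<lambda>n. u' (p n t) x))"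
  show thesis
  proof
    show "case_prod U \<in> borel_measurable (borel \<Otimes>\<^sub>M borel)"
      using borel_measurable_lim_metric[OF um] by (simp add: U_def split_beta')
    fix t assume t: "t \<in> {0..T}"
    have p: "p n t \<in> {0..T}" "\<bar>p n t - t\<bar> < h n" for n
    proof -
      have "p n t \<le> t"
        using of_int_floor_le[of "t / h n"] h(1)[of n] by (simp only: p_def pos_le_divide_eq mult.commute)
      moreover have "t / h n < of_int \<lfloor>t / h n\<rfloor> + 1" "0 \<le> \<lfloor>t / h n\<rfloor>"
        using t h(1)[of n] by auto
      then have "t < p n t + h n" "0 \<le> p n t"
        using h(1)[of n] by (auto simp: p_def field_simps)
      ultimately
      show "p n t \<in> {0..T}" "\<bar>p n t - t\<bar> < h n" using t by auto
    qed
    define d where "d = (\<lambda>n x. \<bar>u (p n t) x - u t x\<bar>)"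
    have di: "integrable lborel (d n)" for n
      unfolding d_def using p t int by auto
    then have dm [measurable]: "d n \<in> borel_measurable borel" for n by auto
    \<comment> \<open>The L1 distances to \<open>u t\<close> are summable, so the sum of the
      pointwise distances is finite almost everywhere. Its terms then tend to 0 there, without
      passing to a subsequence.\<close>
    have half: "(\<Sum>n. ennreal ((1/2) ^ n)) = ennreal (1 / (1 - 1/2))"
      by (rule suminf_ennreal_eq[OF _ geometric_sums]) auto
    have "(\<integral>\<^sup>+x. (\<Sum>n. ennreal (d n x)) \<partial>lborel) = (\<Sum>n. \<integral>\<^sup>+x. ennreal (d n x) \<partial>lborel)"
      by (rule nn_integral_suminf) measurable
    also have "\<dots> \<le> (\<Sum>n. ennreal ((1/2) ^ n))"
    proof (rule suminf_le)
      fix n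
      have "(\<integral>\<^sup>+x. ennreal (d n x) \<partial>lborel) = ennreal (\<integral>x. d n x \<partial>lborel)"
        by (rule nn_integral_eq_integral[OF di]) (simp add: d_def)
      also have "\<dots> \<le> ennreal ((1/2) ^ n)"
        unfolding d_def by (intro ennreal_leI less_imp_le h(2) p t)
      finally show "(\<integral>\<^sup>+x. ennreal (d n x) \<partial>lborel) \<le> ennreal ((1/2) ^ n)" .
    qed auto
    finally have "(\<integral>\<^sup>+x. (\<Sum>n. ennreal (d n x)) \<partial>lborel) \<le> ennreal (1 / (1 - 1/2))"
      unfolding half .
    then have "(\<integral>\<^sup>+x. (\<Sum>n. ennreal (d n x)) \<partial>lborel) \<noteq> \<infinity>"
      unfolding infinity_ennreal_def by (rule neq_top_trans[OF ennreal_neq_top])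
    then have "AE x in lborel. (\<Sum>n. ennreal (d n x)) \<noteq> \<infinity>"
      by (intro nn_integral_PInf_AE) auto
    then show "AE x in lborel. U t x = u t x"
    proof eventually_elim
      case (elim x)
      have "summable (\<lambda>n. d n x)"
        by (rule summable_suminf_not_top) (use elim in \<open>auto simp: d_def\<close>)
      then have "(\<lambda>n. \<bar>u (p n t) x - u t x\<bar>) \<longlonglongrightarrow> 0"
        unfolding d_def by (rule summable_LIMSEQ_zero)
      then have "(\<lambda>n. u (p n t) x) \<longlonglongrightarrow> u t x"
        by (rule LIM_zero_cancel[OF tendsto_rabs_zero_cancel])
      moreover have "u' (p n t) x = u (p n t) x" for n
        using p by (simp add: u'_def)
      ultimately show ?case by (simp add: U_def limI)
    qed
  qed
qed

text \<open>By the reverse triangle inequality the L1 norm is continuous in time, hence bounded on a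
  compact interval. This provides the a priori bound \<open>B\<close>.\<close>

lemma L1_continuous_bounded:
  fixes u :: "real \<Rightarrow> 'a::euclidean_space \<Rightarrow> real"
  assumes int: "\<And>t. t \<in> {0..T} \<Longrightarrow> integrable lborel (u t)"
    and cont: "\<And>t0. t0 \<in> {0..T} \<Longrightarrow>
      ((\<lambda>t. \<integral>x. \<bar>u t x - u t0 x\<bar> \<partial>lborel) \<longlongrightarrow> 0) (at t0 within {0..T})"
  obtains B where "\<And>t. t \<in> {0..T} \<Longrightarrow> (\<integral>x. \<bar>u t x\<bar> \<partial>lborel) \<le> B"
proof -
  have "continuous_on {0..T} (\<lambda>t. \<integral>x. \<bar>u t x\<bar> \<partial>lborel)"
    unfolding continuous_on_def
  proof
    fix a assume a: "a \<in> {0..T}"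
    show "((\<lambda>t. \<integral>x. \<bar>u t x\<bar> \<partial>lborel) \<longlongrightarrow> (\<integral>x. \<bar>u a x\<bar> \<partial>lborel)) (at a within {0..T})"
    proof (rule LIM_zero_cancel, rule Lim_null_comparison[OF _ cont[OF a]])
      have "norm ((\<integral>x. \<bar>u t x\<bar> \<partial>lborel) - (\<integral>x. \<bar>u a x\<bar> \<partial>lborel)) \<le> (\<integral>x. \<bar>u t x - u a x\<bar> \<partial>lborel)"
        if t: "t \<in> {0..T}" for t
      proof -
        have "(\<integral>x. \<bar>u t x\<bar> \<partial>lborel) - (\<integral>x. \<bar>u a x\<bar> \<partial>lborel) = (\<integral>x. \<bar>u t x\<bar> - \<bar>u a x\<bar> \<partial>lborel)"
          by (intro Bochner_Integration.integral_diff[symmetric] integrable_abs int a t)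
        also have "\<bar>\<dots>\<bar> \<le> (\<integral>x. \<bar>u t x - u a x\<bar> \<partial>lborel)"
          by (intro integral_abs_bound_integral integrable_abs Bochner_Integration.integrable_diff int a t) auto
        finally show ?thesis by simp
      qed
      then show "\<forall>\<^sub>F t in at a within {0..T}. norm ((\<integral>x. \<bar>u t x\<bar> \<partial>lborel) - (\<integral>x. \<bar>u a x\<bar> \<partial>lborel))
          \<le> (\<integral>x. \<bar>u t x - u a x\<bar> \<partial>lborel)"
        unfolding eventually_at_filter by (intro always_eventually) blast
    qed
  qed
  from compact_imp_bounded[OF compact_continuous_image[OF this compact_Icc]]
  obtain B where "\<forall>x\<in>(\<lambda>t. \<integral>x. \<bar>u t x\<bar> \<partial>lborel) ` {0..T}. norm x \<le> B"
    unfolding bounded_iff by blast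
  then have "(\<integral>x. \<bar>u t x\<bar> \<partial>lborel) \<le> B" if "t \<in> {0..T}" for t
    using that by auto
  then show thesis by (rule that)
qed

section \<open>Mass-preserving dilations and weighted L1 spaces\<close>

lemma rescale_eq:
  assumes "0 < a"
  shows "rescale a K x = inverse (a ^ DIM('a)) * K (inverse a *\<^sub>R (x::'a::euclidean_space))"
  using assms by (simp add: rescale_def powr_minus powr_realpow)

lemma integrable_rescale:
  fixes K :: "'a::euclidean_space \<Rightarrow> real"
  assumes a: "0 < a" and K: "integrable lborel K"
  shows "integrable lborel (rescale a K)"
  using lborel_integrable_affine[OF K, of "inverse a" 0] a
  by (simp add: rescale_eq[OF a, abs_def])

lemma integral_rescale:
  fixes K :: "'a::euclidean_space \<Rightarrow> real"
  assumes a: "0 < a"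
  shows "(\<integral>x. rescale a K x \<partial>lborel) = (\<integral>x. K x \<partial>lborel)"
  using lborel_integral_affine[of "inverse a" K 0] a
  by (simp add: rescale_eq[OF a] power_inverse)

lemma fourier_rescale:
  fixes K :: "'a::euclidean_space \<Rightarrow> real"
  assumes a: "0 < a"
  shows "fourier (rescale a K) \<xi> = fourier K (a *\<^sub>R \<xi>)"
proof -
  have "fourier K (a *\<^sub>R \<xi>) = inverse a ^ DIM('a) *\<^sub>R
      (\<integral>x. cis (- ((inverse a *\<^sub>R x) \<bullet> (a *\<^sub>R \<xi>))) * complex_of_real (K (inverse a *\<^sub>R x)) \<partial>lborel)"
    unfolding fourier_def
    using lborel_integral_affine[of "inverse a" "\<lambda>x. cis (- (x \<bullet> (a *\<^sub>R \<xi>))) * complex_of_real (K x)" 0] a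
    by simp
  also have "\<dots> = fourier (rescale a K) \<xi>"
  proof -
    have e: "(inverse a *\<^sub>R x) \<bullet> (a *\<^sub>R \<xi>) = x \<bullet> \<xi>" for x using a by simp
    show ?thesis
      unfolding e fourier_def integral_scaleR_right[symmetric]
      by (intro Bochner_Integration.integral_cong) (auto simp: rescale_eq[OF a] scaleR_conv_of_real power_inverse)
  qed
  finally show ?thesis ..
qed

lemma fourier_cong_AE:
  assumes "AE x in lborel. f x = g x" "f \<in> borel_measurable borel" "g \<in> borel_measurable borel"
  shows "fourier f \<xi> = fourier g \<xi>"
  unfolding fourier_def
proof (rule integral_cong_AE)
  note [measurable] = assms(2,3)
  show "AE x in lborel. cis (- (x \<bullet> \<xi>)) * complex_of_real (f x) = cis (- (x \<bullet> \<xi>)) * complex_of_real (g x)"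
    using assms(1) by eventually_elim simp
qed (use assms(2,3) in measurable)

lemma jbr_ge_1: "1 \<le> jbr x"
  by (simp add: jbr_def)

lemma jbr_measurable [measurable]: "(jbr :: 'a::euclidean_space \<Rightarrow> real) \<in> borel_measurable borel"
  unfolding jbr_def[abs_def] by measurable

lemma L1w_integrable:
  fixes f :: "'a::euclidean_space \<Rightarrow> real"
  assumes "0 \<le> k" "L1w k f"
  shows "integrable lborel f"
    and "(\<integral>x. \<bar>f x\<bar> \<partial>lborel) \<le> L1w_norm k f"
proof -
  have i: "integrable lborel (\<lambda>x. jbr x powr k * \<bar>f x\<bar>)" and [measurable]: "f \<in> borel_measurable borel"
    using assms by (auto simp: L1w_def)
  have le: "\<bar>f x\<bar> \<le> jbr x powr k * \<bar>f x\<bar>" for x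
    using ge_one_powr_ge_zero[OF jbr_ge_1 assms(1), of x] by (simp add: mult_le_cancel_right1)
  show int: "integrable lborel f"
    by (rule Bochner_Integration.integrable_bound[OF i]) (use le in \<open>auto intro: order_trans[OF _ abs_ge_self]\<close>)
  show "(\<integral>x. \<bar>f x\<bar> \<partial>lborel) \<le> L1w_norm k f"
    unfolding L1w_norm_def by (intro Bochner_Integration.integral_mono i le) (use int in auto)
qed

lemma L1w_diff:
  fixes f g :: "'a::euclidean_space \<Rightarrow> real"
  assumes "L1w k f" "L1w k g"
  shows "L1w k (\<lambda>x. f x - g x)"
proof -
  have [measurable]: "f \<in> borel_measurable borel" "g \<in> borel_measurable borel"
    using assms by (auto simp: L1w_def)
  have "integrable lborel (\<lambda>x. jbr x powr k * \<bar>f x\<bar> + jbr x powr k * \<bar>g x\<bar>)"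
    using assms by (auto simp: L1w_def)
  then have "integrable lborel (\<lambda>x. jbr x powr k * \<bar>f x - g x\<bar>)"
    by (rule Bochner_Integration.integrable_bound)
       (auto simp: abs_mult simp flip: distrib_left intro!: mult_left_mono)
  then show ?thesis by (simp add: L1w_def)
qed

text \<open>In the expanding coordinates \<^term>\<open>y = exp t *\<^sub>R x\<close> the drift disappears and the mild formula becomes
  a Duhamel formula with a time-dependent kernel.\<close>

lemma mild_solution_conv_duhamel:
  fixes K u0 :: "'a::euclidean_space \<Rightarrow> real"
  assumes mild: "mild_solution k lam K u0 u"
    and k: "0 \<le> k" and lam: "0 \<le> lam" and T: "0 \<le> T"
    and K: "prob_density K" and u0: "integrable lborel u0"
  obtains V B where "conv_duhamel (\<lambda>\<tau>. rescale (exp \<tau>) (\<lambda>x. \<bar>K x\<bar>)) V u0 lam T B"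
    and "\<And>t. t \<in> {0..T} \<Longrightarrow>
      AE y in lborel. V t y = exp ((lam - DIM('a)) * t) * u t (exp (- t) *\<^sub>R y)"
proof -
  have [measurable]: "K \<in> borel_measurable borel" and Ki: "integrable lborel K"
    and K1: "(\<integral>x. K x \<partial>lborel) = 1" and K0: "AE x in lborel. 0 \<le> K x"
    using K by (auto simp: prob_density_def)
  have KAE: "AE x in lborel. \<bar>K x\<bar> = K x" using K0 by eventually_elim simp
  have L: "L1w k (u t)" if "t \<in> {0..T}" for t
    using mild that by (auto simp: mild_solution_def)
  have ui: "integrable lborel (u t)" if "t \<in> {0..T}" for t
    using L1w_integrable(1)[OF k L[OF that]] .
  have cont: "((\<lambda>t. \<integral>x. \<bar>u t x - u t0 x\<bar> \<partial>lborel) \<longlongrightarrow> 0) (at t0 within {0..T})" if "t0 \<in> {0..T}" for t0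
  proof (rule Lim_null_comparison)
    have "((\<lambda>t. L1w_norm k (\<lambda>x. u t x - u t0 x)) \<longlongrightarrow> 0) (at t0 within {0..})"
      using mild that by (auto simp: mild_solution_def)
    then show "((\<lambda>t. L1w_norm k (\<lambda>x. u t x - u t0 x)) \<longlongrightarrow> 0) (at t0 within {0..T})"
      by (rule tendsto_within_subset) auto
    show "\<forall>\<^sub>F t in at t0 within {0..T}. norm (\<integral>x. \<bar>u t x - u t0 x\<bar> \<partial>lborel) \<le> L1w_norm k (\<lambda>x. u t x - u t0 x)"
      unfolding eventually_at_topological
      using L1w_integrable(2)[OF k L1w_diff[OF L L[OF that]]] by (intro exI[of _ UNIV]) auto
  qed
  \<comment> \<open>Time integrals involve all slices at once and need joint measurability; each
    slice of \<open>U\<close> agrees with that of \<open>u\<close> almost everywhere.\<close>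
  obtain U where Um: "case_prod U \<in> borel_measurable (borel \<Otimes>\<^sub>M borel)"
    and U: "\<And>t. t \<in> {0..T} \<Longrightarrow> AE x in lborel. U t x = u t x"
    using L1_continuous_measurable_version[OF ui cont] by blast
  obtain B where B: "\<And>t. t \<in> {0..T} \<Longrightarrow> (\<integral>x. \<bar>u t x\<bar> \<partial>lborel) \<le> B"
    using L1_continuous_bounded[OF ui cont] by blast
  have Um' [measurable]: "(\<lambda>x. U (f x) (g x)) \<in> borel_measurable M"
    if "f \<in> borel_measurable M" "g \<in> borel_measurable M" for f :: "'c \<Rightarrow> real" and g :: "'c \<Rightarrow> 'a" and M
    using measurable_compose[OF measurable_Pair[OF that] Um] by simp
  \<comment> \<open>e^(-dt) compensates the Jacobian of the dilation and e^(lam t) the loss term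
    -lam u. The value 0 outside [0,T] gives the bounds at all times.\<close>
  define V where "V = (\<lambda>t y. if t \<in> {0..T} then exp ((lam - DIM('a)) * t) * U t (exp (- t) *\<^sub>R y) else 0)"
  \<comment> \<open>A density is nonnegative only almost everywhere; the absolute value makes the
    kernel nonnegative at every point.\<close>
  define L where "L = (\<lambda>\<tau>. rescale (exp \<tau>) (\<lambda>x. \<bar>K x\<bar>))"
  have VAE: "AE y in lborel. V t y = exp ((lam - DIM('a)) * t) * u t (exp (- t) *\<^sub>R y)" if "t \<in> {0..T}" for t
    using AE_lborel_affine[OF _ U[OF that], of "exp (- t)" 0]
    that by (simp add: V_def)
  have [measurable]: "u t \<in> borel_measurable borel" if "t \<in> {0..T}" for t
    using ui[OF that] by auto
  have Vm: "case_prod V \<in> borel_measurable (borel \<Otimes>\<^sub>M borel)"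
    unfolding V_def split_beta' by measurable
  have Vtm [measurable]: "V t \<in> borel_measurable borel" for t
    using measurable_Pair2[OF Vm, of t] by simp
  have ei: "integrable lborel (\<lambda>y. exp ((lam - DIM('a)) * t) * u t (exp (- t) *\<^sub>R y))" if "t \<in> {0..T}" for t
    using lborel_integrable_affine[OF ui[OF that], of "exp (- t)" 0] by simp
  have Vi: "integrable lborel (V t)" for t
  proof (cases "t \<in> {0..T}")
    case True
    show ?thesis
      by (subst integrable_cong_AE[OF _ _ VAE[OF True]]) (use True ei in auto)
  next
    case False
    then have "V t = (\<lambda>_. 0)" by (auto simp: V_def)
    then show ?thesis by simp
  qed
  have scale: "exp ((lam - DIM('a)) * t) = exp (lam * t) * exp (- t) ^ DIM('a)" for t
    by (simp add: exp_of_nat_mult[symmetric] mult_exp_exp algebra_simps)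
  have Vb: "(\<integral>x. \<bar>V t x\<bar> \<partial>lborel) \<le> exp (lam * T) * max B 0" for t
  proof (cases "t \<in> {0..T}")
    case True
    have "(\<integral>x. \<bar>V t x\<bar> \<partial>lborel) = (\<integral>y. \<bar>exp ((lam - DIM('a)) * t) * u t (exp (- t) *\<^sub>R y)\<bar> \<partial>lborel)"
      using VAE[OF True] True by (intro integral_cong_AE) (auto elim: AE_mp)
    also have "\<dots> = exp (lam * t) * (\<integral>x. \<bar>u t x\<bar> \<partial>lborel)"
      using lborel_integral_affine[of "exp (- t)" "\<lambda>x. \<bar>u t x\<bar>" 0] by (simp add: abs_mult scale)
    also have "\<dots> \<le> exp (lam * T) * max B 0"
      using B[OF True] True lam by (intro mult_mono) (auto intro: mult_left_mono)
    finally show ?thesis .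
  next
    case False
    then have "V t = (\<lambda>_. 0)" by (auto simp: V_def)
    then show ?thesis by simp
  qed
  \<comment> \<open>The change of variables y = e^\<tau> x turns convolution with \<open>K\<close>
    into convolution with \<open>K\<close> dilated by e^\<tau>.\<close>
  have convL: "conv (L \<tau>) (V \<tau>) y = exp ((lam - DIM('a)) * \<tau>) * conv K (u \<tau>) (exp (- \<tau>) *\<^sub>R y)"
    if \<tau>: "\<tau> \<in> {0..T}" for \<tau> y
  proof -
    have "conv (L \<tau>) (V \<tau>) y = conv (rescale (exp \<tau>) K) (\<lambda>y. exp ((lam - DIM('a)) * \<tau>) * u \<tau> (exp (- \<tau>) *\<^sub>R y)) y"
    proof (rule conv_cong_AE)
      show "AE x in lborel. L \<tau> x = rescale (exp \<tau>) K x"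
        using AE_lborel_affine[OF _ KAE, of "exp (- \<tau>)" 0]
        by (auto simp: L_def rescale_eq exp_minus)
    qed (use VAE[OF \<tau>] \<tau> in \<open>auto simp: L_def rescale_eq[OF exp_gt_zero, abs_def]\<close>)
    also have "\<dots> = exp ((lam - DIM('a)) * \<tau>) *
        (exp (- \<tau>) ^ DIM('a) *\<^sub>R (\<integral>z. K (exp (- \<tau>) *\<^sub>R y - (0 + exp (- \<tau>) *\<^sub>R z)) * u \<tau> (0 + exp (- \<tau>) *\<^sub>R z) \<partial>lborel))"
      unfolding conv_def real_scaleR_def integral_mult_right_zero[symmetric]
      by (intro Bochner_Integration.integral_cong)
         (auto simp: rescale_eq exp_minus power_inverse scaleR_diff_right)
    also have "\<dots> = exp ((lam - DIM('a)) * \<tau>) * conv K (u \<tau>) (exp (- \<tau>) *\<^sub>R y)"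
      using lborel_integral_affine[of "exp (- \<tau>)" "\<lambda>z. K (exp (- \<tau>) *\<^sub>R y - z) * u \<tau> z" 0]
      by (simp add: conv_def)
    finally show ?thesis .
  qed
  have "conv_duhamel L V u0 lam T (exp (lam * T) * max B 0)"
  proof
    show "case_prod L \<in> borel_measurable (borel \<Otimes>\<^sub>M borel)"
      unfolding L_def rescale_def split_beta' by measurable
    show "0 \<le> L \<tau> x" for \<tau> x by (simp add: L_def rescale_eq)
    show "integrable lborel (L \<tau>)" for \<tau>
      unfolding L_def by (intro integrable_rescale integrable_abs Ki) auto
    show "(\<integral>x. L \<tau> x \<partial>lborel) = 1" for \<tau>
      unfolding L_def using integral_cong_AE[OF _ _ KAE] K1 by (subst integral_rescale) auto
    show "continuous_on {0..T} (\<lambda>\<tau>. fourier (L \<tau>) \<zeta>)" for \<zeta>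
      unfolding L_def fourier_rescale[OF exp_gt_zero]
      by (rule continuous_on_compose2[OF continuous_fourier[of _ UNIV]])
         (auto intro!: continuous_intros Ki)
    fix t assume t: "t \<in> {0..T}"
    have "AE x in lborel. u t x = exp ((real DIM('a) - lam) * t) * u0 (exp t *\<^sub>R x) +
          (LINT \<tau>:{0..t}|lborel. lam * exp ((real DIM('a) - lam) * (t - \<tau>)) * conv K (u \<tau>) (exp (t - \<tau>) *\<^sub>R x))"
      using mild t unfolding mild_solution_def by (auto elim: AE_mp)
    \<comment> \<open>Substituting x = e^(-t) y turns the argument e^(t-\<tau>) x into e^(-\<tau>)
      y, which no longer involves t.\<close>
    from AE_lborel_affine[OF _ this, of "exp (- t)" 0]
    have "AE y in lborel. u t (exp (- t) *\<^sub>R y) = exp ((real DIM('a) - lam) * t) * u0 y +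
          (LINT \<tau>:{0..t}|lborel. lam * exp ((real DIM('a) - lam) * (t - \<tau>)) * conv K (u \<tau>) (exp (- \<tau>) *\<^sub>R y))"
      by (simp add: mult_exp_exp)
    with VAE[OF t] show "AE y in lborel. V t y = u0 y + (LINT \<tau>:{0..t}|lborel. lam * conv (L \<tau>) (V \<tau>) y)"
    proof eventually_elim
      case (elim y)
      have "exp ((lam - DIM('a)) * t) * (LINT \<tau>:{0..t}|lborel. lam * exp ((real DIM('a) - lam) * (t - \<tau>)) * conv K (u \<tau>) (exp (- \<tau>) *\<^sub>R y))
         = (LINT \<tau>:{0..t}|lborel. lam * conv (L \<tau>) (V \<tau>) y)"
        unfolding set_integral_mult_right[symmetric]
      proof (rule set_lebesgue_integral_cong)
        show "\<forall>\<tau>. \<tau> \<in> {0..t} \<longrightarrow> exp ((lam - DIM('a)) * t) * (lam * exp ((real DIM('a) - lam) * (t - \<tau>)) * conv K (u \<tau>) (exp (- \<tau>) *\<^sub>R y))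
            = lam * conv (L \<tau>) (V \<tau>) y"
        proof safe
          fix \<tau> assume "\<tau> \<in> {0..t}"
          then have \<tau>: "\<tau> \<in> {0..T}" using t by auto
          have "exp ((lam - DIM('a)) * t) * exp ((real DIM('a) - lam) * (t - \<tau>)) = exp ((lam - DIM('a)) * \<tau>)"
            by (simp add: mult_exp_exp algebra_simps)
          then show "exp ((lam - DIM('a)) * t) * (lam * exp ((real DIM('a) - lam) * (t - \<tau>)) * conv K (u \<tau>) (exp (- \<tau>) *\<^sub>R y))
            = lam * conv (L \<tau>) (V \<tau>) y"
            unfolding convL[OF \<tau>] by (metis mult.assoc mult.left_commute)
        qed
      qed auto
      moreover have "exp ((lam - DIM('a)) * t) * exp ((real DIM('a) - lam) * t) = 1"
        by (simp add: mult_exp_exp algebra_simps)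
      ultimately show ?case
        unfolding elim by (simp add: distrib_left mult.assoc[symmetric])
    qed
  qed (use lam T Vm Vi Vb u0 in auto)
  then show thesis
    using VAE by (intro that) (auto simp: L_def)
qed

section \<open>Fractional moments\<close>

lemma fourier_cmult: "fourier (\<lambda>x. c * f x) \<xi> = complex_of_real c * fourier f \<xi>"
  unfolding fourier_def integral_mult_right_zero[symmetric]
  by (intro Bochner_Integration.integral_cong) (auto simp: mult_ac)

text \<open>Shows \<open>V\<close> as e^(lam t) times a mass-preserving dilation of the solution,
  from which its mass, integrals and transform can be read off.\<close>

lemma exp_rescale:
  fixes lam t :: real
  shows
  "exp ((lam - DIM('a)) * t) * f (exp (- t) *\<^sub>R y) = exp (lam * t) * rescale (exp t) f (y::'a::euclidean_space)"
proof -
  have "exp ((lam - DIM('a)) * t) = exp (lam * t) * inverse (exp t ^ DIM('a))"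
    unfolding exp_of_nat_mult[symmetric] exp_minus[symmetric] mult_exp_exp by (simp add: algebra_simps)
  then show ?thesis by (simp add: rescale_eq exp_minus)
qed

lemma prob_densityD:
  assumes "prob_density K"
  shows "K \<in> borel_measurable borel" "integrable lborel K" "(\<integral>x. K x \<partial>lborel) = 1"
    "AE x in lborel. \<bar>K x\<bar> = K x"
  using assms by (auto simp: prob_density_def elim: AE_mp)

lemma fourier_abs_prob_density:
  assumes "prob_density K"
  shows "fourier (\<lambda>x. \<bar>K x\<bar>) = fourier K"
  using prob_densityD[OF assms] by (intro ext fourier_cong_AE) auto

lemma mild_solution_integrable:
  assumes "mild_solution k lam K u0 u" "0 \<le> k" "0 \<le> t"
  shows "integrable lborel (u t)"
  using assms by (intro L1w_integrable(1)) (auto simp: mild_solution_def)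

context
  fixes K u0 :: "'a::euclidean_space \<Rightarrow> real" and u :: "real \<Rightarrow> 'a \<Rightarrow> real" and k lam t :: real
  assumes mild: "mild_solution k lam K u0 u"
    and k: "0 \<le> k" and lam: "0 \<le> lam" and t: "0 \<le> t"
    and K: "prob_density K" and u0: "integrable lborel u0"
begin

text \<open>The final time t serves as the horizon of the Duhamel problem. Dividing by e^(lam t)
  subtracts 1 from the transform of the kernel, so the exponent acquires nonpositive real
  part.\<close>

lemma mild_solution_fourier:
  "fourier (u t) (exp t *\<^sub>R \<zeta>) = fourier u0 \<zeta> *
    exp (LINT \<tau>:{0..t}|lborel. complex_of_real lam * (fourier K (exp \<tau> *\<^sub>R \<zeta>) - 1))"
proof -
  obtain V B where V: "conv_duhamel (\<lambda>\<tau>. rescale (exp \<tau>) (\<lambda>x. \<bar>K x\<bar>)) V u0 lam t B"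
    and VAE: "\<And>s. s \<in> {0..t} \<Longrightarrow>
      AE y in lborel. V s y = exp ((lam - DIM('a)) * s) * u s (exp (- s) *\<^sub>R y)"
    using mild_solution_conv_duhamel[OF mild k lam t K u0] by blast
  interpret conv_duhamel "\<lambda>\<tau>. rescale (exp \<tau>) (\<lambda>x. \<bar>K x\<bar>)" V u0 lam t B by (rule V)
  note ui = mild_solution_integrable[OF mild k t]
  have [measurable]: "u t \<in> borel_measurable borel" "V t \<in> borel_measurable borel"
    using ui V_int[of t] by auto
  have "fourier (V t) \<zeta> = fourier (\<lambda>y. exp (lam * t) * rescale (exp t) (u t) y) \<zeta>"
    using VAE[of t] t unfolding exp_rescale
    by (intro fourier_cong_AE) (auto simp: rescale_eq[OF exp_gt_zero, abs_def])
  also have "\<dots> = exp (lam * t) * fourier (u t) (exp t *\<^sub>R \<zeta>)"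
    by (simp add: fourier_cmult fourier_rescale)
  finally have 1: "exp (lam * t) * fourier (u t) (exp t *\<^sub>R \<zeta>) = fourier u0 \<zeta> *
    exp (LINT \<tau>:{0..t}|lborel. complex_of_real lam * fourier K (exp \<tau> *\<^sub>R \<zeta>))"
    using fourier_V[of t \<zeta>] t by (simp add: fourier_rescale fourier_abs_prob_density[OF K])
  have c: "continuous_on {0..t} (\<lambda>\<tau>. fourier K (exp \<tau> *\<^sub>R \<zeta>))"
    using K_fourier[of \<zeta>] by (simp add: fourier_rescale fourier_abs_prob_density[OF K])
  have "(LINT \<tau>:{0..t}|lborel. complex_of_real lam * (fourier K (exp \<tau> *\<^sub>R \<zeta>) - 1)) =
    (LINT \<tau>:{0..t}|lborel. complex_of_real lam * fourier K (exp \<tau> *\<^sub>R \<zeta>)) - (LINT \<tau>:{0..t}|lborel. complex_of_real lam)"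
    unfolding right_diff_distrib mult_1_right
    by (intro set_integral_diff(2) borel_integrable_atLeastAtMost' continuous_intros c)
  also have "(LINT \<tau>:{0..t}|lborel. complex_of_real lam) = complex_of_real (lam * t)"
    using t by (simp add: set_lebesgue_integral_def scaleR_conv_of_real mult.commute)
  finally have "exp (LINT \<tau>:{0..t}|lborel. complex_of_real lam * (fourier K (exp \<tau> *\<^sub>R \<zeta>) - 1)) =
      exp (LINT \<tau>:{0..t}|lborel. complex_of_real lam * fourier K (exp \<tau> *\<^sub>R \<zeta>)) / complex_of_real (exp (lam * t))"
    by (simp only: exp_diff exp_of_real)
  then have e: "fourier u0 \<zeta> * exp (LINT \<tau>:{0..t}|lborel. complex_of_real lam * (fourier K (exp \<tau> *\<^sub>R \<zeta>) - 1)) =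
      fourier u0 \<zeta> * exp (LINT \<tau>:{0..t}|lborel. complex_of_real lam * fourier K (exp \<tau> *\<^sub>R \<zeta>)) / complex_of_real (exp (lam * t))"
    by (simp only: times_divide_eq_right)
  show ?thesis
    unfolding e 1[symmetric] by simp
qed

text \<open>Both sides of the estimates for \<open>V\<close> carry the factor e^(lam t). After
  cancellation \<open>lam\<close> survives only multiplied by 1 minus the transform of the
  kernel.\<close>

lemma mild_solution_mass: "(\<integral>x. \<bar>u t x\<bar> \<partial>lborel) \<le> (\<integral>x. \<bar>u0 x\<bar> \<partial>lborel)"
  and mild_solution_one_minus_cos:
  "(\<integral>x. (1 - cos ((exp t *\<^sub>R x) \<bullet> \<zeta>)) * \<bar>u t x\<bar> \<partial>lborel) \<le>
    (\<integral>y. (1 - cos (y \<bullet> \<zeta>)) * \<bar>u0 y\<bar> \<partial>lborel) +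
      (\<integral>y. \<bar>u0 y\<bar> \<partial>lborel) * (LINT \<tau>:{0..t}|lborel. lam * cmod (1 - fourier K (exp \<tau> *\<^sub>R \<zeta>)))"
proof -
  obtain V B where V: "conv_duhamel (\<lambda>\<tau>. rescale (exp \<tau>) (\<lambda>x. \<bar>K x\<bar>)) V u0 lam t B"
    and VAE: "\<And>s. s \<in> {0..t} \<Longrightarrow>
      AE y in lborel. V s y = exp ((lam - DIM('a)) * s) * u s (exp (- s) *\<^sub>R y)"
    using mild_solution_conv_duhamel[OF mild k lam t K u0] by blast
  interpret conv_duhamel "\<lambda>\<tau>. rescale (exp \<tau>) (\<lambda>x. \<bar>K x\<bar>)" V u0 lam t B by (rule V)
  note ui = mild_solution_integrable[OF mild k t]
  have [measurable]: "u t \<in> borel_measurable borel" "V t \<in> borel_measurable borel"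
    using ui V_int[of t] by auto
  have scale: "(\<integral>y. \<psi> y * \<bar>V t y\<bar> \<partial>lborel) = exp (lam * t) * (\<integral>x. \<psi> (exp t *\<^sub>R x) * \<bar>u t x\<bar> \<partial>lborel)"
    if [measurable]: "\<psi> \<in> borel_measurable borel" for \<psi> :: "'a \<Rightarrow> real"
  proof -
    have "(\<integral>y. \<psi> y * \<bar>V t y\<bar> \<partial>lborel) = (\<integral>y. exp (lam * t) * rescale (exp t) (\<lambda>x. \<psi> (exp t *\<^sub>R x) * \<bar>u t x\<bar>) y \<partial>lborel)"
    proof (rule integral_cong_AE)
      show "AE y in lborel. \<psi> y * \<bar>V t y\<bar> = exp (lam * t) * rescale (exp t) (\<lambda>x. \<psi> (exp t *\<^sub>R x) * \<bar>u t x\<bar>) y"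
        using VAE[of t, unfolded exp_rescale] t by (auto simp: rescale_eq abs_mult elim!: AE_mp)
    qed (auto simp: rescale_eq[OF exp_gt_zero, abs_def])
    then show ?thesis by (simp add: integral_rescale)
  qed
  have "exp (lam * t) * (\<integral>x. \<bar>u t x\<bar> \<partial>lborel) \<le> exp (lam * t) * (\<integral>x. \<bar>u0 x\<bar> \<partial>lborel)"
    using mass_bound[of t] scale[of "\<lambda>_. 1"] t by simp
  then show "(\<integral>x. \<bar>u t x\<bar> \<partial>lborel) \<le> (\<integral>x. \<bar>u0 x\<bar> \<partial>lborel)" by simp
  show "(\<integral>x. (1 - cos ((exp t *\<^sub>R x) \<bullet> \<zeta>)) * \<bar>u t x\<bar> \<partial>lborel) \<le>
    (\<integral>y. (1 - cos (y \<bullet> \<zeta>)) * \<bar>u0 y\<bar> \<partial>lborel) +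
      (\<integral>y. \<bar>u0 y\<bar> \<partial>lborel) * (LINT \<tau>:{0..t}|lborel. lam * cmod (1 - fourier K (exp \<tau> *\<^sub>R \<zeta>)))"
    using one_minus_cos_bound[of t \<zeta>] scale[of "\<lambda>y. 1 - cos (y \<bullet> \<zeta>)"] t
    by (simp add: fourier_rescale fourier_abs_prob_density[OF K])
qed

end

section \<open>Fractional powers represented by cosines\<close>

lemma powr_add_le_add_powr:
  fixes a b m :: real
  assumes "0 \<le> a" "0 \<le> b" "0 < m" "m \<le> 1"
  shows "(a + b) powr m \<le> a powr m + b powr m"
proof (cases "a + b = 0")
  case False
  then have s: "0 < a + b" using assms by auto
  have le: "c \<le> c powr m" if "0 \<le> c" "c \<le> 1" for c :: real
  proof (cases "c = 0")
    case False
    then have "c powr 1 \<le> c powr m" using that assms by (intro powr_mono') auto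
    then show ?thesis using that by simp
  qed simp
  \<comment> \<open>After normalisation the two fractions lie in [0,1], where c \<le> c^m, and they
    add up to 1.\<close>
  have "1 = a / (a + b) + b / (a + b)" using s by (simp flip: add_divide_distrib)
  also have "\<dots> \<le> (a / (a + b)) powr m + (b / (a + b)) powr m"
    using assms s by (intro add_mono le) auto
  finally have "(a + b) powr m * 1 \<le> (a + b) powr m * ((a / (a + b)) powr m + (b / (a + b)) powr m)"
    by (intro mult_left_mono) auto
  also have "\<dots> = a powr m + b powr m"
    using assms s by (simp add: powr_divide distrib_left)
  finally show ?thesis by simp
qed (use assms in auto)

text \<open>Subadditivity of the power m \<le> 1 reduces the weight to one-dimensional moments, so
  only frequencies on the coordinate axes matter.\<close>

lemma jbr_powr_le:
  fixes x :: "'a::euclidean_space"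
  assumes m: "0 < m" "m \<le> 1"
  shows "jbr x powr m \<le> 1 + (\<Sum>b\<in>Basis. \<bar>x \<bullet> b\<bar> powr m)"
proof -
  have sum: "(\<Sum>b\<in>A. \<bar>x \<bullet> b\<bar>) powr m \<le> (\<Sum>b\<in>A. \<bar>x \<bullet> b\<bar> powr m)" if "finite A" for A
    using that
  proof induction
    case (insert b A)
    have "(\<Sum>b\<in>insert b A. \<bar>x \<bullet> b\<bar>) powr m \<le> \<bar>x \<bullet> b\<bar> powr m + (\<Sum>b\<in>A. \<bar>x \<bullet> b\<bar>) powr m"
      using insert m by (simp add: powr_add_le_add_powr sum_nonneg)
    then show ?case using insert by simp
  qed simp
  have "jbr x \<le> 1 + norm x"
    unfolding jbr_def by (rule real_le_lsqrt) (auto simp: power2_sum)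
  also have "\<dots> \<le> 1 + (\<Sum>b\<in>Basis. \<bar>x \<bullet> b\<bar>)"
    using norm_le_l1 by auto
  finally have "jbr x powr m \<le> (1 + (\<Sum>b\<in>Basis. \<bar>x \<bullet> b\<bar>)) powr m"
    using jbr_ge_1[of x] m by (intro powr_mono2) auto
  also have "\<dots> \<le> 1 powr m + (\<Sum>b\<in>Basis. \<bar>x \<bullet> b\<bar>) powr m"
    using m by (intro powr_add_le_add_powr sum_nonneg) auto
  also have "\<dots> \<le> 1 + (\<Sum>b\<in>Basis. \<bar>x \<bullet> b\<bar> powr m)"
    using sum[OF finite_Basis] by simp
  finally show ?thesis .
qed

lemma inner_Basis_powr_le_jbr:
  fixes x :: "'a::euclidean_space"
  assumes "b \<in> Basis" "0 \<le> m"
  shows "\<bar>x \<bullet> b\<bar> powr m \<le> jbr x powr m"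
proof (rule powr_mono2)
  have "\<bar>x \<bullet> b\<bar> \<le> norm x" by (rule Basis_le_norm[OF assms(1)])
  also have "\<dots> \<le> jbr x" unfolding jbr_def by (rule real_le_rsqrt) simp
  finally show "\<bar>x \<bullet> b\<bar> \<le> jbr x" .
qed (use assms in auto)

text \<open>Near 0 the integrand is r^(-m), integrable since m < 1; near infinity it is r^(-1-m),
  integrable since m > 0. The first half is what restricts the moments to order below 1.\<close>

lemma nn_integral_min_powr_finite:
  assumes m: "0 < m" "m < (1::real)"
  shows "(\<integral>\<^sup>+r. ennreal (indicator {0<..} r * (min 1 r * r powr (- 1 - m))) \<partial>lborel) < \<infinity>"
proof -
  have 1: "(\<integral>\<^sup>+r. ennreal (indicator {0..1} r * r powr (- m)) \<partial>lborel) = ennreal (1 powr (- m + 1) / (- m + 1))"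
    using nn_integral_has_integral_lebesgue[OF _ has_integral_powr_from_0[of "- m" 1]] m by simp
  have 2: "(\<integral>\<^sup>+r. ennreal (indicator {1..} r * r powr (- 1 - m)) \<partial>lborel) = ennreal (- (1 powr (- 1 - m + 1)) / (- 1 - m + 1))"
    using nn_integral_has_integral_lebesgue[OF _ has_integral_powr_to_inf[of "- 1 - m" 1]] m by simp
  have "(\<integral>\<^sup>+r. ennreal (indicator {0<..} r * (min 1 r * r powr (- 1 - m))) \<partial>lborel)
     \<le> (\<integral>\<^sup>+r. ennreal (indicator {0..1} r * r powr (- m)) + ennreal (indicator {1..} r * r powr (- 1 - m)) \<partial>lborel)"
  proof (rule nn_integral_mono)
    fix r :: real
    have "r * r powr (- 1 - m) = r powr (- m)" if "0 < r"
      using that powr_add[of r 1 "- 1 - m"] by simp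
    then have "indicator {0<..} r * (min 1 r * r powr (- 1 - m)) \<le>
        indicator {0..1} r * r powr (- m) + indicator {1..} r * r powr (- 1 - m)"
      by (auto simp: min_def split: split_indicator)
    then show "ennreal (indicator {0<..} r * (min 1 r * r powr (- 1 - m)))
     \<le> ennreal (indicator {0..1} r * r powr (- m)) + ennreal (indicator {1..} r * r powr (- 1 - m))"
      by (simp add: ennreal_leI flip: ennreal_plus)
  qed
  also have "\<dots> = ennreal (1 powr (- m + 1) / (- m + 1)) + ennreal (- (1 powr (- 1 - m + 1)) / (- 1 - m + 1))"
    by (subst nn_integral_add) (auto simp: 1 2)
  also have "\<dots> < \<infinity>" by simp
  finally show ?thesis .
qed

lemma one_minus_cos_le: "1 - cos (r::real) \<le> 2 * min 1 \<bar>r\<bar>"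
proof -
  have "1 - cos r = 2 * (sin (r/2))\<^sup>2"
    using cos_double_sin[of "r / 2"] by simp
  also have "\<dots> \<le> 2 * \<bar>sin (r/2)\<bar>"
  proof -
    have "(sin (r/2))\<^sup>2 = \<bar>sin (r/2)\<bar> * \<bar>sin (r/2)\<bar>" by (simp add: power2_eq_square)
    also have "\<dots> \<le> \<bar>sin (r/2)\<bar> * 1" by (intro mult_left_mono abs_sin_le_one) auto
    finally show ?thesis by simp
  qed
  also have "\<dots> \<le> 2 * \<bar>r\<bar>" using abs_sin_x_le_abs_x[of "r/2"] by simp
  finally show ?thesis using cos_ge_minus_one[of r] by (cases "1 \<le> \<bar>r\<bar>") (auto simp: min_def)
qed

text \<open>Normalising constant in the cosine representation of |x|^m. It takes values in
  \<open>ennreal\<close> so that the representation and Tonelli hold without finiteness; finiteness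
  and positivity enter only when it is cancelled.\<close>

definition fractional_const :: "real \<Rightarrow> ennreal" where
  "fractional_const m = (\<integral>\<^sup>+r. ennreal (indicator {0<..} r * ((1 - cos r) * r powr (- 1 - m))) \<partial>lborel)"

lemma fractional_const_finite:
  assumes "0 < m" "m < 1"
  shows "fractional_const m < \<infinity>"
proof -
  have "fractional_const m \<le> (\<integral>\<^sup>+r. ennreal 2 * ennreal (indicator {0<..} r * (min 1 r * r powr (- 1 - m))) \<partial>lborel)"
    unfolding fractional_const_def
  proof (rule nn_integral_mono)
    fix r :: real
    have "(1 - cos r) * r powr (- 1 - m) \<le> 2 * min 1 \<bar>r\<bar> * r powr (- 1 - m)"
      by (intro mult_right_mono one_minus_cos_le) auto
    then show "ennreal (indicator {0<..} r * ((1 - cos r) * r powr (- 1 - m))) \<le>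
      ennreal 2 * ennreal (indicator {0<..} r * (min 1 r * r powr (- 1 - m)))"
      by (subst ennreal_mult[symmetric]) (auto intro!: ennreal_leI simp del: ennreal_numeral split: split_indicator)
  qed
  also have "\<dots> < \<infinity>"
    using nn_integral_min_powr_finite[OF assms] by (subst nn_integral_cmult) (auto simp: ennreal_mult_less_top)
  finally show ?thesis .
qed

text \<open>On [1,2], inside [0,\<pi>] where cos decreases, the integrand is at least (1 - cos 1)
  2^(-1-m).\<close>

lemma fractional_const_pos: "0 < m \<Longrightarrow> 0 < fractional_const m"
proof -
  assume m: "0 < m"
  define c where "c = (1 - cos 1) * 2 powr (- 1 - m)"
  have "cos (1::real) < cos 0" by (intro cos_monotone_0_pi) (use pi_gt3 in auto)
  then have c: "0 < c" by (simp add: c_def)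
  have "0 < (\<integral>\<^sup>+r. ennreal c * indicator {1..2::real} r \<partial>lborel)"
    using c by (subst nn_integral_cmult_indicator) auto
  also have "\<dots> \<le> fractional_const m"
    unfolding fractional_const_def
  proof (rule nn_integral_mono)
    fix r :: real
    show "ennreal c * indicator {1..2} r \<le> ennreal (indicator {0<..} r * ((1 - cos r) * r powr (- 1 - m)))"
    proof (cases "r \<in> {1..2}")
      case True
      then have "cos r \<le> cos 1" by (intro cos_monotone_0_pi_le) (use pi_gt3 in auto)
      moreover have "2 powr (- 1 - m) \<le> r powr (- 1 - m)"
        using True m by (intro powr_mono2') auto
      ultimately have "c \<le> (1 - cos r) * r powr (- 1 - m)"
        unfolding c_def by (intro mult_mono) auto
      with True show ?thesis by (auto intro!: ennreal_leI)
    qed auto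
  qed
  finally show ?thesis .
qed

text \<open>Dilating r by |x| in the integral that defines the constant produces the power of |x|;
  at x = 0 both sides vanish.\<close>

lemma fractional_powr_eq:
  assumes m: "0 < m"
  shows "(\<integral>\<^sup>+r. ennreal (indicator {0<..} r * ((1 - cos (r * x)) * r powr (- 1 - m))) \<partial>lborel) =
    ennreal (\<bar>x\<bar> powr m) * fractional_const m"
proof (cases "x = 0")
  case False
  then have x: "0 < \<bar>x\<bar>" by simp
  have cosx: "cos (r * \<bar>x\<bar>) = cos (r * x)" for r
    by (simp add: abs_if)
  have "fractional_const m = ennreal \<bar>x\<bar> * (\<integral>\<^sup>+r. ennreal (indicator {0<..} (0 + \<bar>x\<bar> * r) * ((1 - cos (0 + \<bar>x\<bar> * r)) * (0 + \<bar>x\<bar> * r) powr (- 1 - m))) \<partial>lborel)"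
    unfolding fractional_const_def using x
    by (subst nn_integral_real_affine[where c="\<bar>x\<bar>" and t=0]) auto
  also have "(\<integral>\<^sup>+r. ennreal (indicator {0<..} (0 + \<bar>x\<bar> * r) * ((1 - cos (0 + \<bar>x\<bar> * r)) * (0 + \<bar>x\<bar> * r) powr (- 1 - m))) \<partial>lborel) =
    (\<integral>\<^sup>+r. ennreal (\<bar>x\<bar> powr (- 1 - m)) * ennreal (indicator {0<..} r * ((1 - cos (r * x)) * r powr (- 1 - m))) \<partial>lborel)"
  proof (rule nn_integral_cong)
    fix r :: real
    show "ennreal (indicator {0<..} (0 + \<bar>x\<bar> * r) * ((1 - cos (0 + \<bar>x\<bar> * r)) * (0 + \<bar>x\<bar> * r) powr (- 1 - m))) =
       ennreal (\<bar>x\<bar> powr (- 1 - m)) * ennreal (indicator {0<..} r * ((1 - cos (r * x)) * r powr (- 1 - m)))"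
      using x cosx[of r]
      by (auto simp: zero_less_mult_iff powr_mult mult_ac simp flip: ennreal_mult split: split_indicator)
  qed
  also have "\<dots> = ennreal (\<bar>x\<bar> powr (- 1 - m)) * (\<integral>\<^sup>+r. ennreal (indicator {0<..} r * ((1 - cos (r * x)) * r powr (- 1 - m))) \<partial>lborel)"
    by (rule nn_integral_cmult) measurable
  finally have "ennreal (\<bar>x\<bar> powr m) * fractional_const m = ennreal (\<bar>x\<bar> powr m * (\<bar>x\<bar> * \<bar>x\<bar> powr (- 1 - m))) *
    (\<integral>\<^sup>+r. ennreal (indicator {0<..} r * ((1 - cos (r * x)) * r powr (- 1 - m))) \<partial>lborel)"
    by (simp add: ennreal_mult mult_ac)
  moreover have "\<bar>x\<bar> powr m * (\<bar>x\<bar> * \<bar>x\<bar> powr (- 1 - m)) = \<bar>x\<bar> powr (m + (1 + (- 1 - m)))"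
    using x by (simp only: powr_add powr_one)
  ultimately show ?thesis using x by simp
qed simp

text \<open>Tonelli applied to the cosine representation. Both sides live in \<open>ennreal\<close>,
  so the moment need not be known finite; its finiteness is later deduced from the right-hand
  side.\<close>

lemma fractional_moment_eq:
  fixes v :: "'a::euclidean_space \<Rightarrow> real"
  assumes m: "0 < m" and v: "integrable lborel v"
  shows "fractional_const m * (\<integral>\<^sup>+x. ennreal (\<bar>x \<bullet> b\<bar> powr m * \<bar>v x\<bar>) \<partial>lborel) =
    (\<integral>\<^sup>+r. ennreal (indicator {0<..} r * r powr (- 1 - m)) * ennreal (\<integral>x. (1 - cos (x \<bullet> (r *\<^sub>R b))) * \<bar>v x\<bar> \<partial>lborel) \<partial>lborel)"
proof -
  have [measurable]: "v \<in> borel_measurable borel" using v by auto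
  have "fractional_const m * (\<integral>\<^sup>+x. ennreal (\<bar>x \<bullet> b\<bar> powr m * \<bar>v x\<bar>) \<partial>lborel) =
    (\<integral>\<^sup>+x. (\<integral>\<^sup>+r. ennreal (indicator {0<..} r * ((1 - cos (r * (x \<bullet> b))) * r powr (- 1 - m))) \<partial>lborel) * ennreal \<bar>v x\<bar> \<partial>lborel)"
    unfolding fractional_powr_eq[OF m]
    by (subst nn_integral_cmult[symmetric]) (auto simp: ennreal_mult mult_ac intro!: nn_integral_cong)
  also have "\<dots> = (\<integral>\<^sup>+x. (\<integral>\<^sup>+r. ennreal (indicator {0<..} r * r powr (- 1 - m)) * ennreal ((1 - cos (x \<bullet> (r *\<^sub>R b))) * \<bar>v x\<bar>) \<partial>lborel) \<partial>lborel)"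
  proof (rule nn_integral_cong)
    fix x
    show "(\<integral>\<^sup>+r. ennreal (indicator {0<..} r * ((1 - cos (r * (x \<bullet> b))) * r powr (- 1 - m))) \<partial>lborel) * ennreal \<bar>v x\<bar> =
      (\<integral>\<^sup>+r. ennreal (indicator {0<..} r * r powr (- 1 - m)) * ennreal ((1 - cos (x \<bullet> (r *\<^sub>R b))) * \<bar>v x\<bar>) \<partial>lborel)"
      by (subst nn_integral_multc[symmetric])
         (auto simp: mult_ac simp flip: ennreal_mult intro!: nn_integral_cong)
  qed
  also have "\<dots> = (\<integral>\<^sup>+r. (\<integral>\<^sup>+x. ennreal (indicator {0<..} r * r powr (- 1 - m)) * ennreal ((1 - cos (x \<bullet> (r *\<^sub>R b))) * \<bar>v x\<bar>) \<partial>lborel) \<partial>lborel)"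
    by (rule lborel_pair.Fubini') measurable
  also have "\<dots> = (\<integral>\<^sup>+r. ennreal (indicator {0<..} r * r powr (- 1 - m)) * ennreal (\<integral>x. (1 - cos (x \<bullet> (r *\<^sub>R b))) * \<bar>v x\<bar> \<partial>lborel) \<partial>lborel)"
  proof (rule nn_integral_cong)
    fix r
    have "(\<integral>\<^sup>+x. ennreal ((1 - cos (x \<bullet> (r *\<^sub>R b))) * \<bar>v x\<bar>) \<partial>lborel) = ennreal (\<integral>x. (1 - cos (x \<bullet> (r *\<^sub>R b))) * \<bar>v x\<bar> \<partial>lborel)"
      by (rule nn_integral_eq_integral[OF integral_one_minus_cos(2)]) (use v in auto)
    then show "(\<integral>\<^sup>+x. ennreal (indicator {0<..} r * r powr (- 1 - m)) * ennreal ((1 - cos (x \<bullet> (r *\<^sub>R b))) * \<bar>v x\<bar>) \<partial>lborel)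
      = ennreal (indicator {0<..} r * r powr (- 1 - m)) * ennreal (\<integral>x. (1 - cos (x \<bullet> (r *\<^sub>R b))) * \<bar>v x\<bar> \<partial>lborel)"
      by (subst nn_integral_cmult) auto
  qed
  finally show ?thesis .
qed

text \<open>The bound is chosen before the kernel, the rate, the solution and the time; the kernel
  enters only through a linear bound on \<open>lam\<close> times the symbol on the axes. Linear
  growth near r = 0 suffices since m < 1. That the solution has a moment of order m at all is part
  of the conclusion.\<close>

lemma moment_uniform:
  fixes u0 :: "'a::euclidean_space \<Rightarrow> real"
  assumes m: "0 < m" "m < 1" and u0: "L1w m u0" and A: "0 \<le> A" and T: "0 \<le> T"
  shows "\<exists>C. \<forall>K k lam u t. mild_solution k lam K u0 u \<longrightarrow> 0 \<le> k \<longrightarrow> 0 \<le> lam \<longrightarrow> prob_density K \<longrightarrow>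
     0 \<le> t \<longrightarrow> t \<le> T \<longrightarrow>
     (\<forall>b\<in>Basis. \<forall>r\<in>{0<..1}. \<forall>\<tau>\<in>{0..t}. lam * cmod (1 - fourier K (exp \<tau> *\<^sub>R r *\<^sub>R b)) \<le> A * r) \<longrightarrow>
     L1w m (u t) \<and> L1w_norm m (u t) \<le> C"
proof -
  have u0i: "integrable lborel u0" using L1w_integrable(1)[OF _ u0] m by simp
  have [measurable]: "u0 \<in> borel_measurable borel" using u0i by auto
  define N where "N = (\<integral>x. \<bar>u0 x\<bar> \<partial>lborel)"
  \<comment> \<open>The maximum serves both ranges of r: \<open>A * T\<close> from the Gronwall
    source for r \<le> 1, and 2 from 1 - cos \<le> 2 for r > 1.\<close>
  define D where "D = N * max (A * T) 2"
  define E where "E = enn2real (\<integral>\<^sup>+r. ennreal (indicator {0<..} r * (min 1 r * r powr (- 1 - m))) \<partial>lborel)"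
  define c where "c = enn2real (fractional_const m)"
  define M where "M = (\<lambda>b. \<integral>x. \<bar>x \<bullet> b\<bar> powr m * \<bar>u0 x\<bar> \<partial>lborel)"
  define C where "C = N + (\<Sum>b\<in>Basis. M b + D * E / c)"
  have N: "0 \<le> N" by (simp add: N_def)
  have D: "0 \<le> D" using N by (simp add: D_def)
  have E: "(\<integral>\<^sup>+r. ennreal (indicator {0<..} r * (min 1 r * r powr (- 1 - m))) \<partial>lborel) = ennreal E" "0 \<le> E"
    using nn_integral_min_powr_finite[OF m] by (auto simp: E_def)
  have c: "fractional_const m = ennreal c" "0 < c"
    using fractional_const_finite[OF m] fractional_const_pos[OF m(1)] by (auto simp: c_def enn2real_positive_iff)
  have M: "(\<integral>\<^sup>+x. ennreal (\<bar>x \<bullet> b\<bar> powr m * \<bar>u0 x\<bar>) \<partial>lborel) = ennreal (M b)" "0 \<le> M b" if b: "b \<in> Basis" for b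
  proof -
    have "integrable lborel (\<lambda>x. \<bar>x \<bullet> b\<bar> powr m * \<bar>u0 x\<bar>)"
    proof (rule Bochner_Integration.integrable_bound)
      show "integrable lborel (\<lambda>x. jbr x powr m * \<bar>u0 x\<bar>)" using u0 by (simp add: L1w_def)
      show "AE x in lborel. norm (\<bar>x \<bullet> b\<bar> powr m * \<bar>u0 x\<bar>) \<le> norm (jbr x powr m * \<bar>u0 x\<bar>)"
        using inner_Basis_powr_le_jbr[OF b] m by (auto simp: abs_mult intro!: mult_right_mono)
    qed measurable
    then show "(\<integral>\<^sup>+x. ennreal (\<bar>x \<bullet> b\<bar> powr m * \<bar>u0 x\<bar>) \<partial>lborel) = ennreal (M b)"
      unfolding M_def by (rule nn_integral_eq_integral) auto
    show "0 \<le> M b" by (simp add: M_def)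
  qed
  have nn: "0 \<le> M b + D * E / c" if "b \<in> Basis" for b
    using M(2)[OF that] D E(2) c(2) by simp
  have "L1w m (u t) \<and> L1w_norm m (u t) \<le> C"
    if mild: "mild_solution k lam K u0 u" and k: "0 \<le> k" and lam: "0 \<le> lam" and K: "prob_density K"
    and t: "0 \<le> t" "t \<le> T"
    and bd: "\<And>b r \<tau>. b \<in> Basis \<Longrightarrow> r \<in> {0<..1} \<Longrightarrow> \<tau> \<in> {0..t} \<Longrightarrow> lam * cmod (1 - fourier K (exp \<tau> *\<^sub>R r *\<^sub>R b)) \<le> A * r"
    for K k lam u t
  proof -
    have ui: "integrable lborel (u t)" by (rule mild_solution_integrable[OF mild k t(1)])
    then have [measurable]: "u t \<in> borel_measurable borel" by auto
    have mass: "(\<integral>x. \<bar>u t x\<bar> \<partial>lborel) \<le> N"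
      unfolding N_def by (rule mild_solution_mass[OF mild k lam t(1) K u0i])
    have X: "(\<integral>\<^sup>+x. ennreal (\<bar>x \<bullet> b\<bar> powr m * \<bar>u t x\<bar>) \<partial>lborel) \<le> ennreal (M b + D * E / c)" if b: "b \<in> Basis" for b
    proof -
      define P where "P = (\<lambda>r. \<integral>x. (1 - cos (x \<bullet> (r *\<^sub>R (exp t *\<^sub>R b)))) * \<bar>u t x\<bar> \<partial>lborel)"
      define P0 where "P0 = (\<lambda>r. \<integral>x. (1 - cos (x \<bullet> (r *\<^sub>R b))) * \<bar>u0 x\<bar> \<partial>lborel)"
      have P0: "0 \<le> P0 r" for r unfolding P0_def by (intro Bochner_Integration.integral_nonneg) auto
      have P: "P r \<le> P0 r + D * min 1 r" if r: "0 < r" for r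
      proof (cases "r \<le> 1")
        case True
        have "(LINT \<tau>:{0..t}|lborel. lam * cmod (1 - fourier K (exp \<tau> *\<^sub>R r *\<^sub>R b))) \<le> (LINT \<tau>:{0..t}|lborel. A * r)"
          unfolding set_lebesgue_integral_def
          using bd[OF b, of r] True r A t
          by (intro integral_mono_AE' integrable_mult_left integrable_real_indicator)
             (auto simp: emeasure_lborel_Icc_eq intro!: AE_I2 split: split_indicator)
        also have "\<dots> = (A * t) * r" using t by (simp add: set_lebesgue_integral_def)
        also have "\<dots> \<le> max (A * T) 2 * r"
          using t A r by (intro mult_right_mono) (auto simp: max.coboundedI1 mult_left_mono)
        finally have "N * (LINT \<tau>:{0..t}|lborel. lam * cmod (1 - fourier K (exp \<tau> *\<^sub>R r *\<^sub>R b))) \<le> N * (max (A * T) 2 * r)"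
          using N by (rule mult_left_mono)
        then show ?thesis
          using mild_solution_one_minus_cos[OF mild k lam t(1) K u0i, of "r *\<^sub>R b"] True
          by (simp add: P_def P0_def D_def N_def mult_ac min_def)
      next
        case False
        have "P r \<le> (\<integral>x. 2 * \<bar>u t x\<bar> \<partial>lborel)"
          unfolding P_def
        proof (rule Bochner_Integration.integral_mono)
          show "integrable lborel (\<lambda>x. (1 - cos (x \<bullet> (r *\<^sub>R (exp t *\<^sub>R b)))) * \<bar>u t x\<bar>)"
            by (rule integral_one_minus_cos(2)[OF integrable_abs[OF ui]])
          fix x show "(1 - cos (x \<bullet> (r *\<^sub>R (exp t *\<^sub>R b)))) * \<bar>u t x\<bar> \<le> 2 * \<bar>u t x\<bar>"
            using cos_ge_minus_one[of "x \<bullet> (r *\<^sub>R (exp t *\<^sub>R b))"] by (intro mult_right_mono) auto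
        qed (use ui in auto)
        also have "\<dots> \<le> N * 2" using mass by simp
        also have "\<dots> \<le> D * min 1 r" unfolding D_def using N False by (auto intro: mult_left_mono)
        finally show ?thesis using P0[of r] by simp
      qed
      \<comment> \<open>The cosine bound concerns the expanded point e^t x; since t \<ge> 0 its
        coordinates dominate those of x.\<close>
      have "ennreal c * (\<integral>\<^sup>+x. ennreal (\<bar>x \<bullet> b\<bar> powr m * \<bar>u t x\<bar>) \<partial>lborel) \<le>
        ennreal c * (\<integral>\<^sup>+x. ennreal (\<bar>x \<bullet> (exp t *\<^sub>R b)\<bar> powr m * \<bar>u t x\<bar>) \<partial>lborel)"
      proof (intro mult_left_mono nn_integral_mono ennreal_leI mult_right_mono powr_mono2)
        fix x
        have "1 * \<bar>x \<bullet> b\<bar> \<le> exp t * \<bar>x \<bullet> b\<bar>" using t by (intro mult_right_mono) auto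
        then show "\<bar>x \<bullet> b\<bar> \<le> \<bar>x \<bullet> (exp t *\<^sub>R b)\<bar>" by (simp add: abs_mult)
      qed (use m in auto)
      also have "\<dots> = (\<integral>\<^sup>+r. ennreal (indicator {0<..} r * r powr (- 1 - m)) * ennreal (P r) \<partial>lborel)"
        unfolding c(1)[symmetric] P_def by (rule fractional_moment_eq[OF m(1) ui])
      also have "\<dots> \<le> (\<integral>\<^sup>+r. ennreal (indicator {0<..} r * r powr (- 1 - m)) * ennreal (P0 r)
          + ennreal D * ennreal (indicator {0<..} r * (min 1 r * r powr (- 1 - m))) \<partial>lborel)"
      proof (rule nn_integral_mono)
        fix r :: real
        show "ennreal (indicator {0<..} r * r powr (- 1 - m)) * ennreal (P r) \<le>
            ennreal (indicator {0<..} r * r powr (- 1 - m)) * ennreal (P0 r)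
          + ennreal D * ennreal (indicator {0<..} r * (min 1 r * r powr (- 1 - m)))"
        proof (cases "0 < r")
          case True
          have "ennreal (r powr (- 1 - m)) * ennreal (P r) \<le> ennreal (r powr (- 1 - m)) * ennreal (P0 r + D * min 1 r)"
            using P[OF True] by (intro mult_left_mono ennreal_leI) auto
          also have "\<dots> = ennreal (r powr (- 1 - m) * P0 r + D * (min 1 r * r powr (- 1 - m)))"
            using P0 D True by (subst ennreal_mult[symmetric]) (auto simp: algebra_simps)
          also have "\<dots> = ennreal (r powr (- 1 - m)) * ennreal (P0 r) + ennreal D * ennreal (min 1 r * r powr (- 1 - m))"
            using P0 D True by (subst ennreal_plus) (auto simp: ennreal_mult)
          finally show ?thesis using True by simp
        qed simp
      qed
      also have "\<dots> = ennreal c * ennreal (M b) + ennreal D * ennreal E"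
      proof -
        have [measurable]: "P0 \<in> borel_measurable borel" unfolding P0_def by measurable
        show ?thesis
          unfolding E(1)[symmetric] M(1)[OF b, symmetric] c(1)[symmetric]
          by (subst nn_integral_add) (auto simp: nn_integral_cmult fractional_moment_eq[OF m(1) u0i] P0_def)
      qed
      also have "\<dots> = ennreal c * ennreal (M b + D * E / c)"
        using c(2) D E(2) M(2)[OF b] by (simp add: field_simps flip: ennreal_mult ennreal_plus)
      finally show ?thesis
        using c(2) by (subst (asm) ennreal_mult_le_mult_iff) auto
    qed
    have "(\<integral>\<^sup>+x. ennreal (jbr x powr m * \<bar>u t x\<bar>) \<partial>lborel) \<le>
        (\<integral>\<^sup>+x. ennreal \<bar>u t x\<bar> + (\<Sum>b\<in>Basis. ennreal (\<bar>x \<bullet> b\<bar> powr m * \<bar>u t x\<bar>)) \<partial>lborel)"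
    proof (rule nn_integral_mono)
      fix x
      have "jbr x powr m * \<bar>u t x\<bar> \<le> (1 + (\<Sum>b\<in>Basis. \<bar>x \<bullet> b\<bar> powr m)) * \<bar>u t x\<bar>"
        using m by (intro mult_right_mono jbr_powr_le) auto
      then have "ennreal (jbr x powr m * \<bar>u t x\<bar>) \<le> ennreal (\<bar>u t x\<bar> + (\<Sum>b\<in>Basis. \<bar>x \<bullet> b\<bar> powr m * \<bar>u t x\<bar>))"
        by (intro ennreal_leI) (simp add: distrib_right sum_distrib_right)
      also have "\<dots> = ennreal \<bar>u t x\<bar> + (\<Sum>b\<in>Basis. ennreal (\<bar>x \<bullet> b\<bar> powr m * \<bar>u t x\<bar>))"
        by (subst ennreal_plus) (auto intro!: sum_nonneg)
      finally show "ennreal (jbr x powr m * \<bar>u t x\<bar>) \<le> ennreal \<bar>u t x\<bar> + (\<Sum>b\<in>Basis. ennreal (\<bar>x \<bullet> b\<bar> powr m * \<bar>u t x\<bar>))" .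
    qed
    also have "\<dots> = (\<integral>\<^sup>+x. ennreal \<bar>u t x\<bar> \<partial>lborel) + (\<Sum>b\<in>Basis. \<integral>\<^sup>+x. ennreal (\<bar>x \<bullet> b\<bar> powr m * \<bar>u t x\<bar>) \<partial>lborel)"
      by (subst nn_integral_add) (auto simp: nn_integral_sum simp del: sum_ennreal)
    also have "\<dots> \<le> ennreal N + (\<Sum>b\<in>Basis. ennreal (M (b::'a) + D * E / c))"
    proof (intro add_mono sum_mono X)
      show "(\<integral>\<^sup>+x. ennreal \<bar>u t x\<bar> \<partial>lborel) \<le> ennreal N"
        using mass ui by (subst nn_integral_eq_integral) (auto intro!: ennreal_leI)
    qed
    also have "\<dots> = ennreal C"
      unfolding C_def using N by (simp only: sum_ennreal nn ennreal_plus sum_nonneg)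
    finally have le: "(\<integral>\<^sup>+x. ennreal (jbr x powr m * \<bar>u t x\<bar>) \<partial>lborel) \<le> ennreal C" .
    have i: "integrable lborel (\<lambda>x. jbr x powr m * \<bar>u t x\<bar>)"
      by (rule integrableI_bounded) (use le in \<open>auto simp: less_top[symmetric] top_unique abs_mult\<close>)
    have C: "0 \<le> C"
      unfolding C_def by (intro add_nonneg_nonneg[OF N] sum_nonneg nn)
    have "ennreal (L1w_norm m (u t)) \<le> ennreal C"
      unfolding L1w_norm_def by (subst nn_integral_eq_integral[symmetric]) (use i le in auto)
    with C i show ?thesis by (simp add: L1w_def)
  qed
  then show ?thesis by blast
qed

section \<open>Gaussian regularisation and the L2 bound\<close>

lemma lborel_prod_Basis:
  fixes f :: "'a::euclidean_space \<Rightarrow> real \<Rightarrow> 'b::{real_normed_field, banach, second_countable_topology}"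
  assumes f: "\<And>b. b \<in> Basis \<Longrightarrow> integrable lborel (f b)"
  shows "(\<integral>x. (\<Prod>b\<in>Basis. f b (x \<bullet> b)) \<partial>lborel) = (\<Prod>b\<in>Basis. \<integral>x. f b x \<partial>lborel)"
    and "integrable lborel (\<lambda>x. \<Prod>b\<in>Basis. f b (x \<bullet> b))"
proof -
  interpret P: product_sigma_finite "\<lambda>_::'a. lborel :: real measure" by standard
  have [measurable]: "f b \<in> borel_measurable borel" if "b \<in> Basis" for b using f[OF that] by auto
  have m: "(\<lambda>g. \<Sum>b\<in>Basis. g b *\<^sub>R b) \<in> measurable (\<Pi>\<^sub>M b\<in>(Basis::'a set). lborel) borel"
    by measurable
  have eq: "(\<Prod>b\<in>Basis. f b ((\<Sum>c\<in>Basis. g c *\<^sub>R c) \<bullet> b)) = (\<Prod>b\<in>Basis. f b (g b))" for g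
    by (intro prod.cong refl) (simp add: inner_sum_left inner_Basis if_distrib sum.delta cong: if_cong)
  show "(\<integral>x. (\<Prod>b\<in>Basis. f b (x \<bullet> b)) \<partial>lborel) = (\<Prod>b\<in>Basis. \<integral>x. f b x \<partial>lborel)"
    by (subst lborel_eq, subst integral_distr[OF m])
       (auto simp: eq P.product_integral_prod[OF finite_Basis f])
  show "integrable lborel (\<lambda>x. \<Prod>b\<in>Basis. f b (x \<bullet> b))"
    by (subst lborel_eq, subst integrable_distr_eq[OF m])
       (auto simp: eq intro!: P.product_integrable_prod f)
qed

text \<open>Left unnormalised, with maximum value 1, because it serves as a cut-off in frequency and
  in space as well as a mollifier. Its mass is \<open>gauss_const\<close>.\<close>

definition gauss :: "'a::euclidean_space \<Rightarrow> real" where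
  "gauss x = exp (- (norm x)\<^sup>2 / 2)"

abbreviation gauss_const :: "'a::euclidean_space itself \<Rightarrow> real" where
  "gauss_const _ \<equiv> sqrt (2 * pi) ^ DIM('a)"

lemma gauss_prod: "gauss (x::'a::euclidean_space) = gauss_const TYPE('a) * (\<Prod>b\<in>Basis. std_normal_density (x \<bullet> b))"
proof -
  have "gauss x = exp (\<Sum>b\<in>Basis. - (x \<bullet> b)\<^sup>2 / 2)"
    by (simp add: gauss_def sum_negf sum_divide_distrib[symmetric] norm_eq_sqrt_inner euclidean_inner[of x x] power2_eq_square sum_nonneg)
  also have "\<dots> = (\<Prod>b\<in>Basis. sqrt (2 * pi) * std_normal_density (x \<bullet> b))"
    by (simp add: exp_sum std_normal_density_def)
  finally show ?thesis by (simp add: prod.distrib)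
qed

lemma gauss_pos: "0 < gauss x" and gauss_le_1: "gauss x \<le> 1"
  by (auto simp: gauss_def)

lemma continuous_gauss [continuous_intros]:
  "continuous_on A f \<Longrightarrow> continuous_on A (\<lambda>x. gauss (f x))"
  unfolding gauss_def by (intro continuous_intros) auto

lemma gauss_measurable [measurable]: "(gauss :: 'a::euclidean_space \<Rightarrow> real) \<in> borel_measurable borel"
  by (intro borel_measurable_continuous_onI continuous_gauss continuous_on_id)

lemma integrable_gauss: "integrable lborel (gauss :: 'a::euclidean_space \<Rightarrow> real)"
  unfolding gauss_prod[abs_def] by (intro integrable_mult_right lborel_prod_Basis(2)) simp

lemma integral_gauss: "(\<integral>x. gauss x \<partial>(lborel :: 'a::euclidean_space measure)) = gauss_const TYPE('a)"
proof -
  have "(\<integral>x. (\<Prod>b\<in>Basis. std_normal_density (x \<bullet> b)) \<partial>(lborel :: 'a measure)) = 1"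
    by (subst lborel_prod_Basis(1)) auto
  then show ?thesis unfolding gauss_prod by simp
qed

text \<open>The integral factors over the coordinates, and each factor is the characteristic
  function of the standard normal law.\<close>

lemma fourier_gauss: "fourier (gauss :: 'a::euclidean_space \<Rightarrow> real) \<xi> = complex_of_real (gauss_const TYPE('a) * gauss \<xi>)"
proof -
  have 1: "integrable lborel (\<lambda>x. cis (- (x * s)) * complex_of_real (std_normal_density x))" for s
    using integrable_cis_mult[of std_normal_density s] by simp
  have 2: "(\<integral>x. cis (- (x * s)) * complex_of_real (std_normal_density x) \<partial>lborel) = complex_of_real (exp (- s\<^sup>2 / 2))" for s
  proof -
    have "char std_normal_distribution (- s) = (\<integral>x. std_normal_density x *\<^sub>R iexp (- s * x) \<partial>lborel)"
      unfolding char_def by (subst integral_density) auto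
    also have "\<dots> = (\<integral>x. cis (- (x * s)) * complex_of_real (std_normal_density x) \<partial>lborel)"
      by (intro Bochner_Integration.integral_cong) (auto simp: cis_conv_exp scaleR_conv_of_real mult_ac)
    finally show ?thesis by (simp add: char_std_normal_distribution)
  qed
  have "fourier (\<lambda>x. \<Prod>b\<in>Basis. std_normal_density (x \<bullet> b)) \<xi> =
    (\<integral>x. (\<Prod>b\<in>Basis. cis (- ((x \<bullet> b) * (\<xi> \<bullet> b))) * complex_of_real (std_normal_density (x \<bullet> b))) \<partial>(lborel :: 'a measure))"
    unfolding fourier_def
  proof (rule Bochner_Integration.integral_cong[OF refl])
    fix x :: 'a
    have "cis (- (x \<bullet> \<xi>)) = exp (\<Sum>b\<in>Basis. \<i> * complex_of_real (- ((x \<bullet> b) * (\<xi> \<bullet> b))))"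
      by (subst euclidean_inner) (simp add: cis_conv_exp sum_negf sum_distrib_left)
    also have "\<dots> = (\<Prod>b\<in>Basis. cis (- ((x \<bullet> b) * (\<xi> \<bullet> b))))"
      by (simp add: exp_sum cis_conv_exp)
    finally show "cis (- (x \<bullet> \<xi>)) * complex_of_real (\<Prod>b\<in>Basis. std_normal_density (x \<bullet> b)) =
      (\<Prod>b\<in>Basis. cis (- ((x \<bullet> b) * (\<xi> \<bullet> b))) * complex_of_real (std_normal_density (x \<bullet> b)))"
      by (simp add: prod.distrib)
  qed
  also have "\<dots> = (\<Prod>b\<in>Basis. complex_of_real (exp (- (\<xi> \<bullet> b)\<^sup>2 / 2)))"
    using lborel_prod_Basis(1)[of "\<lambda>b x. cis (- (x * (\<xi> \<bullet> b))) * complex_of_real (std_normal_density x)", OF 1]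
    by (simp add: 2)
  also have "\<dots> = complex_of_real (gauss \<xi>)"
    by (simp add: gauss_def exp_sum[symmetric] sum_negf sum_divide_distrib[symmetric] norm_eq_sqrt_inner
        euclidean_inner[of \<xi> \<xi>] power2_eq_square sum_nonneg flip: of_real_prod)
  finally have "fourier (\<lambda>x. \<Prod>b\<in>Basis. std_normal_density (x \<bullet> b)) \<xi> = complex_of_real (gauss \<xi>)" .
  moreover have "(gauss :: 'a \<Rightarrow> real) = (\<lambda>x. gauss_const TYPE('a) * (\<Prod>b\<in>Basis. std_normal_density (x \<bullet> b)))"
    by (rule ext) (rule gauss_prod)
  then have "fourier (gauss :: 'a \<Rightarrow> real) \<xi> = fourier (\<lambda>x. gauss_const TYPE('a) * (\<Prod>b\<in>Basis. std_normal_density (x \<bullet> b))) \<xi>"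
    by (rule arg_cong)
  ultimately show ?thesis
    by (simp only: fourier_cmult of_real_mult)
qed

lemma integrable_pair_mult:
  fixes f g :: "'a::euclidean_space \<Rightarrow> real"
  assumes f: "integrable lborel f" and g: "integrable lborel g"
  shows "integrable (lborel \<Otimes>\<^sub>M lborel) (\<lambda>(x, y). f x * g y)"
proof (rule lborel_pair.Fubini_integrable)
  have [measurable]: "f \<in> borel_measurable borel" "g \<in> borel_measurable borel" using f g by auto
  show "(\<lambda>(x, y). f x * g y) \<in> borel_measurable (lborel \<Otimes>\<^sub>M lborel)" by measurable
qed (use f g in \<open>auto simp: abs_mult\<close>)

lemma cis_inner_measurable_pair [measurable]:
  fixes f g :: "'c \<Rightarrow> 'a::euclidean_space"
  assumes [measurable]: "f \<in> borel_measurable M" "g \<in> borel_measurable M"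
  shows "(\<lambda>x. cis (- (f x \<bullet> g x))) \<in> borel_measurable M"
  unfolding cis_conv_exp by measurable

text \<open>Multiplication formula with a cut-off in frequency; it replaces Fourier inversion.\<close>

lemma fourier_bilinear:
  fixes f g w :: "'a::euclidean_space \<Rightarrow> real" and R :: "'a \<Rightarrow> real"
  assumes f: "integrable lborel f" and g: "integrable lborel g" and w: "integrable lborel w"
    and R: "\<And>x. fourier w x = complex_of_real (R x)" and w0: "\<And>\<xi>. 0 \<le> w \<xi>"
  shows "(\<integral>\<xi>. fourier f \<xi> * (cnj (fourier g \<xi>) * complex_of_real (w \<xi>)) \<partial>lborel) =
    complex_of_real (\<integral>x. f x * conv R g x \<partial>lborel)"
proof -
  have [measurable]: "f \<in> borel_measurable borel" "g \<in> borel_measurable borel" "w \<in> borel_measurable borel"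
    "fourier g \<in> borel_measurable borel"
    using f g w by (auto intro: fourier_measurable)
  have [measurable]: "cnj \<in> borel_measurable borel"
    by (intro borel_measurable_continuous_onI continuous_intros)
  define N where "N = (\<integral>x. \<bar>g x\<bar> \<partial>lborel)"
  define p where "p = (\<lambda>\<xi>. cnj (fourier g \<xi>) * complex_of_real (w \<xi>))"
  have [measurable]: "p \<in> borel_measurable borel" unfolding p_def by measurable
  have p: "cmod (p \<xi>) \<le> N * w \<xi>" for \<xi>
    unfolding p_def N_def using norm_fourier_le[of g \<xi>] w0[of \<xi>] by (auto simp: norm_mult intro!: mult_right_mono)
  have I1: "integrable (lborel \<Otimes>\<^sub>M lborel) (\<lambda>(x, \<xi>). cis (- (x \<bullet> \<xi>)) * complex_of_real (f x) * p \<xi>)"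
  proof (rule Bochner_Integration.integrable_bound[OF integrable_pair_mult[OF f integrable_mult_right[OF w]]])
    show "AE q in lborel \<Otimes>\<^sub>M lborel. norm (case q of (x, \<xi>) \<Rightarrow> cis (- (x \<bullet> \<xi>)) * complex_of_real (f x) * p \<xi>)
      \<le> norm (case q of (x, \<xi>) \<Rightarrow> f x * (N * w \<xi>))"
      using p by (auto simp: norm_mult abs_mult[of "f _"] intro!: mult_left_mono order_trans[OF p abs_ge_self] AE_I2)
  qed measurable
  have I2: "integrable (lborel \<Otimes>\<^sub>M lborel) (\<lambda>(y, \<xi>). cis (- ((x - y) \<bullet> \<xi>)) * complex_of_real (g y * w \<xi>))" for x
  proof (rule Bochner_Integration.integrable_bound[OF integrable_pair_mult[OF g w]])
    show "AE q in lborel \<Otimes>\<^sub>M lborel. norm (case q of (y, \<xi>) \<Rightarrow> cis (- ((x - y) \<bullet> \<xi>)) * complex_of_real (g y * w \<xi>))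
      \<le> norm (case q of (y, \<xi>) \<Rightarrow> g y * w \<xi>)"
      by (auto simp: norm_mult abs_mult)
  qed measurable
  \<comment> \<open>Exchanging the integrals over y and \<xi> exhibits the transform of
    \<open>w\<close> at x - y, which is \<open>R\<close>. A second exchange, over x and \<xi>, gives
    the claim.\<close>
  have inner: "(\<integral>\<xi>. cis (- (x \<bullet> \<xi>)) * p \<xi> \<partial>lborel) = complex_of_real (conv R g x)" for x
  proof -
    have "(\<integral>\<xi>. cis (- (x \<bullet> \<xi>)) * p \<xi> \<partial>lborel) =
       (\<integral>\<xi>. (\<integral>y. cis (- ((x - y) \<bullet> \<xi>)) * complex_of_real (g y * w \<xi>) \<partial>lborel) \<partial>lborel)"
    proof (rule Bochner_Integration.integral_cong[OF refl])
      fix \<xi> :: 'a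
      have c: "cis (- ((x - y) \<bullet> \<xi>)) * complex_of_real (g y * w \<xi>) =
          (cis (- (x \<bullet> \<xi>)) * complex_of_real (w \<xi>)) * cnj (cis (- (y \<bullet> \<xi>)) * complex_of_real (g y))" for y
      proof -
        have "cis (- ((x - y) \<bullet> \<xi>)) = cis (- (x \<bullet> \<xi>)) * cnj (cis (- (y \<bullet> \<xi>)))"
          by (simp add: cis_cnj cis_mult inner_diff_left)
        then show ?thesis by simp
      qed
      have "(\<integral>y. cis (- ((x - y) \<bullet> \<xi>)) * complex_of_real (g y * w \<xi>) \<partial>lborel) =
         (cis (- (x \<bullet> \<xi>)) * complex_of_real (w \<xi>)) * cnj (fourier g \<xi>)"
        unfolding c fourier_def integral_mult_right_zero by (rule arg_cong[OF Bochner_Integration.integral_cnj])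
      then show "cis (- (x \<bullet> \<xi>)) * p \<xi> = (\<integral>y. cis (- ((x - y) \<bullet> \<xi>)) * complex_of_real (g y * w \<xi>) \<partial>lborel)"
        by (simp add: p_def mult_ac)
    qed
    also have "\<dots> = (\<integral>y. (\<integral>\<xi>. cis (- ((x - y) \<bullet> \<xi>)) * complex_of_real (g y * w \<xi>) \<partial>lborel) \<partial>lborel)"
      using lborel_pair.Fubini_integral[of "\<lambda>y \<xi>. cis (- ((x - y) \<bullet> \<xi>)) * complex_of_real (g y * w \<xi>)"] I2[of x] by simp
    also have "\<dots> = (\<integral>y. complex_of_real (R (x - y) * g y) \<partial>lborel)"
    proof (rule Bochner_Integration.integral_cong[OF refl])
      fix y
      have "(\<integral>\<xi>. cis (- ((x - y) \<bullet> \<xi>)) * complex_of_real (g y * w \<xi>) \<partial>lborel) =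
         (\<integral>\<xi>. complex_of_real (g y) * (cis (- (\<xi> \<bullet> (x - y))) * complex_of_real (w \<xi>)) \<partial>lborel)"
        by (intro Bochner_Integration.integral_cong) (auto simp: inner_commute mult_ac)
      also have "\<dots> = complex_of_real (g y) * fourier w (x - y)"
        unfolding fourier_def by (rule integral_mult_right_zero)
      finally show "(\<integral>\<xi>. cis (- ((x - y) \<bullet> \<xi>)) * complex_of_real (g y * w \<xi>) \<partial>lborel) = complex_of_real (R (x - y) * g y)"
        by (simp add: R)
    qed
    finally show ?thesis by (simp add: conv_def del: of_real_mult)
  qed
  have "(\<integral>\<xi>. fourier f \<xi> * p \<xi> \<partial>lborel) = (\<integral>\<xi>. (\<integral>x. cis (- (x \<bullet> \<xi>)) * complex_of_real (f x) * p \<xi> \<partial>lborel) \<partial>lborel)"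
    by (simp add: fourier_def)
  also have "\<dots> = (\<integral>x. (\<integral>\<xi>. cis (- (x \<bullet> \<xi>)) * complex_of_real (f x) * p \<xi> \<partial>lborel) \<partial>lborel)"
    using lborel_pair.Fubini_integral[of "\<lambda>x \<xi>. cis (- (x \<bullet> \<xi>)) * complex_of_real (f x) * p \<xi>"] I1 by simp
  also have "\<dots> = (\<integral>x. complex_of_real (f x * conv R g x) \<partial>lborel)"
  proof (rule Bochner_Integration.integral_cong[OF refl])
    fix x
    have "(\<integral>\<xi>. cis (- (x \<bullet> \<xi>)) * complex_of_real (f x) * p \<xi> \<partial>lborel) = (\<integral>\<xi>. complex_of_real (f x) * (cis (- (x \<bullet> \<xi>)) * p \<xi>) \<partial>lborel)"
      by (simp add: mult_ac)
    also have "\<dots> = complex_of_real (f x) * (\<integral>\<xi>. cis (- (x \<bullet> \<xi>)) * p \<xi> \<partial>lborel)"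
      by (rule integral_mult_right_zero)
    finally show "(\<integral>\<xi>. cis (- (x \<bullet> \<xi>)) * complex_of_real (f x) * p \<xi> \<partial>lborel) = complex_of_real (f x * conv R g x)"
      by (simp add: inner)
  qed
  finally show ?thesis by (simp add: p_def del: of_real_mult)
qed

text \<open>2 g(x) g(y) \<le> g(x)^2 + g(y)^2, integrated against the nonnegative R(x - y): both
  terms give the mass of \<open>R\<close> times the squared L2 norm. The bound \<open>b\<close>
  serves only for integrability.\<close>

lemma quadratic_conv_le:
  fixes g R :: "'a::euclidean_space \<Rightarrow> real"
  assumes g: "integrable lborel g" and g2: "integrable lborel (\<lambda>x. (g x)\<^sup>2)" and gb: "\<And>x. \<bar>g x\<bar> \<le> b"
    and R: "integrable lborel R" "\<And>x. 0 \<le> R x"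
  shows "(\<integral>x. g x * conv R g x \<partial>lborel) \<le> (\<integral>x. R x \<partial>lborel) * (\<integral>x. (g x)\<^sup>2 \<partial>lborel)"
proof -
  have [measurable]: "g \<in> borel_measurable borel" "conv R g \<in> borel_measurable borel"
    using g integrable_conv[OF R(1) g] by auto
  have pw: "AE x in lborel. g x * conv R g x \<le> ((g x)\<^sup>2 * (\<integral>x. R x \<partial>lborel) + conv R (\<lambda>x. (g x)\<^sup>2) x) / 2"
    using AE_conv_integrable[OF R(1) g2] AE_conv_integrable[OF R(1) g]
  proof eventually_elim
    case (elim x)
    have Rx: "integrable lborel (\<lambda>y. R (x - y))"
      using lborel_integrable_affine[OF R(1), of "-1" x] by simp
    have "g x * conv R g x = (\<integral>y. g x * (R (x - y) * g y) \<partial>lborel)"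
      unfolding conv_def by simp
    also have "\<dots> \<le> (\<integral>y. ((g x)\<^sup>2 * R (x - y) + R (x - y) * (g y)\<^sup>2) / 2 \<partial>lborel)"
    proof (rule Bochner_Integration.integral_mono)
      fix y
      have "0 \<le> R (x - y) * (g x - g y)\<^sup>2" using R(2) by simp
      then show "g x * (R (x - y) * g y) \<le> ((g x)\<^sup>2 * R (x - y) + R (x - y) * (g y)\<^sup>2) / 2"
        by (simp add: power2_eq_square algebra_simps)
    qed (use elim Rx in auto)
    also have "\<dots> = ((g x)\<^sup>2 * (\<integral>x. R x \<partial>lborel) + conv R (\<lambda>x. (g x)\<^sup>2) x) / 2"
      unfolding conv_def using elim Rx by (simp add: lborel_integral_diff_reflect)
    finally show ?case .
  qed
  have "(\<integral>x. g x * conv R g x \<partial>lborel) \<le> (\<integral>x. ((g x)\<^sup>2 * (\<integral>x. R x \<partial>lborel) + conv R (\<lambda>x. (g x)\<^sup>2) x) / 2 \<partial>lborel)"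
  proof (rule integral_mono_AE[OF _ _ pw])
    show "integrable lborel (\<lambda>x. g x * conv R g x)"
      by (rule Bochner_Integration.integrable_bound[OF integrable_mult_right[OF integrable_conv[OF R(1) g], of b]])
         (use gb in \<open>auto simp: abs_mult intro!: mult_right_mono order_trans[OF gb] AE_I2\<close>)
  qed (use g2 integrable_conv[OF R(1) g2] in auto)
  also have "\<dots> = (\<integral>x. R x \<partial>lborel) * (\<integral>x. (g x)\<^sup>2 \<partial>lborel)"
    using g2 integrable_conv[OF R(1) g2] by (simp add: integral_conv[OF R(1) g2])
  finally show ?thesis .
qed

lemma gauss_scaled:
  fixes e :: real
  assumes e: "0 < e"
  shows "integrable lborel (\<lambda>x::'a::euclidean_space. gauss (e *\<^sub>R x))"
    and "(\<integral>x. gauss (e *\<^sub>R x) \<partial>(lborel :: 'a measure)) = inverse e ^ DIM('a) * gauss_const TYPE('a)"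
    and "fourier (\<lambda>x::'a. gauss (e *\<^sub>R x)) \<xi> = complex_of_real (gauss_const TYPE('a) * rescale e gauss \<xi>)"
proof -
  have eq: "(\<lambda>x::'a. gauss (e *\<^sub>R x)) = (\<lambda>x. inverse e ^ DIM('a) * rescale (inverse e) gauss x)"
    using e by (auto simp: rescale_eq power_inverse)
  show "integrable lborel (\<lambda>x::'a::euclidean_space. gauss (e *\<^sub>R x))"
    unfolding eq using e by (intro integrable_mult_right integrable_rescale integrable_gauss) auto
  show "(\<integral>x. gauss (e *\<^sub>R x) \<partial>(lborel :: 'a measure)) = inverse e ^ DIM('a) * gauss_const TYPE('a)"
    unfolding eq using e by (simp add: integral_rescale integral_gauss)
  show "fourier (\<lambda>x::'a. gauss (e *\<^sub>R x)) \<xi> = complex_of_real (gauss_const TYPE('a) * rescale e gauss \<xi>)"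
    unfolding eq fourier_cmult fourier_rescale[OF positive_imp_inverse_positive[OF e]] fourier_gauss
    using e by (simp add: rescale_eq power_inverse)
qed

lemma conv_rescale_gauss:
  fixes g :: "'a::euclidean_space \<Rightarrow> real"
  assumes e: "0 < e"
  shows "conv (rescale e gauss) g x = (\<integral>z. gauss z * g (x - e *\<^sub>R z) \<partial>lborel)"
proof -
  have "(\<integral>y. rescale e gauss (x - y) * g y \<partial>lborel) =
     (\<bar>- e\<bar> ^ DIM('a)) *\<^sub>R (\<integral>z. rescale e gauss (x - (x + (- e) *\<^sub>R z)) * g (x + (- e) *\<^sub>R z) \<partial>lborel)"
    by (rule lborel_integral_affine) (use e in auto)
  also have "\<dots> = (\<integral>z. gauss z * g (x - e *\<^sub>R z) \<partial>lborel)"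
    unfolding integral_scaleR_right[symmetric] using e
    by (intro Bochner_Integration.integral_cong) (auto simp: rescale_eq)
  finally show ?thesis by (simp add: conv_def)
qed

text \<open>A one-sided form of Plancherel and Cauchy-Schwarz, the product of norms being replaced
  by a weighted sum with free parameter \<alpha>. It is proved with a Gaussian cut-off in frequency,
  that is, with \<open>g\<close> mollified, and the cut-off is then removed. The powers of 2 \<pi>
  are not kept sharp: they are discarded using \<open>1 \<le> c\<close>.\<close>

lemma fourier_L2_pairing:
  fixes f g :: "'a::euclidean_space \<Rightarrow> real"
  assumes f: "integrable lborel f" and F: "integrable lborel (\<lambda>\<xi>. (cmod (fourier f \<xi>))\<^sup>2)"
    and g: "integrable lborel g" and g2: "integrable lborel (\<lambda>x. (g x)\<^sup>2)"
    and gb: "\<And>x. \<bar>g x\<bar> \<le> b" and gc: "continuous_on UNIV g" and \<alpha>: "0 < \<alpha>"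
  shows "(\<integral>x. f x * g x \<partial>lborel) \<le>
    \<alpha> * (\<integral>\<xi>. (cmod (fourier f \<xi>))\<^sup>2 \<partial>lborel) + (\<integral>x. (g x)\<^sup>2 \<partial>lborel) / \<alpha>"
proof -
  define c where "c = gauss_const TYPE('a)"
  have "1 \<le> sqrt (2 * pi)" using pi_gt3 by (simp add: real_le_rsqrt)
  then have c: "1 \<le> c" by (simp add: c_def)
  have [measurable]: "f \<in> borel_measurable borel" "g \<in> borel_measurable borel" using f g by auto
  have b: "0 \<le> b" using gb[of 0] by linarith
  define I where "I = (\<lambda>e. \<integral>x. f x * conv (rescale e gauss) g x \<partial>lborel)"
  define F2 where "F2 = (\<integral>\<xi>. (cmod (fourier f \<xi>))\<^sup>2 \<partial>lborel)"
  define G2 where "G2 = (\<integral>x. (g x)\<^sup>2 \<partial>lborel)"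
  have bound: "I e \<le> \<alpha> * F2 + c / \<alpha> * G2" if e: "0 < e" for e
  proof -
    define w where "w = (\<lambda>x::'a. gauss (e *\<^sub>R x))"
    define R where "R = (\<lambda>x::'a. c * rescale e gauss x)"
    have w: "integrable lborel w" "\<And>\<xi>. 0 \<le> w \<xi>" "\<And>\<xi>. w \<xi> \<le> 1" "\<And>\<xi>. fourier w \<xi> = complex_of_real (R \<xi>)"
      using e gauss_pos[THEN less_imp_le] gauss_le_1 by (auto simp: w_def R_def c_def gauss_scaled)
    have R: "integrable lborel R"
      unfolding R_def using e by (intro integrable_mult_right integrable_rescale integrable_gauss)
    have R0: "0 \<le> R x" for x
      unfolding R_def rescale_eq[OF e] using e c gauss_pos[of "inverse e *\<^sub>R x"] by simp
    have R1: "(\<integral>x. R x \<partial>lborel) = c * c"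
      unfolding R_def integral_mult_right_zero integral_rescale[OF e] integral_gauss c_def ..
    have convR: "conv R h x = c * conv (rescale e gauss) h x" for h x
      unfolding conv_def R_def integral_mult_right_zero[symmetric] by (simp add: mult_ac)
    have m [measurable]: "fourier f \<in> borel_measurable borel" "fourier g \<in> borel_measurable borel"
      "w \<in> borel_measurable borel"
      using w(1) by (auto intro: fourier_measurable f g)
    define N where "N = (\<integral>x. \<bar>g x\<bar> \<partial>lborel)"
    have gN: "cmod (fourier g \<xi>) \<le> N" for \<xi> unfolding N_def by (rule norm_fourier_le)
    have iG: "integrable lborel (\<lambda>\<xi>. (cmod (fourier g \<xi>))\<^sup>2 * w \<xi>)"
      by (rule Bochner_Integration.integrable_bound[OF integrable_mult_right[OF w(1), of "N\<^sup>2"]])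
         (use gN w(2) in \<open>auto intro!: AE_I2 mult_right_mono power_mono simp: abs_mult\<close>)
    have "complex_of_real (\<integral>\<xi>. (cmod (fourier g \<xi>))\<^sup>2 * w \<xi> \<partial>lborel) = complex_of_real (\<integral>x. g x * conv R g x \<partial>lborel)"
      unfolding fourier_bilinear[OF g g w(1,4,2), symmetric]
      by (subst integral_complex_of_real[symmetric], intro Bochner_Integration.integral_cong)
         (auto simp: complex_norm_square simp del: of_real_power simp flip: mult.assoc)
    then have G: "(\<integral>\<xi>. (cmod (fourier g \<xi>))\<^sup>2 * w \<xi> \<partial>lborel) \<le> c * c * G2"
      using quadratic_conv_le[OF g g2 gb R R0] by (simp add: R1 G2_def del: of_real_mult)
    have "c * I e = Re (complex_of_real (\<integral>x. f x * conv R g x \<partial>lborel))"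
      unfolding I_def convR integral_mult_right_zero[symmetric] by (simp add: mult_ac)
    also have "\<dots> \<le> cmod (\<integral>\<xi>. fourier f \<xi> * (cnj (fourier g \<xi>) * complex_of_real (w \<xi>)) \<partial>lborel)"
      unfolding fourier_bilinear[OF f g w(1,4,2), symmetric] by (rule complex_Re_le_cmod)
    also have "\<dots> \<le> (\<integral>\<xi>. cmod (fourier f \<xi> * (cnj (fourier g \<xi>) * complex_of_real (w \<xi>))) \<partial>lborel)"
      by (rule integral_norm_bound)
    \<comment> \<open>Young's inequality with parameter c \<alpha>. The g-term will contribute c c
      \<open>G2\<close>, as \<open>R\<close> has mass c c, so a common factor \<open>c\<close> comes
      out of both terms.\<close>
    also have "\<dots> \<le> (\<integral>\<xi>. c * \<alpha> * (cmod (fourier f \<xi>))\<^sup>2 + (cmod (fourier g \<xi>))\<^sup>2 * w \<xi> / (c * \<alpha>) \<partial>lborel)"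
    proof (rule integral_mono_AE')
      show "integrable lborel (\<lambda>\<xi>. c * \<alpha> * (cmod (fourier f \<xi>))\<^sup>2 + (cmod (fourier g \<xi>))\<^sup>2 * w \<xi> / (c * \<alpha>))"
        using F iG by auto
      show "AE \<xi> in lborel. cmod (fourier f \<xi> * (cnj (fourier g \<xi>) * complex_of_real (w \<xi>)))
          \<le> c * \<alpha> * (cmod (fourier f \<xi>))\<^sup>2 + (cmod (fourier g \<xi>))\<^sup>2 * w \<xi> / (c * \<alpha>)"
      proof (rule AE_I2)
        fix \<xi>
        define x where "x = cmod (fourier f \<xi>)"
        define y where "y = cmod (fourier g \<xi>)"
        define s where "s = c * \<alpha>"
        have s: "0 < s" using c \<alpha> by (simp add: s_def)
        have xy: "0 \<le> x" "0 \<le> y" by (auto simp: x_def y_def)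
        have "0 \<le> (s * x - y)\<^sup>2" by simp
        then have "2 * (s * x * y) \<le> s\<^sup>2 * x\<^sup>2 + y\<^sup>2" by (simp add: power2_eq_square algebra_simps)
        moreover have "0 \<le> s * x * y" using s xy by simp
        ultimately have "s * (x * y) \<le> s * (s * x\<^sup>2 + y\<^sup>2 / s)"
          using s by (simp add: power2_eq_square algebra_simps)
        then have "x * y \<le> s * x\<^sup>2 + y\<^sup>2 / s" using s by simp
        then have "x * y * w \<xi> \<le> (s * x\<^sup>2 + y\<^sup>2 / s) * w \<xi>" using w(2) by (rule mult_right_mono)
        also have "\<dots> = s * x\<^sup>2 * w \<xi> + y\<^sup>2 * w \<xi> / s" by (simp add: distrib_right)
        also have "s * x\<^sup>2 * w \<xi> \<le> s * x\<^sup>2 * 1" using s w(3) by (intro mult_left_mono) auto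
        finally show "cmod (fourier f \<xi> * (cnj (fourier g \<xi>) * complex_of_real (w \<xi>)))
          \<le> c * \<alpha> * (cmod (fourier f \<xi>))\<^sup>2 + (cmod (fourier g \<xi>))\<^sup>2 * w \<xi> / (c * \<alpha>)"
          using w(2)[of \<xi>] by (simp add: norm_mult x_def y_def s_def mult_ac)
      qed
      show "AE \<xi> in lborel. 0 \<le> c * \<alpha> * (cmod (fourier f \<xi>))\<^sup>2 + (cmod (fourier g \<xi>))\<^sup>2 * w \<xi> / (c * \<alpha>)"
        using c \<alpha> w(2) by (intro AE_I2) auto
    qed
    also have "\<dots> = c * \<alpha> * F2 + (\<integral>\<xi>. (cmod (fourier g \<xi>))\<^sup>2 * w \<xi> \<partial>lborel) / (c * \<alpha>)"
      using F iG by (simp add: F2_def)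
    also have "\<dots> \<le> c * \<alpha> * F2 + c * c * G2 / (c * \<alpha>)"
      using G c \<alpha> by (intro add_left_mono divide_right_mono) auto
    also have "\<dots> = c * (\<alpha> * F2 + G2 / \<alpha>)"
      using c \<alpha> by (simp add: field_simps)
    finally have "I e \<le> \<alpha> * F2 + G2 / \<alpha>" using c by simp
    also have "G2 / \<alpha> \<le> c / \<alpha> * G2"
      using c \<alpha> mult_right_mono[OF c, of "G2 / \<alpha>"] by (simp add: G2_def)
    finally show ?thesis by simp
  qed
  \<comment> \<open>The mollifier has mass \<open>c\<close> instead of 1, so the limit carries a
    factor \<open>c\<close>, which is divided out at the end.\<close>
  have lim: "(\<lambda>n. I (inverse (real (Suc n)))) \<longlonglongrightarrow> (\<integral>x. f x * (c * g x) \<partial>lborel)"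
    unfolding I_def
  proof (rule integral_dominated_convergence[where w="\<lambda>x. \<bar>f x\<bar> * (c * b)"])
    show "integrable lborel (\<lambda>x. \<bar>f x\<bar> * (c * b))" using f by simp
    show "(\<lambda>x. f x * conv (rescale (inverse (real (Suc n))) gauss) g x) \<in> borel_measurable lborel" for n
      using integrable_conv[OF integrable_rescale[OF _ integrable_gauss] g, of "inverse (real (Suc n))"] by measurable
    have cb: "\<bar>conv (rescale e gauss) g x\<bar> \<le> c * b" if "0 < e" for e x
    proof -
      have "\<bar>conv (rescale e gauss) g x\<bar> \<le> (\<integral>z. gauss z * b \<partial>(lborel :: 'a measure))"
        unfolding conv_rescale_gauss[OF that]
      proof (rule integral_abs_bound_integral)
        show "integrable lborel (\<lambda>z. gauss z * g (x - e *\<^sub>R z))"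
          by (rule Bochner_Integration.integrable_bound[OF integrable_mult_left[OF integrable_gauss, of b]])
             (use gb in \<open>auto simp: abs_mult abs_of_pos[OF gauss_pos] less_imp_le[OF gauss_pos] intro!: AE_I2 mult_left_mono order_trans[OF gb abs_ge_self]\<close>)
        show "\<bar>gauss z * g (x - e *\<^sub>R z)\<bar> \<le> gauss z * b" for z
          using gb gauss_pos[of z] by (auto simp: abs_mult intro!: mult_left_mono)
      qed (simp add: integrable_gauss)
      then show ?thesis by (simp add: integral_gauss c_def)
    qed
    show "AE x in lborel. norm (f x * conv (rescale (inverse (real (Suc n))) gauss) g x) \<le> \<bar>f x\<bar> * (c * b)" for n
      using cb[of "inverse (real (Suc n))"] by (auto simp: abs_mult intro!: AE_I2 mult_left_mono)
    show "AE x in lborel. (\<lambda>n. f x * conv (rescale (inverse (real (Suc n))) gauss) g x) \<longlonglongrightarrow> f x * (c * g x)"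
    proof (intro AE_I2 tendsto_mult tendsto_const)
      fix x
      have "(\<lambda>n. \<integral>z. gauss z * g (x - inverse (real (Suc n)) *\<^sub>R z) \<partial>lborel) \<longlonglongrightarrow> (\<integral>z. gauss z * g x \<partial>(lborel :: 'a measure))"
      proof (rule integral_dominated_convergence[where w="\<lambda>z::'a. gauss z * b"])
        show "AE z in lborel. norm (gauss z * g (x - inverse (real (Suc n)) *\<^sub>R z)) \<le> gauss z * b" for n
          using gb by (auto simp: abs_mult abs_of_pos[OF gauss_pos] less_imp_le[OF gauss_pos] intro!: AE_I2 mult_left_mono)
        show "AE z in lborel. (\<lambda>n. gauss z * g (x - inverse (real (Suc n)) *\<^sub>R z)) \<longlonglongrightarrow> gauss z * g x"
        proof (intro AE_I2 tendsto_mult tendsto_const)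
          fix z
          have "(\<lambda>n. x - inverse (real (Suc n)) *\<^sub>R z) \<longlonglongrightarrow> x - 0 *\<^sub>R z"
            by (intro tendsto_intros LIMSEQ_inverse_real_of_nat)
          then have "(\<lambda>n. x - inverse (real (Suc n)) *\<^sub>R z) \<longlonglongrightarrow> x" by simp
          then show "(\<lambda>n. g (x - inverse (real (Suc n)) *\<^sub>R z)) \<longlonglongrightarrow> g x"
            using gc by (intro isCont_tendsto_compose[where g=g]) (auto simp: continuous_on_eq_continuous_at)
        qed
      qed (simp_all add: integrable_gauss)
      then show "(\<lambda>n. conv (rescale (inverse (real (Suc n))) gauss) g x) \<longlonglongrightarrow> c * g x"
        by (simp add: conv_rescale_gauss integral_gauss c_def)
    qed
  qed measurable
  have "(\<integral>x. f x * (c * g x) \<partial>lborel) \<le> \<alpha> * F2 + c / \<alpha> * G2"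
    by (rule LIMSEQ_le_const2[OF lim], intro exI allI impI bound) simp
  moreover have "\<dots> \<le> c * (\<alpha> * F2 + G2 / \<alpha>)"
    using c \<alpha> mult_right_mono[OF c, of "\<alpha> * F2"] by (simp add: F2_def algebra_simps)
  moreover have "(\<integral>x. f x * (c * g x) \<partial>lborel) = c * (\<integral>x. f x * g x \<partial>lborel)"
    unfolding integral_mult_right_zero[symmetric] by (simp add: mult_ac)
  ultimately have "c * (\<integral>x. f x * g x \<partial>lborel) \<le> c * (\<alpha> * F2 + G2 / \<alpha>)" by linarith
  then show ?thesis using c by (simp add: F2_def G2_def)
qed

text \<open>Needed for the sign of \<open>f\<close>: the pairing inequality admits only continuous
  test functions, whereas an L1 norm is a pairing with the discontinuous function sgn f.\<close>

lemma AE_limit_continuous: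
  fixes f :: "'a::euclidean_space \<Rightarrow> real"
  assumes f: "f \<in> borel_measurable borel"
  obtains h where "\<And>n::nat. continuous_on UNIV (h n)" "AE x in lborel. (\<lambda>n. h n x) \<longlonglongrightarrow> f x"
proof -
  have "f \<in> borel_measurable lebesgue"
    using measurable_completion[of f lborel borel] f by simp
  then have "f measurable_on UNIV"
    by (rule lebesgue_measurable_imp_measurable_on) simp
  then obtain N h where N: "negligible N" and h: "\<And>n. continuous_on UNIV (h n)"
    and lim: "\<And>x. x \<notin> N \<Longrightarrow> (\<lambda>n. h n x) \<longlonglongrightarrow> f x"
    unfolding measurable_on_def by auto
  have "AE x in lebesgue. x \<notin> N"
    using N by (intro AE_not_in) (simp add: negligible_iff_null_sets)
  then have "AE x in lborel. x \<notin> N" by (simp add: AE_completion_iff)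
  then have "AE x in lborel. (\<lambda>n. h n x) \<longlonglongrightarrow> f x"
    by (rule AE_mp) (use lim in auto)
  with h show thesis by (rule that)
qed

text \<open>The pairing inequality with test function \<phi> sgn f, reached as an almost everywhere
  limit of continuous functions dominated by \<phi>.\<close>

lemma fourier_L2_weighted:
  fixes f \<phi> :: "'a::euclidean_space \<Rightarrow> real"
  assumes f: "integrable lborel f" and F: "integrable lborel (\<lambda>\<xi>. (cmod (fourier f \<xi>))\<^sup>2)"
    and \<phi>: "integrable lborel \<phi>" "integrable lborel (\<lambda>x. (\<phi> x)\<^sup>2)"
    and \<phi>b: "\<And>x. 0 \<le> \<phi> x" "\<And>x. \<phi> x \<le> b" and \<phi>c: "continuous_on UNIV \<phi>" and \<alpha>: "0 < \<alpha>"
  shows "(\<integral>x. \<phi> x * \<bar>f x\<bar> \<partial>lborel) \<le>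
    \<alpha> * (\<integral>\<xi>. (cmod (fourier f \<xi>))\<^sup>2 \<partial>lborel) + (\<integral>x. (\<phi> x)\<^sup>2 \<partial>lborel) / \<alpha>"
proof -
  have [measurable]: "f \<in> borel_measurable borel" "\<phi> \<in> borel_measurable borel" using f \<phi> by auto
  have "(\<lambda>x. sgn (f x)) \<in> borel_measurable borel" by measurable
  then obtain h where h: "\<And>n::nat. continuous_on UNIV (h n)" "AE x in lborel. (\<lambda>n. h n x) \<longlonglongrightarrow> sgn (f x)"
    using AE_limit_continuous by blast
  \<comment> \<open>Clamping to [-1,1] preserves continuity and the limit, as sgn takes values
    there, and keeps the test functions below \<phi>.\<close>
  define k where "k = (\<lambda>n x. max (- 1) (min 1 (h n x)))"
  have kc: "continuous_on UNIV (k n)" for n unfolding k_def by (intro continuous_intros h)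
  have kb: "\<bar>k n x\<bar> \<le> 1" for n x by (auto simp: k_def)
  have km [measurable]: "k n \<in> borel_measurable borel" for n
    by (intro borel_measurable_continuous_onI kc)
  have kl: "AE x in lborel. (\<lambda>n. k n x) \<longlonglongrightarrow> sgn (f x)"
    using h(2)
  proof eventually_elim
    case (elim x)
    have "(\<lambda>n. k n x) \<longlonglongrightarrow> max (- 1) (min 1 (sgn (f x)))"
      unfolding k_def by (intro tendsto_max tendsto_min tendsto_const elim)
    moreover have "max (- 1) (min 1 (sgn (f x))) = sgn (f x)" by (auto simp: sgn_if)
    ultimately show ?case by simp
  qed
  have bound: "(\<integral>x. f x * (\<phi> x * k n x) \<partial>lborel) \<le>
    \<alpha> * (\<integral>\<xi>. (cmod (fourier f \<xi>))\<^sup>2 \<partial>lborel) + (\<integral>x. (\<phi> x)\<^sup>2 \<partial>lborel) / \<alpha>" for n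
  proof -
    have le: "\<bar>\<phi> x * k n x\<bar> \<le> \<phi> x" for x
      using mult_left_mono[OF kb[of n x] \<phi>b(1)[of x]] \<phi>b(1)[of x] by (simp add: abs_mult)
    have le2: "(\<phi> x * k n x)\<^sup>2 \<le> (\<phi> x)\<^sup>2" for x
      using le[of x] \<phi>b(1)[of x] by (simp add: abs_le_square_iff[symmetric])
    have i2: "integrable lborel (\<lambda>x. (\<phi> x * k n x)\<^sup>2)"
      by (rule Bochner_Integration.integrable_bound[OF \<phi>(2)]) (use le2 in auto)
    have "(\<integral>x. f x * (\<phi> x * k n x) \<partial>lborel) \<le>
      \<alpha> * (\<integral>\<xi>. (cmod (fourier f \<xi>))\<^sup>2 \<partial>lborel) + (\<integral>x. (\<phi> x * k n x)\<^sup>2 \<partial>lborel) / \<alpha>"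
    proof (rule fourier_L2_pairing[OF f F _ i2 _ _ \<alpha>])
      show "integrable lborel (\<lambda>x. \<phi> x * k n x)"
        by (rule Bochner_Integration.integrable_bound[OF \<phi>(1)]) (use le in \<open>auto intro: order_trans[OF _ abs_ge_self]\<close>)
      show "\<bar>\<phi> x * k n x\<bar> \<le> b" for x using le[of x] \<phi>b(2)[of x] by linarith
      show "continuous_on UNIV (\<lambda>x. \<phi> x * k n x)" by (intro continuous_intros \<phi>c kc)
    qed
    also have "(\<integral>x. (\<phi> x * k n x)\<^sup>2 \<partial>lborel) / \<alpha> \<le> (\<integral>x. (\<phi> x)\<^sup>2 \<partial>lborel) / \<alpha>"
      using \<alpha> by (intro divide_right_mono Bochner_Integration.integral_mono i2 \<phi>(2) le2) auto
    finally show ?thesis by simp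
  qed
  have "(\<lambda>n. \<integral>x. f x * (\<phi> x * k n x) \<partial>lborel) \<longlonglongrightarrow> (\<integral>x. f x * (\<phi> x * sgn (f x)) \<partial>lborel)"
  proof (rule integral_dominated_convergence[where w="\<lambda>x. \<bar>f x\<bar> * b"])
    show "AE x in lborel. (\<lambda>n. f x * (\<phi> x * k n x)) \<longlonglongrightarrow> f x * (\<phi> x * sgn (f x))"
      using kl by eventually_elim (intro tendsto_intros)
    show "AE x in lborel. norm (f x * (\<phi> x * k n x)) \<le> \<bar>f x\<bar> * b" for n
    proof (rule AE_I2)
      fix x
      have "\<bar>\<phi> x\<bar> * \<bar>k n x\<bar> \<le> b * 1" using kb \<phi>b[of x] by (intro mult_mono) auto
      then show "norm (f x * (\<phi> x * k n x)) \<le> \<bar>f x\<bar> * b" by (auto simp: abs_mult intro!: mult_left_mono)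
    qed
  qed (use f in auto)
  from LIMSEQ_le_const2[OF this] bound
  have "(\<integral>x. f x * (\<phi> x * sgn (f x)) \<partial>lborel) \<le>
    \<alpha> * (\<integral>\<xi>. (cmod (fourier f \<xi>))\<^sup>2 \<partial>lborel) + (\<integral>x. (\<phi> x)\<^sup>2 \<partial>lborel) / \<alpha>" by blast
  moreover have "f x * (\<phi> x * sgn (f x)) = \<phi> x * \<bar>f x\<bar>" for x
    by (simp add: abs_sgn mult_ac)
  ultimately show ?thesis by simp
qed

section \<open>Estimates on the symbols and conclusion\<close>

lemma prob_density_rescale:
  fixes J :: "'a::euclidean_space \<Rightarrow> real"
  assumes e: "0 < e" and J: "prob_density J"
  shows "prob_density (rescale e J)"
proof -
  have [measurable]: "J \<in> borel_measurable borel" using J by (auto simp: prob_density_def)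
  have "AE x in lborel. 0 \<le> J x" using J by (auto simp: prob_density_def)
  from AE_lborel_affine[OF _ this, of "inverse e" 0] have "AE x in lborel. 0 \<le> rescale e J x"
    using e by (auto simp: rescale_eq)
  with J e show ?thesis
    by (auto simp: prob_density_def integrable_rescale integral_rescale)
       (simp add: rescale_eq[OF e, abs_def])
qed

lemma norm_fourier_prob_density_le:
  assumes "prob_density J"
  shows "cmod (fourier J \<xi>) \<le> 1"
proof -
  have "(\<integral>x. \<bar>J x\<bar> \<partial>lborel) = (\<integral>x. J x \<partial>lborel)"
    using prob_densityD[OF assms] by (intro integral_cong_AE) auto
  then show ?thesis using norm_fourier_le[of J \<xi>] prob_densityD(3)[OF assms] by simp
qed

lemma L1w_mono:
  fixes f :: "'a::euclidean_space \<Rightarrow> real"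
  assumes "L1w M f" "m \<le> M"
  shows "L1w m f"
proof -
  have [measurable]: "f \<in> borel_measurable borel" and i: "integrable lborel (\<lambda>x. jbr x powr M * \<bar>f x\<bar>)"
    using assms by (auto simp: L1w_def)
  have "integrable lborel (\<lambda>x. jbr x powr m * \<bar>f x\<bar>)"
    by (rule Bochner_Integration.integrable_bound[OF i])
       (use assms jbr_ge_1 in \<open>auto simp: abs_mult intro!: AE_I2 mult_right_mono powr_mono\<close>)
  then show ?thesis by (simp add: L1w_def)
qed

lemma L1w_norm_diff_le:
  fixes f g :: "'a::euclidean_space \<Rightarrow> real"
  assumes "L1w k f" "L1w k g"
  shows "L1w_norm k (\<lambda>x. f x - g x) \<le> L1w_norm k f + L1w_norm k g"
proof -
  have i: "integrable lborel (\<lambda>x. jbr x powr k * \<bar>f x\<bar>)" "integrable lborel (\<lambda>x. jbr x powr k * \<bar>g x\<bar>)"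
    "integrable lborel (\<lambda>x. jbr x powr k * \<bar>f x - g x\<bar>)"
    using assms L1w_diff[OF assms] by (auto simp: L1w_def)
  have "L1w_norm k (\<lambda>x. f x - g x) \<le> (\<integral>x. jbr x powr k * \<bar>f x\<bar> + jbr x powr k * \<bar>g x\<bar> \<partial>lborel)"
    unfolding L1w_norm_def
    by (intro Bochner_Integration.integral_mono i Bochner_Integration.integrable_add)
       (auto simp flip: distrib_left intro!: mult_left_mono)
  then show ?thesis using i by (simp add: L1w_norm_def)
qed

text \<open>The frequency cut \<^term>\<open>jbr x < \<rho>\<close> is smoothed by a Gaussian so that the L2 part can be estimated
  by the Fourier transform; \<^term>\<open>\<rho>\<close> balances the two contributions.\<close>

lemma L1w_norm_interpolation:
  fixes f :: "'a::euclidean_space \<Rightarrow> real"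
  assumes k: "0 \<le> k" and km: "k < m" and f: "L1w m f" and A: "L1w_norm m f \<le> A"
    and F: "integrable lborel (\<lambda>\<xi>. (cmod (fourier f \<xi>))\<^sup>2)"
    and FX: "(\<integral>\<xi>. (cmod (fourier f \<xi>))\<^sup>2 \<partial>lborel) \<le> X\<^sup>2 * F0" and X: "0 < X"
  shows "L1w_norm k f \<le> (exp (1/2) * (F0 + gauss_const TYPE('a)) + A) * X powr ((m - k) / (m + DIM('a) / 2))"
proof -
  define d where "d = real DIM('a)"
  define c where "c = gauss_const TYPE('a)"
  define \<theta> where "\<theta> = (m - k) / (m + d / 2)"
  \<comment> \<open>The solution of \<rho>^(d/2) X = \<rho>^(-m); both contributions then equal
    X^\<theta> up to constants.\<close>
  define \<rho> where "\<rho> = X powr (- 1 / (m + d / 2))"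
  \<comment> \<open>Equalises the two terms of the L2 inequality: \<alpha> X^2 = \<rho>^d / \<alpha>
    = \<rho>^(d/2) X.\<close>
  define \<alpha> where "\<alpha> = \<rho> powr (d / 2) / X"
  have md: "0 < m + d / 2" using k km by (simp add: d_def add_pos_nonneg)
  have \<rho>: "0 < \<rho>" using X by (simp add: \<rho>_def)
  have \<alpha>: "0 < \<alpha>" using X \<rho> by (simp add: \<alpha>_def)
  have fi: "integrable lborel f" using L1w_integrable(1)[OF _ f] k km by simp
  have [measurable]: "f \<in> borel_measurable borel" using fi by auto
  define \<phi> where "\<phi> = (\<lambda>x::'a. gauss (inverse \<rho> *\<^sub>R x))"
  have \<phi>i: "integrable lborel \<phi>" and \<phi>1: "(\<integral>x. \<phi> x \<partial>lborel) = \<rho> ^ DIM('a) * c"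
    using gauss_scaled(1,2)[of "inverse \<rho>"] \<rho> by (auto simp: \<phi>_def c_def)
  have \<phi>b: "0 \<le> \<phi> x" "\<phi> x \<le> 1" for x
    using gauss_pos[of "inverse \<rho> *\<^sub>R x"] gauss_le_1[of "inverse \<rho> *\<^sub>R x"] by (auto simp: \<phi>_def)
  have \<phi>sq: "(\<phi> x)\<^sup>2 \<le> \<phi> x" for x
    using \<phi>b[of x] by (simp add: power2_eq_square mult_left_le)
  have [measurable]: "\<phi> \<in> borel_measurable borel" using \<phi>i by auto
  have \<phi>2i: "integrable lborel (\<lambda>x. (\<phi> x)\<^sup>2)"
    by (rule Bochner_Integration.integrable_bound[OF \<phi>i]) (use \<phi>sq \<phi>b in auto)
  have \<phi>2: "(\<integral>x. (\<phi> x)\<^sup>2 \<partial>lborel) \<le> \<rho> ^ DIM('a) * c"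
    unfolding \<phi>1[symmetric] by (intro Bochner_Integration.integral_mono \<phi>2i \<phi>i \<phi>sq)
  have \<phi>fi: "integrable lborel (\<lambda>x. \<phi> x * \<bar>f x\<bar>)"
    by (rule Bochner_Integration.integrable_bound[OF fi]) (use \<phi>b in \<open>auto simp: abs_mult mult_left_le_one_le\<close>)
  have "(\<integral>x. \<phi> x * \<bar>f x\<bar> \<partial>lborel) \<le>
    \<alpha> * (\<integral>\<xi>. (cmod (fourier f \<xi>))\<^sup>2 \<partial>lborel) + (\<integral>x. (\<phi> x)\<^sup>2 \<partial>lborel) / \<alpha>"
    by (rule fourier_L2_weighted[OF fi F \<phi>i \<phi>2i \<phi>b _ \<alpha>])
       (auto simp: \<phi>_def intro!: continuous_intros)
  also have "\<dots> \<le> \<alpha> * (X\<^sup>2 * F0) + \<rho> ^ DIM('a) * c / \<alpha>"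
    using \<alpha> by (intro add_mono mult_left_mono FX divide_right_mono \<phi>2) auto
  also have "\<dots> = \<rho> powr (d / 2) * X * (F0 + c)"
  proof -
    have "\<rho> ^ DIM('a) = \<rho> powr (d / 2) * \<rho> powr (d / 2)"
      using \<rho> by (simp add: d_def powr_realpow flip: powr_add)
    then show ?thesis
      using X \<rho> by (simp add: \<alpha>_def power2_eq_square field_simps)
  qed
  finally have low: "(\<integral>x. \<phi> x * \<bar>f x\<bar> \<partial>lborel) \<le> \<rho> powr (d / 2) * X * (F0 + c)" .
  have fm: "integrable lborel (\<lambda>x. jbr x powr m * \<bar>f x\<bar>)" using f by (simp add: L1w_def)
  have fk: "integrable lborel (\<lambda>x. jbr x powr k * \<bar>f x\<bar>)"
    using L1w_mono[OF f, of k] km by (simp add: L1w_def)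
  \<comment> \<open>Inside the radius the Gaussian is at least e^(-1/2), whence the factor
    \<open>exp (1/2)\<close>; outside, the surplus weight k - m < 0 is at most its value at
    \<rho>.\<close>
  have pw: "jbr x powr k \<le> \<rho> powr k * exp (1/2) * \<phi> x + \<rho> powr (k - m) * jbr x powr m" for x
  proof (cases "jbr x < \<rho>")
    case True
    have "norm x \<le> jbr x" unfolding jbr_def by (rule real_le_rsqrt) simp
    then have "norm x \<le> \<rho>" using True by simp
    then have "norm (inverse \<rho> *\<^sub>R x) \<le> 1" using \<rho> by (simp add: field_simps)
    then have "(norm (inverse \<rho> *\<^sub>R x))\<^sup>2 \<le> 1" by (simp add: power_le_one)
    then have "1 \<le> exp (1/2) * \<phi> x"
      unfolding \<phi>_def gauss_def by (simp add: mult_exp_exp)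
    moreover have "jbr x powr k \<le> \<rho> powr k"
      using True jbr_ge_1[of x] k by (intro powr_mono2) auto
    ultimately have "jbr x powr k * 1 \<le> \<rho> powr k * (exp (1/2) * \<phi> x)"
      by (intro mult_mono) auto
    then have "jbr x powr k \<le> \<rho> powr k * exp (1/2) * \<phi> x" by (simp add: mult.assoc)
    then show ?thesis by (rule add_increasing2[rotated]) simp
  next
    case False
    then have "jbr x powr (k - m) \<le> \<rho> powr (k - m)"
      using \<rho> km by (intro powr_mono2') auto
    then have "jbr x powr (k - m) * jbr x powr m \<le> \<rho> powr (k - m) * jbr x powr m"
      by (intro mult_right_mono) auto
    moreover have "jbr x powr (k - m) * jbr x powr m = jbr x powr k"
      by (simp flip: powr_add)
    moreover have "0 \<le> \<rho> powr k * exp (1/2) * \<phi> x" using \<phi>b(1)[of x] by simp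
    ultimately show ?thesis by simp
  qed
  have "L1w_norm k f \<le> (\<integral>x. \<rho> powr k * exp (1/2) * (\<phi> x * \<bar>f x\<bar>) + \<rho> powr (k - m) * (jbr x powr m * \<bar>f x\<bar>) \<partial>lborel)"
    unfolding L1w_norm_def
  proof (rule Bochner_Integration.integral_mono[OF fk])
    fix x
    show "jbr x powr k * \<bar>f x\<bar> \<le> \<rho> powr k * exp (1/2) * (\<phi> x * \<bar>f x\<bar>) + \<rho> powr (k - m) * (jbr x powr m * \<bar>f x\<bar>)"
      using mult_right_mono[OF pw[of x], of "\<bar>f x\<bar>"] by (simp add: algebra_simps)
  qed (intro Bochner_Integration.integrable_add integrable_mult_right \<phi>fi fm)
  also have "\<dots> = \<rho> powr k * exp (1/2) * (\<integral>x. \<phi> x * \<bar>f x\<bar> \<partial>lborel) + \<rho> powr (k - m) * L1w_norm m f"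
    unfolding L1w_norm_def using \<phi>fi fm
    by (subst Bochner_Integration.integral_add) auto
  also have "\<dots> \<le> \<rho> powr k * exp (1/2) * (\<rho> powr (d / 2) * X * (F0 + c)) + \<rho> powr (k - m) * A"
    by (intro add_mono mult_left_mono low A) auto
  also have "\<dots> = exp (1/2) * (F0 + c) * (\<rho> powr (k + d / 2) * X) + A * \<rho> powr (k - m)"
    by (simp add: powr_add algebra_simps)
  also have "\<rho> powr (k - m) = X powr \<theta>"
  proof -
    have "- 1 / (m + d / 2) * (k - m) = \<theta>"
      unfolding \<theta>_def using md by (simp add: field_simps)
    then show ?thesis by (simp only: \<rho>_def powr_powr)
  qed
  also have "\<rho> powr (k + d / 2) * X = X powr \<theta>"
  proof -
    have "- 1 / (m + d / 2) * (k + d / 2) + 1 = \<theta>"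
      unfolding \<theta>_def using md by (simp add: field_simps)
    then have "X powr (- 1 / (m + d / 2) * (k + d / 2)) * X powr 1 = X powr \<theta>"
      by (simp only: powr_add[symmetric])
    then show ?thesis using X by (simp add: \<rho>_def powr_powr)
  qed
  finally show ?thesis
    by (simp add: \<theta>_def d_def c_def distrib_right)
qed

section \<open>Growth and comparison of the symbols\<close>

lemma abs_ln_mult_le_1:
  fixes p :: real
  assumes "0 < p" "p \<le> 1"
  shows "p * \<bar>ln p\<bar> \<le> 1"
proof -
  have "\<bar>ln p\<bar> = ln (inverse p)" using assms by (simp add: ln_inverse)
  also have "\<dots> \<le> inverse p - 1" using assms by (intro ln_le_minus_one) auto
  finally have "p * \<bar>ln p\<bar> \<le> p * (inverse p - 1)" using assms by (intro mult_left_mono) auto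
  also have "\<dots> \<le> 1" using assms by (simp add: right_diff_distrib)
  finally show ?thesis .
qed

lemma japanese_powr_ge:
  fixes p \<eta> :: real
  assumes "0 < p" "0 \<le> \<eta>"
  shows "1 \<le> (1 + p\<^sup>2) powr (\<eta> / 2)" and "p powr \<eta> \<le> (1 + p\<^sup>2) powr (\<eta> / 2)"
proof -
  show "1 \<le> (1 + p\<^sup>2) powr (\<eta> / 2)" using assms by (intro ge_one_powr_ge_zero) auto
  have "p powr \<eta> = (p powr 2) powr (\<eta> / 2)" by (simp add: powr_powr)
  also have "\<dots> = (p\<^sup>2) powr (\<eta> / 2)" using assms by simp
  also have "\<dots> \<le> (1 + p\<^sup>2) powr (\<eta> / 2)" using assms by (intro powr_mono2) auto
  finally show "p powr \<eta> \<le> (1 + p\<^sup>2) powr (\<eta> / 2)" .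
qed

text \<open>The gap \<kappa> = \<eta> - 2 - \<delta> pays for the logarithm at high frequency
  through ln p \<le> p^\<kappa> / \<kappa>, the origin of the constant. At low frequency p |ln p|
  \<le> 1 suffices because 2s > 1. The second bound extracts the factor 1 - s from the difference of
  the two powers.\<close>

lemma powr_log_growth:
  fixes p s \<delta> \<eta> :: real
  assumes p: "0 < p" and s: "1/2 < s" "s < 1" and \<delta>: "0 < \<delta>" and \<eta>: "2 + \<delta> < \<eta>"
  shows "p powr (2 * s + \<delta>) * (1 + \<bar>ln p\<bar>) \<le> (2 + 1 / (\<eta> - 2 - \<delta>)) * (1 + p\<^sup>2) powr (\<eta> / 2)"
    and "\<bar>p powr (2 * s) - p\<^sup>2\<bar> \<le> 2 * (1 - s) * ((2 + 1 / (\<eta> - 2 - \<delta>)) * (1 + p\<^sup>2) powr (\<eta> / 2))"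
proof -
  define \<kappa> where "\<kappa> = \<eta> - 2 - \<delta>"
  define q where "q = (1 + p\<^sup>2) powr (\<eta> / 2)"
  have \<kappa>: "0 < \<kappa>" using \<eta> by (simp add: \<kappa>_def)
  have q: "1 \<le> q" "p powr \<eta> \<le> q" unfolding q_def using p \<delta> \<eta> by (intro japanese_powr_ge; simp)+
  have p2: "p\<^sup>2 = p powr 2" using p by simp
  \<comment> \<open>The inequality 1 + x \<le> e^x at x = -a ln p; it makes a difference of powers
    linear in the difference of exponents.\<close>
  have pow: "1 - p powr (- a) \<le> a * ln p" for a
    using exp_ge_add_one_self[of "- a * ln p"] p by (simp add: powr_def)
  have "p powr (2 * s + \<delta>) * (1 + \<bar>ln p\<bar>) \<le> (2 + 1 / \<kappa>) * q \<and>
      \<bar>p powr (2 * s) - p\<^sup>2\<bar> \<le> 2 * (1 - s) * ((2 + 1 / \<kappa>) * q)"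
  proof (cases "p \<le> 1")
    case True
    have small: "p powr a \<le> p" if "1 \<le> a" for a
      using powr_mono'[OF that, of p] p True by simp
    have "p powr (2 * s + \<delta>) * (1 + \<bar>ln p\<bar>) \<le> p * (1 + \<bar>ln p\<bar>)"
      using s \<delta> by (intro mult_right_mono small) auto
    also have "\<dots> \<le> 2" using abs_ln_mult_le_1[OF p True] True by (simp add: distrib_left)
    also have "\<dots> \<le> (2 + 1 / \<kappa>) * q"
      using mult_mono[of 2 "2 + 1 / \<kappa>" 1 q] \<kappa> q by simp
    finally have 1: "p powr (2 * s + \<delta>) * (1 + \<bar>ln p\<bar>) \<le> (2 + 1 / \<kappa>) * q" .
    have "p\<^sup>2 = p powr (2 * s) * p powr (- (2 * s - 2))"
      using p by (simp flip: powr_add)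
    then have "p powr (2 * s) - p\<^sup>2 = p powr (2 * s) * (1 - p powr (- (2 * s - 2)))"
      by (simp add: right_diff_distrib)
    also have "\<dots> \<le> p powr (2 * s) * ((2 * s - 2) * ln p)"
      by (intro mult_left_mono pow) auto
    also have "\<dots> = p powr (2 * s) * (2 * (1 - s) * \<bar>ln p\<bar>)"
      using p True by (simp add: algebra_simps)
    also have "\<dots> \<le> p * (2 * (1 - s) * \<bar>ln p\<bar>)"
      using s by (intro mult_right_mono small) auto
    also have "\<dots> = 2 * (1 - s) * (p * \<bar>ln p\<bar>)" by simp
    also have "\<dots> \<le> 2 * (1 - s) * ((2 + 1 / \<kappa>) * q)"
    proof (rule mult_left_mono)
      have "p * \<bar>ln p\<bar> \<le> 1 * 1" using abs_ln_mult_le_1[OF p True] by simp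
      also have "\<dots> \<le> (2 + 1 / \<kappa>) * q" using \<kappa> q by (intro mult_mono) auto
      finally show "p * \<bar>ln p\<bar> \<le> (2 + 1 / \<kappa>) * q" .
    qed (use s in auto)
    finally have "p powr (2 * s) - p\<^sup>2 \<le> 2 * (1 - s) * ((2 + 1 / \<kappa>) * q)" .
    moreover have "p\<^sup>2 \<le> p powr (2 * s)" unfolding p2 using p True s by (intro powr_mono') auto
    ultimately show ?thesis using 1 by simp
  next
    case False
    then have p1: "1 \<le> p" by simp
    have ln0: "0 \<le> ln p" using p1 by simp
    have ln: "ln p \<le> p powr \<kappa> / \<kappa>" using ln_powr_bound[OF p1 \<kappa>] .
    have "p powr (2 * s + \<delta>) * (1 + \<bar>ln p\<bar>) \<le> p powr (2 + \<delta>) * (1 + p powr \<kappa> / \<kappa>)"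
      using p1 s ln ln0 by (intro mult_mono powr_mono) auto
    also have "\<dots> = p powr (2 + \<delta>) + p powr (2 + \<delta> + \<kappa>) / \<kappa>"
      by (simp add: distrib_left powr_add)
    also have "\<dots> \<le> p powr \<eta> + p powr \<eta> / \<kappa>"
      using p1 \<eta> by (intro add_mono powr_mono) (auto simp: \<kappa>_def)
    also have "\<dots> \<le> q + q / \<kappa>"
      using q \<kappa> by (intro add_mono divide_right_mono) auto
    also have "\<dots> \<le> (2 + 1 / \<kappa>) * q" using q by (simp add: distrib_right)
    finally have 1: "p powr (2 * s + \<delta>) * (1 + \<bar>ln p\<bar>) \<le> (2 + 1 / \<kappa>) * q" .
    have "p powr (2 * s) = p powr 2 * p powr (- (2 - 2 * s))"
      unfolding powr_add[symmetric] by simp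
    then have "p\<^sup>2 - p powr (2 * s) = p powr 2 * (1 - p powr (- (2 - 2 * s)))"
      unfolding p2 by (simp add: right_diff_distrib)
    also have "\<dots> \<le> p powr 2 * ((2 - 2 * s) * ln p)"
      by (intro mult_left_mono pow) auto
    also have "\<dots> \<le> p powr 2 * ((2 - 2 * s) * (p powr \<kappa> / \<kappa>))"
      using s ln by (intro mult_left_mono) auto
    also have "\<dots> = 2 * (1 - s) * (p powr (2 + \<kappa>) / \<kappa>)"
      using \<kappa> by (simp add: powr_add field_simps)
    also have "\<dots> \<le> 2 * (1 - s) * ((2 + 1 / \<kappa>) * q)"
    proof (rule mult_left_mono)
      have "p powr (2 + \<kappa>) \<le> p powr \<eta>" using p1 \<delta> by (intro powr_mono) (auto simp: \<kappa>_def)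
      then have "p powr (2 + \<kappa>) / \<kappa> \<le> q / \<kappa>" using q \<kappa> by (intro divide_right_mono) auto
      also have "\<dots> \<le> (2 + 1 / \<kappa>) * q" using q by (simp add: distrib_right)
      finally show "p powr (2 + \<kappa>) / \<kappa> \<le> (2 + 1 / \<kappa>) * q" .
    qed (use s in auto)
    finally have "p\<^sup>2 - p powr (2 * s) \<le> 2 * (1 - s) * ((2 + 1 / \<kappa>) * q)" .
    moreover have "p powr (2 * s) \<le> p\<^sup>2" unfolding p2 using p1 s by (intro powr_mono) auto
    ultimately show ?thesis using 1 by simp
  qed
  then show "p powr (2 * s + \<delta>) * (1 + \<bar>ln p\<bar>) \<le> (2 + 1 / (\<eta> - 2 - \<delta>)) * (1 + p\<^sup>2) powr (\<eta> / 2)"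
    and "\<bar>p powr (2 * s) - p\<^sup>2\<bar> \<le> 2 * (1 - s) * ((2 + 1 / (\<eta> - 2 - \<delta>)) * (1 + p\<^sup>2) powr (\<eta> / 2))"
    by (simp_all add: \<kappa>_def q_def)
qed

lemma fourier_prob_density_0: "prob_density J \<Longrightarrow> fourier J 0 = 1"
  by (simp add: fourier_0 prob_density_def)

text \<open>The exponent \<^term>\<open>a\<close> stands for \<open>2s\<close>, so \<open>a = 2\<close> covers the limit kernel.\<close>

lemma one_minus_fourier_le:
  fixes J :: "'a::euclidean_space \<Rightarrow> real"
  assumes J: "prob_density J" and a: "0 < a" and \<delta>: "0 < \<delta>" and C0: "0 < C0"
    and bd: "\<And>\<xi>. norm \<xi> \<le> 1 \<Longrightarrow>
      cmod (fourier J \<xi> - (1 - complex_of_real (norm \<xi> powr a))) \<le> C0 * norm \<xi> powr (a + \<delta>)"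
  shows "cmod (1 - fourier J \<xi>) \<le> (2 + C0) * norm \<xi> powr a"
proof (cases "norm \<xi> \<le> 1")
  case True
  have "1 - fourier J \<xi> = complex_of_real (norm \<xi> powr a) - (fourier J \<xi> - (1 - complex_of_real (norm \<xi> powr a)))"
    by simp
  then have "cmod (1 - fourier J \<xi>) \<le> norm \<xi> powr a + C0 * norm \<xi> powr (a + \<delta>)"
    using norm_triangle_ineq4[of "complex_of_real (norm \<xi> powr a)" "fourier J \<xi> - (1 - complex_of_real (norm \<xi> powr a))"]
      bd[OF True] by simp
  also have "norm \<xi> powr (a + \<delta>) \<le> norm \<xi> powr a"
    using True a \<delta> by (intro powr_mono') auto
  finally have "cmod (1 - fourier J \<xi>) \<le> (1 + C0) * norm \<xi> powr a"
    using C0 by (simp add: distrib_right)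
  also have "\<dots> \<le> (2 + C0) * norm \<xi> powr a" by (intro mult_right_mono) auto
  finally show ?thesis .
next
  case False
  \<comment> \<open>Outside the unit ball the expansion says nothing, but |\<xi>|^a \<ge> 1 there
    and the trivial bound is enough; hence 2 + C0.\<close>
  have "cmod (1 - fourier J \<xi>) \<le> 2"
    using norm_triangle_ineq4[of 1 "fourier J \<xi>"] norm_fourier_prob_density_le[OF J, of \<xi>] by simp
  also have "\<dots> \<le> (2 + C0) * norm \<xi> powr a"
  proof -
    have "1 \<le> norm \<xi> powr a" using False a by (intro ge_one_powr_ge_zero) auto
    then show ?thesis using mult_mono[of 2 "2 + C0" 1 "norm \<xi> powr a"] C0 by simp
  qed
  finally show ?thesis .
qed

text \<open>The rate \<epsilon>^(-a) exactly offsets the factor \<epsilon>^a of the dilated symbol,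
  so the bound is free of \<epsilon>.\<close>

lemma rescaled_symbol_le:
  fixes J :: "'a::euclidean_space \<Rightarrow> real"
  assumes e: "0 < e" and bd: "cmod (1 - fourier J (e *\<^sub>R \<omega>)) \<le> B * norm (e *\<^sub>R \<omega>) powr a"
  shows "e powr (- a) * cmod (1 - fourier (rescale e J) \<omega>) \<le> B * norm \<omega> powr a"
proof -
  have "e powr (- a) * cmod (1 - fourier (rescale e J) \<omega>) \<le> e powr (- a) * (B * norm (e *\<^sub>R \<omega>) powr a)"
    unfolding fourier_rescale[OF e] using bd by (intro mult_left_mono) auto
  also have "\<dots> = B * norm \<omega> powr a * (e powr (- a) * e powr a)"
    using e by (simp add: powr_mult)
  also have "e powr (- a) * e powr a = 1" using e by (simp flip: powr_add)
  finally show ?thesis by simp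
qed

text \<open>Provides the linear bound required for the moments: r^a \<le> r for r \<le> 1 because a
  \<ge> 1, while a \<le> 2 bounds the growth along e^\<tau> by \<open>exp (2 * T)\<close>.\<close>

lemma rescaled_symbol_axis_le:
  fixes J :: "'a::euclidean_space \<Rightarrow> real"
  assumes e: "0 < e" and a: "1 \<le> a" "a \<le> 2" and B: "0 \<le> B"
    and bd: "\<And>\<xi>. cmod (1 - fourier J \<xi>) \<le> B * norm \<xi> powr a"
    and b: "b \<in> Basis" and r: "r \<in> {0<..1}" and \<tau>: "0 \<le> \<tau>" "\<tau> \<le> T"
  shows "e powr (- a) * cmod (1 - fourier (rescale e J) (exp \<tau> *\<^sub>R r *\<^sub>R b)) \<le> B * exp (2 * T) * r"
proof -
  have "e powr (- a) * cmod (1 - fourier (rescale e J) (exp \<tau> *\<^sub>R r *\<^sub>R b)) \<le> B * norm (exp \<tau> *\<^sub>R r *\<^sub>R b) powr a"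
    by (rule rescaled_symbol_le[OF e bd])
  also have "norm (exp \<tau> *\<^sub>R r *\<^sub>R b) powr a = exp (a * \<tau>) * r powr a"
    using b r by (simp add: powr_mult exp_powr_real mult.commute)
  also have "B * (exp (a * \<tau>) * r powr a) \<le> B * (exp (2 * T) * r)"
  proof (intro mult_left_mono mult_mono B)
    have "a * \<tau> \<le> 2 * T" using a \<tau> by (intro mult_mono) auto
    then show "exp (a * \<tau>) \<le> exp (2 * T)" by simp
    show "r powr a \<le> r" using powr_mono'[OF a(1), of r] r by simp
  qed auto
  finally show ?thesis by simp
qed

text \<open>With p = |\<omega>| and X, Y the quotients compared in (H2) at \<epsilon> \<omega>, the
  difference is, up to sign, p^(2s) (X - Y) + (p^(2s) - p^2) Y. (H2) makes the first term small and
  the closeness of the exponents the second; each yields a factor 1 - s.\<close>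

lemma symbol_difference_le:
  fixes J J1 :: "'a::euclidean_space \<Rightarrow> real"
  assumes e: "0 < e" "e < 1" and s: "1/2 < s" "s < 1" and \<delta>: "0 < \<delta>" and \<eta>: "2 + \<delta> < \<eta>"
    and J: "prob_density J" and J1: "prob_density J1" and B: "0 \<le> B" and CC: "0 \<le> CC"
    and bd: "\<And>\<xi>. cmod (1 - fourier J1 \<xi>) \<le> B * norm \<xi> powr 2"
    and H: "\<And>\<xi>. \<xi> \<noteq> 0 \<Longrightarrow>
         cmod ((1 - fourier J \<xi>) / complex_of_real (norm \<xi> powr (2 * s))
               - (1 - fourier J1 \<xi>) / complex_of_real ((norm \<xi>)\<^sup>2))
           \<le> CC * (1 - s) * norm \<xi> powr \<delta> * max 1 \<bar>ln (norm \<xi>)\<bar>"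
  shows "cmod (complex_of_real (e powr (- 2 * s)) * (fourier (rescale e J) \<omega> - 1)
      - complex_of_real (e powr (- 2)) * (fourier (rescale e J1) \<omega> - 1))
    \<le> (CC + 2 * B) * (2 + 1 / (\<eta> - 2 - \<delta>)) * ((1 - s) * (1 + e powr \<delta> * \<bar>ln e\<bar>)) * (1 + (norm \<omega>)\<^sup>2) powr (\<eta> / 2)"
\<comment> \<open>(H2) is silent at the origin, where both transforms equal 1 and the left-hand side
  vanishes.\<close>
proof (cases "\<omega> = 0")
  case True
  then show ?thesis
    using B CC \<eta> s by (simp add: fourier_rescale e fourier_prob_density_0[OF J] fourier_prob_density_0[OF J1])
next
  case False
  define p where "p = norm \<omega>"
  define E where "E = 1 + e powr \<delta> * \<bar>ln e\<bar>"
  define c where "c = 2 + 1 / (\<eta> - 2 - \<delta>)"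
  define q where "q = (1 + p\<^sup>2) powr (\<eta> / 2)"
  have p: "0 < p" using False by (simp add: p_def)
  have E: "1 \<le> E" by (simp add: E_def)
  note growth = powr_log_growth[OF p s \<delta> \<eta>, folded c_def q_def]
  have c: "0 \<le> c" using \<eta> by (simp add: c_def)
  have q: "0 \<le> q" by (simp add: q_def)
  define x where "x = 1 - fourier J (e *\<^sub>R \<omega>)"
  define y where "y = 1 - fourier J1 (e *\<^sub>R \<omega>)"
  define X where "X = x / complex_of_real ((e * p) powr (2 * s))"
  define Y where "Y = y / complex_of_real ((e * p)\<^sup>2)"
  have n: "norm (e *\<^sub>R \<omega>) = e * p" using e by (simp add: p_def)
  have ep: "0 < e * p" using e p by simp
  have es: "complex_of_real (e powr (- 2 * s)) * x = complex_of_real (p powr (2 * s)) * X"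
  proof -
    have "e powr (- 2 * s) * (e * p) powr (2 * s) = p powr (2 * s)"
      using e p by (simp add: powr_mult mult.assoc[symmetric] flip: powr_add)
    then have "complex_of_real (p powr (2 * s)) = complex_of_real (e powr (- 2 * s)) * complex_of_real ((e * p) powr (2 * s))"
      by (simp flip: of_real_mult)
    then show ?thesis unfolding X_def using ep e p by simp
  qed
  have e1: "complex_of_real (e powr (- 2)) * y = complex_of_real (p\<^sup>2) * Y"
  proof -
    have "e powr (- 2) * (e * p)\<^sup>2 = p\<^sup>2"
      using e by (simp add: powr_minus power_mult_distrib)
    then have "complex_of_real (p\<^sup>2) = complex_of_real (e powr (- 2)) * complex_of_real ((e * p)\<^sup>2)"
      by (simp only: of_real_mult[symmetric])
    then show ?thesis unfolding Y_def using ep e p by simp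
  qed
  have XY: "cmod (X - Y) \<le> CC * (1 - s) * (e * p) powr \<delta> * max 1 \<bar>ln (e * p)\<bar>"
    using H[of "e *\<^sub>R \<omega>"] False e unfolding X_def Y_def x_def y_def n by simp
  have Y: "cmod Y \<le> B"
  proof -
    have "cmod y \<le> B * (e * p)\<^sup>2" using bd[of "e *\<^sub>R \<omega>"] ep unfolding y_def n by simp
    moreover have "cmod Y = cmod y / (e * p)\<^sup>2"
      unfolding Y_def norm_divide norm_of_real by simp
    ultimately show ?thesis using zero_less_power[OF ep, of 2] by (simp only: pos_divide_le_eq)
  qed
  \<comment> \<open>ln(\<epsilon> p) splits into ln \<epsilon>, collected in \<open>E\<close> with
    the factor \<epsilon>^\<delta>, and ln p, left to the frequency weight.\<close>
  have logs: "e powr \<delta> * max 1 \<bar>ln (e * p)\<bar> \<le> E * (1 + \<bar>ln p\<bar>)"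
  proof -
    have ed: "e powr \<delta> \<le> 1" using e \<delta> by (intro powr_le1) auto
    have "ln (e * p) = ln e + ln p" using e p by (simp add: ln_mult)
    then have "max 1 \<bar>ln (e * p)\<bar> \<le> 1 + \<bar>ln e\<bar> + \<bar>ln p\<bar>"
      by (intro max.boundedI) linarith+
    then have "e powr \<delta> * max 1 \<bar>ln (e * p)\<bar> \<le> e powr \<delta> * (1 + \<bar>ln e\<bar> + \<bar>ln p\<bar>)"
      by (intro mult_left_mono) auto
    also have "\<dots> = e powr \<delta> + e powr \<delta> * \<bar>ln e\<bar> + e powr \<delta> * \<bar>ln p\<bar>" by (simp add: algebra_simps)
    also have "\<dots> \<le> 1 + e powr \<delta> * \<bar>ln e\<bar> + E * \<bar>ln p\<bar>"
      using ed E by (intro add_mono mult_right_mono) auto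
    also have "\<dots> = E * (1 + \<bar>ln p\<bar>)" by (simp add: E_def algebra_simps)
    finally show ?thesis .
  qed
  have "complex_of_real (e powr (- 2 * s)) * (fourier (rescale e J) \<omega> - 1)
      - complex_of_real (e powr (- 2)) * (fourier (rescale e J1) \<omega> - 1)
    = complex_of_real (e powr (- 2)) * y - complex_of_real (e powr (- 2 * s)) * x"
    unfolding fourier_rescale[OF e(1)] x_def y_def by (simp add: algebra_simps)
  also have "\<dots> = - (complex_of_real (p powr (2 * s)) * (X - Y) + complex_of_real (p powr (2 * s) - p\<^sup>2) * Y)"
    unfolding es e1 by (simp add: algebra_simps)
  also have "cmod \<dots> \<le> cmod (complex_of_real (p powr (2 * s)) * (X - Y)) + cmod (complex_of_real (p powr (2 * s) - p\<^sup>2) * Y)"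
    unfolding norm_minus_cancel by (rule norm_triangle_ineq)
  also have "\<dots> = p powr (2 * s) * cmod (X - Y) + \<bar>p powr (2 * s) - p\<^sup>2\<bar> * cmod Y"
    by (simp only: norm_mult norm_of_real abs_of_nonneg[OF powr_ge_zero])
  also have "\<dots> \<le> p powr (2 * s) * (CC * (1 - s) * (e * p) powr \<delta> * max 1 \<bar>ln (e * p)\<bar>) + 2 * (1 - s) * (c * q) * B"
    using XY Y growth(2) c q s by (intro add_mono mult_left_mono mult_mono) auto
  also have "p powr (2 * s) * (CC * (1 - s) * (e * p) powr \<delta> * max 1 \<bar>ln (e * p)\<bar>)
      = CC * (1 - s) * p powr (2 * s + \<delta>) * (e powr \<delta> * max 1 \<bar>ln (e * p)\<bar>)"
    using e p by (simp add: powr_mult powr_add mult_ac)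
  also have "\<dots> \<le> CC * (1 - s) * p powr (2 * s + \<delta>) * (E * (1 + \<bar>ln p\<bar>))"
    using CC s logs by (intro mult_left_mono) auto
  also have "\<dots> = CC * (1 - s) * E * (p powr (2 * s + \<delta>) * (1 + \<bar>ln p\<bar>))" by (simp add: mult_ac)
  also have "\<dots> \<le> CC * (1 - s) * E * (c * q)"
    using CC s E growth(1) by (intro mult_left_mono) auto
  also have "2 * (1 - s) * (c * q) * B \<le> 2 * (1 - s) * (c * q) * B * E"
    using E s c q B mult_left_mono[OF E, of "2 * (1 - s) * (c * q) * B"] by simp
  also have "CC * (1 - s) * E * (c * q) + 2 * (1 - s) * (c * q) * B * E = (CC + 2 * B) * c * ((1 - s) * E) * q"
    by (simp add: algebra_simps)
  finally show ?thesis
    by (simp only: p_def E_def c_def q_def)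
qed

section \<open>Comparison of two solutions and conclusion\<close>

lemma norm_exp_diff_le:
  fixes a b :: complex
  assumes "Re a \<le> 0" "Re b \<le> 0"
  shows "cmod (exp a - exp b) \<le> cmod (a - b)"
proof -
  have "cmod (exp a - exp b) \<le> 1 * cmod (a - b)"
  \<comment> \<open>Mean value inequality on the closed left half-plane, which is convex and where
    |exp| \<le> 1.\<close>
  proof (rule field_differentiable_bound)
    show "convex {z. Re z \<le> 0}" by (rule convex_halfspace_Re_le)
    show "(exp has_field_derivative exp z) (at z within {z. Re z \<le> 0})" for z :: complex
      by (rule DERIV_subset[OF DERIV_exp]) auto
    show "cmod (exp z) \<le> 1" if "z \<in> {z. Re z \<le> 0}" for z using that by simp
  qed (use assms in auto)
  then show ?thesis by simp
qed

text \<open>Both transforms are that of \<open>u0\<close> times exponentials whose exponents have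
  nonpositive real part, because |K^| \<le> 1. The exponential is 1-Lipschitz there, so the
  difference is at most the time integral of the difference of symbols, with no loss from large
  rates.\<close>

lemma mild_solution_fourier_difference:
  fixes K K1 u0 :: "'a::euclidean_space \<Rightarrow> real"
  assumes u: "mild_solution k lam K u0 u" and v: "mild_solution k lam1 K1 u0 v"
    and k: "0 \<le> k" and lam: "0 \<le> lam" "0 \<le> lam1" and t: "0 \<le> t" "t \<le> T"
    and K: "prob_density K" "prob_density K1" and u0: "integrable lborel u0"
    and X: "0 \<le> X" and \<eta>: "0 \<le> \<eta>"
    and H: "\<And>\<omega>. cmod (complex_of_real lam * (fourier K \<omega> - 1) - complex_of_real lam1 * (fourier K1 \<omega> - 1))
      \<le> X * (1 + (norm \<omega>)\<^sup>2) powr (\<eta> / 2)"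
  shows "cmod (fourier (u t) (exp t *\<^sub>R \<zeta>) - fourier (v t) (exp t *\<^sub>R \<zeta>)) \<le>
    (T * exp (\<eta> * T) * X) * (cmod (fourier u0 \<zeta>) * (1 + (norm \<zeta>)\<^sup>2) powr (\<eta> / 2))"
proof -
  define a where "a = (\<lambda>\<tau>. complex_of_real lam * (fourier K (exp \<tau> *\<^sub>R \<zeta>) - 1))"
  define b where "b = (\<lambda>\<tau>. complex_of_real lam1 * (fourier K1 (exp \<tau> *\<^sub>R \<zeta>) - 1))"
  define Y where "Y = exp (\<eta> * T) * X * (1 + (norm \<zeta>)\<^sup>2) powr (\<eta> / 2)"
  have fc: "continuous_on {0..t} (\<lambda>\<tau>. fourier L (exp \<tau> *\<^sub>R \<zeta>))" if "prob_density L" for L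
    by (rule continuous_on_compose2[OF continuous_fourier[of L UNIV]])
       (auto intro!: continuous_intros prob_densityD[OF that])
  have int: "set_integrable lborel {0..t} (\<lambda>\<tau>. complex_of_real c * (fourier L (exp \<tau> *\<^sub>R \<zeta>) - 1))" if "prob_density L" for L c
    by (intro borel_integrable_atLeastAtMost' continuous_intros fc that)
  have Re: "Re (LINT \<tau>:{0..t}|lborel. complex_of_real c * (fourier L (exp \<tau> *\<^sub>R \<zeta>) - 1)) \<le> 0"
    if L: "prob_density L" and c: "0 \<le> c" for L c
  proof -
    have "Re (LINT \<tau>:{0..t}|lborel. complex_of_real c * (fourier L (exp \<tau> *\<^sub>R \<zeta>) - 1)) =
       (\<integral>\<tau>. Re (indicator {0..t} \<tau> *\<^sub>R (complex_of_real c * (fourier L (exp \<tau> *\<^sub>R \<zeta>) - 1))) \<partial>lborel)"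
      unfolding set_lebesgue_integral_def using int[OF L, of c] by (subst integral_Re) (auto simp: set_integrable_def)
    also have "\<dots> \<le> (\<integral>\<tau>. 0 \<partial>(lborel :: real measure))"
    proof (rule integral_mono_AE'[OF _ AE_I2])
      fix \<tau>
      have "Re (fourier L (exp \<tau> *\<^sub>R \<zeta>)) \<le> 1"
        using complex_Re_le_cmod[of "fourier L (exp \<tau> *\<^sub>R \<zeta>)"] norm_fourier_prob_density_le[OF L, of "exp \<tau> *\<^sub>R \<zeta>"] by simp
      then show "Re (indicator {0..t} \<tau> *\<^sub>R (complex_of_real c * (fourier L (exp \<tau> *\<^sub>R \<zeta>) - 1))) \<le> 0"
        using c by (auto simp: mult_nonneg_nonpos split: split_indicator)
    qed auto
    finally show ?thesis by simp
  qed
  have bound: "cmod (a \<tau> - b \<tau>) \<le> Y" if \<tau>: "\<tau> \<in> {0..t}" for \<tau>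
  proof -
    have "cmod (a \<tau> - b \<tau>) \<le> X * (1 + (norm (exp \<tau> *\<^sub>R \<zeta>))\<^sup>2) powr (\<eta> / 2)"
      unfolding a_def b_def by (rule H)
    \<comment> \<open>Freezes the moving frequency: for \<tau> \<le> T the weight at e^\<tau>
      \<zeta> is at most \<open>exp (\<eta> * T)\<close> times the weight at \<zeta>.\<close>
    also have "\<dots> \<le> X * (exp (2 * T) * (1 + (norm \<zeta>)\<^sup>2)) powr (\<eta> / 2)"
    proof (intro mult_left_mono powr_mono2 X)
      have "(norm (exp \<tau> *\<^sub>R \<zeta>))\<^sup>2 = exp (2 * \<tau>) * (norm \<zeta>)\<^sup>2"
        by (simp add: power_mult_distrib exp_double)
      also have "\<dots> \<le> exp (2 * T) * (norm \<zeta>)\<^sup>2" using \<tau> t by (intro mult_right_mono) auto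
      finally show "1 + (norm (exp \<tau> *\<^sub>R \<zeta>))\<^sup>2 \<le> exp (2 * T) * (1 + (norm \<zeta>)\<^sup>2)"
        using t by (simp add: distrib_left add_mono)
    qed (use \<eta> in \<open>auto intro: add_nonneg_nonneg\<close>)
    also have "\<dots> = Y"
      by (simp add: Y_def powr_mult exp_powr_real mult_ac)
    finally show ?thesis .
  qed
  have "cmod ((LINT \<tau>:{0..t}|lborel. a \<tau>) - (LINT \<tau>:{0..t}|lborel. b \<tau>)) = cmod (LINT \<tau>:{0..t}|lborel. a \<tau> - b \<tau>)"
    unfolding a_def b_def by (subst set_integral_diff(2)) (auto intro: int K)
  also have "\<dots> \<le> (LINT \<tau>:{0..t}|lborel. cmod (a \<tau> - b \<tau>))"
    unfolding a_def b_def by (intro set_integral_norm_bound set_integral_diff(1) int K)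
  also have "\<dots> \<le> (LINT \<tau>:{0..t}|lborel. Y)"
    unfolding a_def b_def
    by (intro set_integral_mono set_integrable_norm set_integral_diff(1) int K bound[unfolded a_def b_def])
       (auto simp: set_integrable_def emeasure_lborel_Icc_eq intro!: integrable_mult_left)
  also have "\<dots> = t * Y" using t by (simp add: set_lebesgue_integral_def)
  also have "\<dots> \<le> T * Y" using t X by (intro mult_right_mono) (auto simp: Y_def)
  finally have d: "cmod ((LINT \<tau>:{0..t}|lborel. a \<tau>) - (LINT \<tau>:{0..t}|lborel. b \<tau>)) \<le> T * Y" .
  have "cmod (fourier (u t) (exp t *\<^sub>R \<zeta>) - fourier (v t) (exp t *\<^sub>R \<zeta>)) =
    cmod (fourier u0 \<zeta>) * cmod (exp (LINT \<tau>:{0..t}|lborel. a \<tau>) - exp (LINT \<tau>:{0..t}|lborel. b \<tau>))"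
    unfolding mild_solution_fourier[OF u k lam(1) t(1) K(1) u0] mild_solution_fourier[OF v k lam(2) t(1) K(2) u0]
    by (simp add: a_def b_def norm_mult flip: right_diff_distrib)
  also have "\<dots> \<le> cmod (fourier u0 \<zeta>) * (T * Y)"
    using order_trans[OF norm_exp_diff_le[OF Re[OF K(1) lam(1)] Re[OF K(2) lam(2)]] d[unfolded a_def b_def]]
    by (intro mult_left_mono) (auto simp: a_def b_def)
  finally show ?thesis by (simp add: Y_def mult_ac)
qed

text \<open>Squaring the pointwise bound turns the exponent \<eta>/2 into \<eta>, so exactly the
  Sobolev integral of the datum appears. The substitution \<xi> = e^t \<zeta> costs the Jacobian
  e^(dt).\<close>

lemma mild_solution_fourier_L2_difference:
  fixes K K1 u0 :: "'a::euclidean_space \<Rightarrow> real"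
  assumes u: "mild_solution k lam K u0 u" and v: "mild_solution k lam1 K1 u0 v"
    and k: "0 \<le> k" and lam: "0 \<le> lam" "0 \<le> lam1" and t: "0 \<le> t" "t \<le> T"
    and K: "prob_density K" "prob_density K1" and u0: "integrable lborel u0"
    and X: "0 \<le> X" and \<eta>: "0 \<le> \<eta>"
    and H: "\<And>\<omega>. cmod (complex_of_real lam * (fourier K \<omega> - 1) - complex_of_real lam1 * (fourier K1 \<omega> - 1))
      \<le> X * (1 + (norm \<omega>)\<^sup>2) powr (\<eta> / 2)"
    and S: "integrable lborel (\<lambda>\<xi>. (1 + (norm \<xi>)\<^sup>2) powr \<eta> * (cmod (fourier u0 \<xi>))\<^sup>2)"
  shows "integrable lborel (\<lambda>\<xi>. (cmod (fourier (\<lambda>x. u t x - v t x) \<xi>))\<^sup>2)"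
    and "(\<integral>\<xi>. (cmod (fourier (\<lambda>x. u t x - v t x) \<xi>))\<^sup>2 \<partial>lborel) \<le>
      X\<^sup>2 * (exp T ^ DIM('a) * (T * exp (\<eta> * T))\<^sup>2 *
        (\<integral>\<xi>. (1 + (norm \<xi>)\<^sup>2) powr \<eta> * (cmod (fourier u0 \<xi>))\<^sup>2 \<partial>lborel))"
proof -
  define D where "D = (\<lambda>\<xi>. (cmod (fourier (\<lambda>x. u t x - v t x) \<xi>))\<^sup>2)"
  define W where "W = (\<lambda>\<xi>. (1 + (norm \<xi>)\<^sup>2) powr \<eta> * (cmod (fourier u0 \<xi>))\<^sup>2)"
  define Q where "Q = (T * exp (\<eta> * T) * X)\<^sup>2"
  note ui = mild_solution_integrable[OF u k t(1)] and vi = mild_solution_integrable[OF v k t(1)]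
  have [measurable]: "D \<in> borel_measurable borel"
    unfolding D_def using fourier_measurable[OF Bochner_Integration.integrable_diff[OF ui vi]] by measurable
  have le: "D (exp t *\<^sub>R \<zeta>) \<le> Q * W \<zeta>" for \<zeta>
  proof -
    have "((1 + (norm \<zeta>)\<^sup>2) powr (\<eta> / 2))\<^sup>2 = (1 + (norm \<zeta>)\<^sup>2) powr \<eta>"
      by (simp add: power2_eq_square flip: powr_add)
    then have "Q * W \<zeta> = ((T * exp (\<eta> * T) * X) * (cmod (fourier u0 \<zeta>) * (1 + (norm \<zeta>)\<^sup>2) powr (\<eta> / 2)))\<^sup>2"
      by (simp add: Q_def W_def power_mult_distrib mult_ac)
    then show ?thesis
      unfolding D_def fourier_diff[OF ui vi]
      using mild_solution_fourier_difference[OF u v k lam t K u0 X \<eta> H, of \<zeta>] by (simp add: power_mono)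
  qed
  have D0: "0 \<le> D \<xi>" and W0: "0 \<le> W \<xi>" for \<xi> by (auto simp: D_def W_def)
  have Wi: "integrable lborel W" using S by (simp add: W_def)
  have i: "integrable lborel (\<lambda>\<zeta>. D (exp t *\<^sub>R \<zeta>))"
    by (rule Bochner_Integration.integrable_bound[OF integrable_mult_right[OF Wi, of Q]])
       (use le D0 in \<open>auto intro: order_trans[OF _ abs_ge_self]\<close>)
  then show "integrable lborel (\<lambda>\<xi>. (cmod (fourier (\<lambda>x. u t x - v t x) \<xi>))\<^sup>2)"
    using lborel_integrable_affine_iff[of "exp t" D 0] by (simp add: D_def)
  have "(\<integral>\<xi>. D \<xi> \<partial>lborel) = exp t ^ DIM('a) * (\<integral>\<zeta>. D (exp t *\<^sub>R \<zeta>) \<partial>lborel)"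
    using lborel_integral_affine[of "exp t" D 0] by simp
  also have "\<dots> \<le> exp T ^ DIM('a) * (\<integral>\<zeta>. Q * W \<zeta> \<partial>lborel)"
    using t D0 by (intro mult_mono power_mono Bochner_Integration.integral_mono i integrable_mult_right Wi le
        Bochner_Integration.integral_nonneg) auto
  also have "\<dots> = X\<^sup>2 * (exp T ^ DIM('a) * (T * exp (\<eta> * T))\<^sup>2 * (\<integral>\<zeta>. W \<zeta> \<partial>lborel))"
    by (simp add: Q_def power_mult_distrib mult_ac)
  finally show "(\<integral>\<xi>. (cmod (fourier (\<lambda>x. u t x - v t x) \<xi>))\<^sup>2 \<partial>lborel) \<le>
      X\<^sup>2 * (exp T ^ DIM('a) * (T * exp (\<eta> * T))\<^sup>2 *
        (\<integral>\<xi>. (1 + (norm \<xi>)\<^sup>2) powr \<eta> * (cmod (fourier u0 \<xi>))\<^sup>2 \<partial>lborel))"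
    by (simp add: D_def W_def)
qed

text \<open>Interpolation raises the logarithmic factor to the power \<theta>. Subadditivity
  separates its terms, and |ln \<epsilon>|^\<theta> \<le> 1 + |ln \<epsilon>| together with
  \<epsilon>^(\<delta> \<theta>) \<le> 1 restores the first power of the logarithm at the price of a
  factor 2.\<close>

lemma log_factor_powr_le:
  fixes e \<delta> \<theta> :: real
  assumes e: "0 < e" "e < 1" and \<delta>: "0 < \<delta>" and \<theta>: "0 < \<theta>" "\<theta> \<le> 1"
  shows "(1 + e powr \<delta> * \<bar>ln e\<bar>) powr \<theta> \<le> 2 * (1 + e powr (\<delta> * \<theta>) * \<bar>ln e\<bar>)"
proof -
  have "(1 + e powr \<delta> * \<bar>ln e\<bar>) powr \<theta> \<le> 1 powr \<theta> + (e powr \<delta> * \<bar>ln e\<bar>) powr \<theta>"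
    using \<theta> by (intro powr_add_le_add_powr) auto
  also have "\<dots> = 1 + e powr (\<delta> * \<theta>) * \<bar>ln e\<bar> powr \<theta>"
    by (simp add: powr_mult powr_powr)
  also have "\<dots> \<le> 1 + e powr (\<delta> * \<theta>) * (1 + \<bar>ln e\<bar>)"
  proof (intro add_left_mono mult_left_mono)
    show "\<bar>ln e\<bar> powr \<theta> \<le> 1 + \<bar>ln e\<bar>"
    proof (cases "\<bar>ln e\<bar> \<le> 1")
      case True
      then have "\<bar>ln e\<bar> powr \<theta> \<le> 1" using \<theta> by (intro powr_le1) auto
      then show ?thesis by linarith
    next
      case False
      then have "\<bar>ln e\<bar> powr \<theta> \<le> \<bar>ln e\<bar> powr 1" using \<theta> by (intro powr_mono) auto
      then show ?thesis using False by simp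
    qed
  qed auto
  also have "\<dots> \<le> 1 + (1 + e powr (\<delta> * \<theta>) * \<bar>ln e\<bar>)"
  proof -
    have "e powr (\<delta> * \<theta>) \<le> 1" using e \<delta> \<theta> by (intro powr_le1) auto
    then show ?thesis by (simp add: distrib_left)
  qed
  also have "\<dots> \<le> 2 * (1 + e powr (\<delta> * \<theta>) * \<bar>ln e\<bar>)" by simp
  finally show ?thesis .
qed



theorem theorem5p2:
  fixes J :: "real \<Rightarrow> 'a::euclidean_space \<Rightarrow> real"
    and J1 :: "'a \<Rightarrow> real"
    and u0 :: "'a \<Rightarrow> real"
    and us :: "real \<Rightarrow> real \<Rightarrow> real \<Rightarrow> 'a \<Rightarrow> real"
    and u :: "real \<Rightarrow> real \<Rightarrow> 'a \<Rightarrow> real"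
    and \<delta> k m M \<eta> :: real
  assumes "\<delta> > 0"
    and "H1 \<delta> J" and "H2 \<delta> J J1"
    and "0 \<le> k" "k < m" "m < M" "M \<le> 1"
    and "\<eta> > 2 + \<delta>"
    and "L1w M u0" and "sobolev_H \<eta> u0"
    and "\<And>s \<epsilon>. s \<in> {1/2<..<1} \<Longrightarrow> \<epsilon> \<in> {0<..<1} \<Longrightarrow>
           mild_solution k (\<epsilon> powr (- 2 * s)) (rescale \<epsilon> (J s)) u0 (us s \<epsilon>)"
    and "\<And>\<epsilon>. \<epsilon> \<in> {0<..<1} \<Longrightarrow>
           mild_solution k (\<epsilon> powr (- 2)) (rescale \<epsilon> J1) u0 (u \<epsilon>)"
  shows "\<forall>T>0. \<exists>C. \<forall>s\<in>{1/2<..<1}. \<forall>\<epsilon>\<in>{0<..<1}. \<forall>t\<in>{0..T}.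
           L1w_norm k (\<lambda>x. us s \<epsilon> t x - u \<epsilon> t x)
             \<le> C * (1 - s) powr ((m - k) / (m + real DIM('a) / 2))
                 * (1 + \<epsilon> powr (\<delta> * ((m - k) / (m + real DIM('a) / 2))) * \<bar>ln \<epsilon>\<bar>)"
proof (intro allI impI)
  fix T :: real assume T: "0 < T"
  note \<delta> = assms(1) and k = assms(4) and km = assms(5) and \<eta> = assms(8) and us = assms(11) and u = assms(12)
  \<comment> \<open>Since m < M \<le> 1 the order is strictly below 1, as the cosine representation
    requires.\<close>
  have m: "0 < m" "m < 1" using assms(4-7) by auto
  have u0M: "L1w m u0" using L1w_mono[OF assms(9)] assms(6) by simp
  have u0: "integrable lborel u0" using L1w_integrable(1)[OF _ u0M] m by simp
  define S where "S = (\<integral>\<xi>. (1 + (norm \<xi>)\<^sup>2) powr \<eta> * (cmod (fourier u0 \<xi>))\<^sup>2 \<partial>lborel)"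
  have S: "integrable lborel (\<lambda>\<xi>. (1 + (norm \<xi>)\<^sup>2) powr \<eta> * (cmod (fourier u0 \<xi>))\<^sup>2)"
    using assms(10) by (simp add: sobolev_H_def)
  have Jd: "prob_density (J s)" if "s \<in> {1/2<..<1}" for s
    using assms(2) that unfolding H1_def by blast
  obtain Cs where Cs: "0 < Cs" and Js: "\<And>s \<xi>. s \<in> {1/2<..<1} \<Longrightarrow> norm \<xi> \<le> 1 \<Longrightarrow>
      cmod (fourier (J s) \<xi> - (1 - complex_of_real (norm \<xi> powr (2 * s)))) \<le> Cs * norm \<xi> powr (2 * s + \<delta>)"
    using assms(2) unfolding H1_def by blast
  have J1d: "prob_density J1" using assms(3) unfolding H2_def by blast
  obtain C1 where C1: "0 < C1" and J1: "\<And>\<xi>. norm \<xi> \<le> 1 \<Longrightarrow>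
      cmod (fourier J1 \<xi> - (1 - complex_of_real ((norm \<xi>)\<^sup>2))) \<le> C1 * norm \<xi> powr (2 + \<delta>)"
    using assms(3) unfolding H2_def by blast
  obtain CC where CC: "0 < CC" and HH: "\<And>s \<xi>. s \<in> {1/2<..<1} \<Longrightarrow> \<xi> \<noteq> 0 \<Longrightarrow>
         cmod ((1 - fourier (J s) \<xi>) / complex_of_real (norm \<xi> powr (2 * s))
               - (1 - fourier J1 \<xi>) / complex_of_real ((norm \<xi>)\<^sup>2))
           \<le> CC * (1 - s) * norm \<xi> powr \<delta> * max 1 \<bar>ln (norm \<xi>)\<bar>"
    using assms(3) unfolding H2_def by blast
  have bs: "cmod (1 - fourier (J s) \<xi>) \<le> (2 + Cs) * norm \<xi> powr (2 * s)" if "s \<in> {1/2<..<1}" for s \<xi>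
    by (rule one_minus_fourier_le[OF Jd[OF that] _ \<delta> Cs Js[OF that]]) (use that in auto)
  have b1: "cmod (1 - fourier J1 \<xi>) \<le> (2 + C1) * norm \<xi> powr 2" for \<xi>
    by (rule one_minus_fourier_le[OF J1d _ \<delta> C1]) (use J1 in auto)
  \<comment> \<open>The uniform moment bound is invoked twice, with the symbol constant shared by
    the whole family and then with that of the limit kernel.\<close>
  have "0 \<le> (2 + Cs) * exp (2 * T)" using Cs by simp
  from moment_uniform[OF m u0M this less_imp_le[OF T]]
  obtain As where As: "\<forall>K k lam u t. mild_solution k lam K u0 u \<longrightarrow> 0 \<le> k \<longrightarrow> 0 \<le> lam \<longrightarrow> prob_density K \<longrightarrow>
     0 \<le> t \<longrightarrow> t \<le> T \<longrightarrow>
     (\<forall>b\<in>Basis. \<forall>r\<in>{0<..1}. \<forall>\<tau>\<in>{0..t}. lam * cmod (1 - fourier K (exp \<tau> *\<^sub>R r *\<^sub>R b)) \<le> (2 + Cs) * exp (2 * T) * r) \<longrightarrow>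
     L1w m (u t) \<and> L1w_norm m (u t) \<le> As" by blast
  have "0 \<le> (2 + C1) * exp (2 * T)" using C1 by simp
  from moment_uniform[OF m u0M this less_imp_le[OF T]]
  obtain A1 where A1: "\<forall>K k lam u t. mild_solution k lam K u0 u \<longrightarrow> 0 \<le> k \<longrightarrow> 0 \<le> lam \<longrightarrow> prob_density K \<longrightarrow>
     0 \<le> t \<longrightarrow> t \<le> T \<longrightarrow>
     (\<forall>b\<in>Basis. \<forall>r\<in>{0<..1}. \<forall>\<tau>\<in>{0..t}. lam * cmod (1 - fourier K (exp \<tau> *\<^sub>R r *\<^sub>R b)) \<le> (2 + C1) * exp (2 * T) * r) \<longrightarrow>
     L1w m (u t) \<and> L1w_norm m (u t) \<le> A1" by blast
  define \<theta> where "\<theta> = (m - k) / (m + real DIM('a) / 2)"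
  have \<theta>: "0 < \<theta>" "\<theta> \<le> 1"
  proof -
    have "0 < m + real DIM('a) / 2" using m by (simp add: add_pos_nonneg)
    then show "0 < \<theta>" "\<theta> \<le> 1" using km k by (auto simp: \<theta>_def divide_le_eq add_increasing2)
  qed
  define Q where "Q = (CC + 2 * (2 + C1)) * (2 + 1 / (\<eta> - 2 - \<delta>))"
  have Q: "0 \<le> Q" using CC C1 \<eta> by (simp add: Q_def)
  define F0 where "F0 = Q\<^sup>2 * (exp T ^ DIM('a) * (T * exp (\<eta> * T))\<^sup>2 * S)"
  \<comment> \<open>Fixed before s, \<epsilon> and t are chosen. The symbol constant
    \<open>Q\<close> sits in \<open>F0\<close>, so that only (1 - s) E is raised to the power
    \<theta>.\<close>
  define C where "C = exp (1/2) * (F0 + gauss_const TYPE('a)) + (As + A1)"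
  \<comment> \<open>The factor 2 comes from \<open>log_factor_powr_le\<close>; the absolute value is
    there because the signs of \<open>As\<close> and \<open>A1\<close> are not tracked.\<close>
  have "L1w_norm k (\<lambda>x. us s \<epsilon> t x - u \<epsilon> t x) \<le> 2 * \<bar>C\<bar> * (1 - s) powr \<theta> * (1 + \<epsilon> powr (\<delta> * \<theta>) * \<bar>ln \<epsilon>\<bar>)"
    if s: "s \<in> {1/2<..<1}" and \<epsilon>: "\<epsilon> \<in> {0<..<1}" and t: "t \<in> {0..T}" for s \<epsilon> t
  proof -
    have e: "0 < \<epsilon>" "\<epsilon> < 1" and s': "1/2 < s" "s < 1" and t': "0 \<le> t" "t \<le> T" using \<epsilon> s t by auto
    note ms = us[OF s \<epsilon>] and mu = u[OF \<epsilon>]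
    note ds = prob_density_rescale[OF e(1) Jd[OF s]] and d1 = prob_density_rescale[OF e(1) J1d]
    have Ls: "L1w m (us s \<epsilon> t) \<and> L1w_norm m (us s \<epsilon> t) \<le> As"
    proof (rule As[rule_format, OF ms k _ ds t'], simp)
      fix b :: 'a and r \<tau> :: real assume "b \<in> Basis" "r \<in> {0<..1}" "\<tau> \<in> {0..t}"
      then show "\<epsilon> powr (- 2 * s) * cmod (1 - fourier (rescale \<epsilon> (J s)) (exp \<tau> *\<^sub>R r *\<^sub>R b)) \<le> (2 + Cs) * exp (2 * T) * r"
        using rescaled_symbol_axis_le[OF e(1) _ _ _ bs[OF s], of b r \<tau> T] s' Cs t' by simp
    qed
    have Lu: "L1w m (u \<epsilon> t) \<and> L1w_norm m (u \<epsilon> t) \<le> A1"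
    proof (rule A1[rule_format, OF mu k _ d1 t'], simp)
      fix b :: 'a and r \<tau> :: real assume "b \<in> Basis" "r \<in> {0<..1}" "\<tau> \<in> {0..t}"
      then show "\<epsilon> powr (- 2) * cmod (1 - fourier (rescale \<epsilon> J1) (exp \<tau> *\<^sub>R r *\<^sub>R b)) \<le> (2 + C1) * exp (2 * T) * r"
        using rescaled_symbol_axis_le[OF e(1) _ _ _ b1, of b r \<tau> T] C1 t' by simp
    qed
    define E where "E = 1 + \<epsilon> powr \<delta> * \<bar>ln \<epsilon>\<bar>"
    define X where "X = (1 - s) * E"
    have E: "0 < E" by (simp add: E_def add_pos_nonneg)
    have X: "0 < X" using s' E by (simp add: X_def)
    have sym: "cmod (complex_of_real (\<epsilon> powr (- 2 * s)) * (fourier (rescale \<epsilon> (J s)) \<omega> - 1)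
      - complex_of_real (\<epsilon> powr (- 2)) * (fourier (rescale \<epsilon> J1) \<omega> - 1))
      \<le> (Q * X) * (1 + (norm \<omega>)\<^sup>2) powr (\<eta> / 2)" for \<omega>
      unfolding Q_def X_def E_def
      by (rule symbol_difference_le[OF e s' \<delta> \<eta> Jd[OF s] J1d _ _ b1 HH[OF s]]) (use C1 CC in auto)
    have lam: "0 \<le> \<epsilon> powr (- 2 * s)" "0 \<le> \<epsilon> powr (- 2)" by auto
    have QX: "0 \<le> Q * X" using Q X by simp
    have \<eta>0: "0 \<le> \<eta>" using \<eta> \<delta> by simp
    note L2 = mild_solution_fourier_L2_difference[OF ms mu k lam t' ds d1 u0 QX \<eta>0 sym S]
    have "L1w_norm k (\<lambda>x. us s \<epsilon> t x - u \<epsilon> t x) \<le> C * X powr \<theta>"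
      unfolding C_def \<theta>_def
    proof (rule L1w_norm_interpolation[OF k km _ _ L2(1) _ X])
      show "L1w m (\<lambda>x. us s \<epsilon> t x - u \<epsilon> t x)" using Ls Lu by (intro L1w_diff) auto
      show "L1w_norm m (\<lambda>x. us s \<epsilon> t x - u \<epsilon> t x) \<le> As + A1"
        using L1w_norm_diff_le[of m "us s \<epsilon> t" "u \<epsilon> t"] Ls Lu by simp
      show "(\<integral>\<xi>. (cmod (fourier (\<lambda>x. us s \<epsilon> t x - u \<epsilon> t x) \<xi>))\<^sup>2 \<partial>lborel) \<le> X\<^sup>2 * F0"
        using L2(2) by (simp add: F0_def S_def power_mult_distrib mult_ac)
    qed
    also have "\<dots> \<le> \<bar>C\<bar> * X powr \<theta>" by (intro mult_right_mono) auto
    also have "X powr \<theta> = (1 - s) powr \<theta> * E powr \<theta>"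
      unfolding X_def using s' E by (simp add: powr_mult)
    also have "\<bar>C\<bar> * ((1 - s) powr \<theta> * E powr \<theta>) \<le> \<bar>C\<bar> * ((1 - s) powr \<theta> * (2 * (1 + \<epsilon> powr (\<delta> * \<theta>) * \<bar>ln \<epsilon>\<bar>)))"
      unfolding E_def by (intro mult_left_mono log_factor_powr_le e \<delta> \<theta>) auto
    finally show ?thesis by (simp add: algebra_simps)
  qed
  then show "\<exists>C. \<forall>s\<in>{1/2<..<1}. \<forall>\<epsilon>\<in>{0<..<1}. \<forall>t\<in>{0..T}.
           L1w_norm k (\<lambda>x. us s \<epsilon> t x - u \<epsilon> t x)
             \<le> C * (1 - s) powr ((m - k) / (m + real DIM('a) / 2))
                 * (1 + \<epsilon> powr (\<delta> * ((m - k) / (m + real DIM('a) / 2))) * \<bar>ln \<epsilon>\<bar>)"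
    unfolding \<theta>_def by blast
qed

end
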